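(* Let $n$ be a positive integer, let $\rho$ be an equivalence relation on $\mathbf{N}=\{1,\dots,n\}$ and let $S_\rho$ be the corresponding Young subgroup of $S_n$. For $i=1,\dots,n$ let $k_i$ be the number of blocks of $\rho$ of cardinality $i$ and let $\mathbf{k}=(k_1,\dots,k_n)$. Then we have the following decomposition of left $\mathcal{FP}^+(S_n)$-modules: $$\mathbb{C}[S_n/S_\rho]\cong\bigoplus_{\mathbf{l}\vdash\mathbf{k}}\dim(S^{\mathbf{l}})\,L(S_\rho,S^{\mathbf{l}}),$$ where $\dim(S^{\mathbf{l}})\,L$ denotes the direct sum of $\dim(S^{\mathbf{l}})$ copies of $L$.
   Context: $\mathcal{FP}^+(S_n)$ is the finite monoid whose elements are the classes $\overline{A}$ of nonempty subsets $A\subset S_n$ under the congruence $A\sim B$ iff $\{a(m)\mid a\in A\}=\{b(m)\mid b\in B\}$ for all $m\in\mathbf{N}$, with multiplication $\overline{A}\,\overline{B}=\overline{AB}$, where $AB=\{ab\mid a\in A,b\in B\}$. If $\rho$ has blocks $N_1,\dots,N_r$, then $S_\rho=S_{N_1}\times\dots\times S_{N_r}\subset S_n$ is the group of all permutations preserving every block; $\overline{S_\rho}$ is an idempotent. Let $\mathrm{N}=\mathrm{N}_{S_n}(S_\rho)$ be the normalizer. Then $\mathrm{N}/S_\rho\cong S_{k_1}\times\dots\times S_{k_n}$ (permuting blocks of equal cardinality; $S_0$ is the trivial group), and $X\mapsto\overline{X}$ identifies $\mathrm{N}/S_\rho$ with the maximal subgroup of $\mathcal{FP}^+(S_n)$ with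 identity $\overline{S_\rho}$. A partition $\mathbf{l}\vdash\mathbf{k}$ is a tuple $\mathbf{l}=(l_1,\dots,l_n)$ where each $l_i$ is a partition of $k_i$; $S^{\mathbf{l}}$ is the simple complex $\mathrm{N}/S_\rho$-module given by the outer tensor product of the Specht modules of $S_{k_i}$ corresponding to $l_i$. The $\mathcal{L}$-class $\mathcal{L}_\rho$ of $\overline{S_\rho}$ consists of the elements $\overline{\tau S_\rho}$, $\tau\in S_n$, and $\tau S_\rho\mapsto\overline{\tau S_\rho}$ is a bijection $S_n/S_\rho\to\mathcal{L}_\rho$. Via this bijection $\mathbb{C}[S_n/S_\rho]$ is an $\mathcal{FP}^+(S_n)$-$\mathrm{N}/S_\rho$-bimodule: for $s\in\mathcal{FP}^+(S_n)$, $x\in\mathcal{L}_\rho$, $g\in\mathrm{N}/S_\rho$ one sets $s\cdot x\cdot g=sxg$ if $sxg\in\mathcal{L}_\rho$, and $0$ otherwise. For a simple $\mathrm{N}/S_\rho$-module $X$, $L(S_\rho,X)=\mathbb{C}[S_n/S_\rho]\otimes_{\mathrm{N}/S_\rho}X$, with the induced left $\mathcal{FP}^+(S_n)$-module structure. *)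

theory Defs
  imports
    "HOL-Algebra.Module"
    "HOL-Algebra.Left_Coset"
    "HOL-Algebra.Group_Action"
    "HOL-Algebra.Sym_Groups"
    "HOL-Algebra.Product_Groups"
    "HOL-Library.Poly_Mapping"
    Complex_Main
begin

definition complex_ring :: "complex ring"
  where "complex_ring = \<lparr>carrier = UNIV, monoid.mult = (*), one = 1, zero = 0, add = (+)\<rparr>"

text \<open>
  A left module over the monoid algebra of \<open>S\<close> is a complex vector space with a linear action
  of \<open>S\<close>. As usual for module records, the inherited fields \<open>mult\<close> and \<open>one\<close> play no role and
  are left undefined below.
\<close>

record ('s, 'v) cmodule = "(complex, 'v) module" +
  act :: "'s \<Rightarrow> 'v \<Rightarrow> 'v"

record ('s, 'g, 'v) cbimodule = "('s, 'v) cmodule" +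
  ract :: "'v \<Rightarrow> 'g \<Rightarrow> 'v"

definition left_module :: "('s, 'a) monoid_scheme \<Rightarrow> ('s, 'v, 'b) cmodule_scheme \<Rightarrow> bool"
  where "left_module S M \<longleftrightarrow>
    Module.module complex_ring M \<and>
    (\<forall>s\<in>carrier S. \<forall>x\<in>carrier M. act M s x \<in> carrier M) \<and>
    (\<forall>s\<in>carrier S. \<forall>x\<in>carrier M. \<forall>y\<in>carrier M.
       act M s (x \<oplus>\<^bsub>M\<^esub> y) = act M s x \<oplus>\<^bsub>M\<^esub> act M s y) \<and>
    (\<forall>s\<in>carrier S. \<forall>c. \<forall>x\<in>carrier M. act M s (c \<odot>\<^bsub>M\<^esub> x) = c \<odot>\<^bsub>M\<^esub> act M s x) \<and>
    (\<forall>s\<in>carrier S. \<forall>t\<in>carrier S. \<forall>x\<in>carrier M.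
       act M (s \<otimes>\<^bsub>S\<^esub> t) x = act M s (act M t x)) \<and>
    (\<forall>x\<in>carrier M. act M \<one>\<^bsub>S\<^esub> x = x)"

definition left_module_iso ::
    "('s, 'a) monoid_scheme \<Rightarrow> ('s, 'v, 'b) cmodule_scheme \<Rightarrow> ('s, 'w, 'c) cmodule_scheme \<Rightarrow> bool"
  where "left_module_iso S M N \<longleftrightarrow>
    left_module S M \<and> left_module S N \<and>
    (\<exists>f. bij_betw f (carrier M) (carrier N) \<and>
      (\<forall>x\<in>carrier M. \<forall>y\<in>carrier M. f (x \<oplus>\<^bsub>M\<^esub> y) = f x \<oplus>\<^bsub>N\<^esub> f y) \<and>
      (\<forall>c. \<forall>x\<in>carrier M. f (c \<odot>\<^bsub>M\<^esub> x) = c \<odot>\<^bsub>N\<^esub> f x) \<and>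
      (\<forall>s\<in>carrier S. \<forall>x\<in>carrier M. f (act M s x) = act N s (f x)))"

definition direct_sum :: "'i set \<Rightarrow> ('i \<Rightarrow> ('s, 'v, 'b) cmodule_scheme) \<Rightarrow> ('s, 'i \<Rightarrow> 'v) cmodule"
  where "direct_sum I M =
    \<lparr>carrier = {f \<in> \<Pi>\<^sub>E i\<in>I. carrier (M i). finite {i\<in>I. f i \<noteq> \<zero>\<^bsub>M i\<^esub>}},
     monoid.mult = undefined, one = undefined,
     zero = (\<lambda>i\<in>I. \<zero>\<^bsub>M i\<^esub>),
     add = (\<lambda>f g. \<lambda>i\<in>I. f i \<oplus>\<^bsub>M i\<^esub> g i),
     smult = (\<lambda>c f. \<lambda>i\<in>I. c \<odot>\<^bsub>M i\<^esub> f i),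
     act = (\<lambda>s f. \<lambda>i\<in>I. act (M i) s (f i))\<rparr>"

definition copies :: "nat \<Rightarrow> ('s, 'v, 'b) cmodule_scheme \<Rightarrow> ('s, nat \<Rightarrow> 'v) cmodule"
  where "copies d M = direct_sum {..<d} (\<lambda>_. M)"

definition pullback :: "('g \<Rightarrow> 'h) \<Rightarrow> ('h, 'v) cmodule \<Rightarrow> ('g, 'v) cmodule"
  where "pullback h M =
    \<lparr>carrier = carrier M, monoid.mult = undefined, one = undefined, zero = \<zero>\<^bsub>M\<^esub>,
     add = add M, smult = smult M, act = (\<lambda>g. act M (h g))\<rparr>"

definition pscale :: "complex \<Rightarrow> ('b \<Rightarrow>\<^sub>0 complex) \<Rightarrow> ('b \<Rightarrow>\<^sub>0 complex)"
  where "pscale c f = Poly_Mapping.map ((*) c) f"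

lemma lookup_pscale [simp]: "Poly_Mapping.lookup (pscale c f) b = c * Poly_Mapping.lookup f b"
  unfolding pscale_def by (simp add: Poly_Mapping.map.rep_eq when_def)

global_interpretation pm: vector_space "pscale :: complex \<Rightarrow> ('b \<Rightarrow>\<^sub>0 complex) \<Rightarrow> _"
  by unfold_locales (rule poly_mapping_eqI, simp add: lookup_add algebra_simps)+

definition basis_vec :: "'b \<Rightarrow> ('b \<Rightarrow>\<^sub>0 complex)"
  where "basis_vec b = Poly_Mapping.single b 1"

definition free_on :: "'b set \<Rightarrow> ('b \<Rightarrow>\<^sub>0 complex) set"
  where "free_on B = {f. Poly_Mapping.keys f \<subseteq> B}"

definition lin_ext :: "('b \<Rightarrow> ('c \<Rightarrow>\<^sub>0 complex)) \<Rightarrow> ('b \<Rightarrow>\<^sub>0 complex) \<Rightarrow> ('c \<Rightarrow>\<^sub>0 complex)"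
  where "lin_ext h f = (\<Sum>b\<in>Poly_Mapping.keys f. pscale (Poly_Mapping.lookup f b) (h b))"

definition sub_free :: "('b \<Rightarrow>\<^sub>0 complex) set \<Rightarrow> ('s \<Rightarrow> ('b \<Rightarrow>\<^sub>0 complex) \<Rightarrow> ('b \<Rightarrow>\<^sub>0 complex))
    \<Rightarrow> ('s, 'b \<Rightarrow>\<^sub>0 complex) cmodule"
  where "sub_free V a =
    \<lparr>carrier = V, monoid.mult = undefined, one = undefined, zero = 0, add = (+), smult = pscale,
     act = a\<rparr>"

text \<open>
  \<open>tensor_over G M X\<close> is the tensor product over the group algebra of \<open>G\<close> of the bimodule \<open>M\<close>
  and the left module \<open>X\<close>: the free vector space on \<open>carrier M \<times> carrier X\<close> modulo the span of
  the bilinearity relations and of \<open>(x g, y) - (x, g y)\<close>.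
\<close>

definition tensor_rels :: "('g, 'a) monoid_scheme \<Rightarrow> ('s, 'g, 'v, 'b) cbimodule_scheme
    \<Rightarrow> ('g, 'w, 'c) cmodule_scheme \<Rightarrow> (('v \<times> 'w) \<Rightarrow>\<^sub>0 complex) set"
  where "tensor_rels G M X =
      {basis_vec (x \<oplus>\<^bsub>M\<^esub> x', y) - basis_vec (x, y) - basis_vec (x', y) | x x' y.
         x \<in> carrier M \<and> x' \<in> carrier M \<and> y \<in> carrier X}
    \<union> {basis_vec (x, y \<oplus>\<^bsub>X\<^esub> y') - basis_vec (x, y) - basis_vec (x, y') | x y y'.
         x \<in> carrier M \<and> y \<in> carrier X \<and> y' \<in> carrier X}
    \<union> {basis_vec (c \<odot>\<^bsub>M\<^esub> x, y) - pscale c (basis_vec (x, y)) | c x y.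
         x \<in> carrier M \<and> y \<in> carrier X}
    \<union> {basis_vec (x, c \<odot>\<^bsub>X\<^esub> y) - pscale c (basis_vec (x, y)) | c x y.
         x \<in> carrier M \<and> y \<in> carrier X}
    \<union> {basis_vec (ract M x g, y) - basis_vec (x, act X g y) | x g y.
         x \<in> carrier M \<and> g \<in> carrier G \<and> y \<in> carrier X}"

definition tensor_cong :: "('g, 'a) monoid_scheme \<Rightarrow> ('s, 'g, 'v, 'b) cbimodule_scheme
    \<Rightarrow> ('g, 'w, 'c) cmodule_scheme \<Rightarrow> ((('v \<times> 'w) \<Rightarrow>\<^sub>0 complex) \<times> (('v \<times> 'w) \<Rightarrow>\<^sub>0 complex)) set"
  where "tensor_cong G M X =
    {(f, h). f \<in> free_on (carrier M \<times> carrier X) \<and> h \<in> free_on (carrier M \<times> carrier X) \<and>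
             f - h \<in> pm.span (tensor_rels G M X)}"

definition tensor_over :: "('g, 'a) monoid_scheme \<Rightarrow> ('s, 'g, 'v, 'b) cbimodule_scheme
    \<Rightarrow> ('g, 'w, 'c) cmodule_scheme \<Rightarrow> ('s, (('v \<times> 'w) \<Rightarrow>\<^sub>0 complex) set) cmodule"
  where "tensor_over G M X =
    (let cl = (\<lambda>f. tensor_cong G M X `` {f}) in
     \<lparr>carrier = free_on (carrier M \<times> carrier X) // tensor_cong G M X,
      monoid.mult = undefined, one = undefined,
      zero = cl 0,
      add = (\<lambda>C D. \<Union>f\<in>C. \<Union>h\<in>D. cl (f + h)),
      smult = (\<lambda>c C. \<Union>f\<in>C. cl (pscale c f)),
      act = (\<lambda>s C. \<Union>f\<in>C. cl (lin_ext (\<lambda>(x, y). basis_vec (act M s x, y)) f))\<rparr>)"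

text \<open>
  Outer tensor product of modules \<open>V i\<close> over groups, for finite \<open>I\<close>, where \<open>V i\<close> is a subspace of
  a free vector space with an action that is the restriction of a linear action on the whole free
  space. The tensor product of these free spaces is identified with the free space on tuples
  of basis elements; the tensor product of the \<open>V i\<close> is then the span of the pure tensors.
\<close>

definition pure_tensor :: "'i set \<Rightarrow> ('i \<Rightarrow> ('b \<Rightarrow>\<^sub>0 complex)) \<Rightarrow> (('i \<Rightarrow> 'b) \<Rightarrow>\<^sub>0 complex)"
  where "pure_tensor I v =
    (\<Sum>x\<in>(\<Pi>\<^sub>E i\<in>I. Poly_Mapping.keys (v i)).
       pscale (\<Prod>i\<in>I. Poly_Mapping.lookup (v i) (x i)) (basis_vec x))"

definition outer_tensor :: "'i set \<Rightarrow> ('i \<Rightarrow> ('g, 'b \<Rightarrow>\<^sub>0 complex) cmodule)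
    \<Rightarrow> ('i \<Rightarrow> 'g, ('i \<Rightarrow> 'b) \<Rightarrow>\<^sub>0 complex) cmodule"
  where "outer_tensor I V =
    sub_free (pm.span {pure_tensor I v | v. v \<in> (\<Pi>\<^sub>E i\<in>I. carrier (V i))})
      (\<lambda>g. lin_ext (\<lambda>x. pure_tensor I (\<lambda>i. act (V i) (g i) (basis_vec (x i)))))"

definition partitions_of :: "nat \<Rightarrow> nat list set"
  where "partitions_of k = {l. sorted_wrt (\<ge>) l \<and> (\<forall>a\<in>set l. 0 < a) \<and> sum_list l = k}"

definition multipartitions :: "nat \<Rightarrow> (nat \<Rightarrow> nat) \<Rightarrow> (nat \<Rightarrow> nat list) set"
  where "multipartitions n k = (\<Pi>\<^sub>E i\<in>{1..n}. partitions_of (k i))"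

definition diagram :: "nat list \<Rightarrow> (nat \<times> nat) set"
  where "diagram l = {(i, j). i < length l \<and> j < l ! i}"

definition diagram_row :: "nat list \<Rightarrow> nat \<Rightarrow> (nat \<times> nat) set"
  where "diagram_row l i = {c \<in> diagram l. fst c = i}"

definition diagram_col :: "nat list \<Rightarrow> nat \<Rightarrow> (nat \<times> nat) set"
  where "diagram_col l j = {c \<in> diagram l. snd c = j}"

definition tableaux :: "nat \<Rightarrow> nat list \<Rightarrow> (nat \<times> nat \<Rightarrow> nat) set"
  where "tableaux k l = {t \<in> extensional (diagram l). bij_betw t (diagram l) {1..k}}"

definition tableau_act :: "nat list \<Rightarrow> (nat \<Rightarrow> nat) \<Rightarrow> (nat \<times> nat \<Rightarrow> nat) \<Rightarrow> (nat \<times> nat \<Rightarrow> nat)"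
  where "tableau_act l p t = (\<lambda>c\<in>diagram l. p (t c))"

definition row_equiv :: "nat \<Rightarrow> nat list \<Rightarrow> ((nat \<times> nat \<Rightarrow> nat) \<times> (nat \<times> nat \<Rightarrow> nat)) set"
  where "row_equiv k l =
    {(t, u). t \<in> tableaux k l \<and> u \<in> tableaux k l \<and>
             (\<forall>i. t ` diagram_row l i = u ` diagram_row l i)}"

text \<open>A tabloid is a row equivalence class of tableaux.\<close>

definition tabloid_act ::
    "nat list \<Rightarrow> (nat \<Rightarrow> nat) \<Rightarrow> (nat \<times> nat \<Rightarrow> nat) set \<Rightarrow> (nat \<times> nat \<Rightarrow> nat) set"
  where "tabloid_act l p T = tableau_act l p ` T"

definition column_stabilizer :: "nat \<Rightarrow> nat list \<Rightarrow> (nat \<times> nat \<Rightarrow> nat) \<Rightarrow> (nat \<Rightarrow> nat) set"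
  where "column_stabilizer k l t =
    {p \<in> carrier (sym_group k). \<forall>j. p ` (t ` diagram_col l j) = t ` diagram_col l j}"

definition polytabloid ::
    "nat \<Rightarrow> nat list \<Rightarrow> (nat \<times> nat \<Rightarrow> nat) \<Rightarrow> ((nat \<times> nat \<Rightarrow> nat) set \<Rightarrow>\<^sub>0 complex)"
  where "polytabloid k l t =
    (\<Sum>p\<in>column_stabilizer k l t.
       pscale (of_int (sign p)) (basis_vec (tabloid_act l p (row_equiv k l `` {t}))))"

definition specht ::
    "nat \<Rightarrow> nat list \<Rightarrow> (nat \<Rightarrow> nat, (nat \<times> nat \<Rightarrow> nat) set \<Rightarrow>\<^sub>0 complex) cmodule"
  where "specht k l =
    sub_free (pm.span (polytabloid k l ` tableaux k l))
      (\<lambda>p. lin_ext (\<lambda>T. basis_vec (tabloid_act l p T)))"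

definition fp_rel :: "nat \<Rightarrow> ((nat \<Rightarrow> nat) set \<times> (nat \<Rightarrow> nat) set) set"
  where "fp_rel n =
    {(A, B). A \<noteq> {} \<and> A \<subseteq> carrier (sym_group n) \<and> B \<noteq> {} \<and> B \<subseteq> carrier (sym_group n) \<and>
             (\<forall>m\<in>{1..n}. {a m | a. a \<in> A} = {b m | b. b \<in> B})}"

definition fp_class :: "nat \<Rightarrow> (nat \<Rightarrow> nat) set \<Rightarrow> (nat \<Rightarrow> nat) set set"
  where "fp_class n A = fp_rel n `` {A}"

definition fp_monoid :: "nat \<Rightarrow> (nat \<Rightarrow> nat) set set monoid"
  where "fp_monoid n =
    \<lparr>carrier = {A. A \<noteq> {} \<and> A \<subseteq> carrier (sym_group n)} // fp_rel n,
     monoid.mult = (\<lambda>X Y. \<Union>A\<in>X. \<Union>B\<in>Y. fp_class n (A <#>\<^bsub>sym_group n\<^esub> B)),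
     one = fp_class n {\<one>\<^bsub>sym_group n\<^esub>}\<rparr>"

definition green_L_class :: "('a, 'b) monoid_scheme \<Rightarrow> 'a \<Rightarrow> 'a set"
  where "green_L_class S x =
    {y \<in> carrier S. (\<lambda>s. s \<otimes>\<^bsub>S\<^esub> y) ` carrier S = (\<lambda>s. s \<otimes>\<^bsub>S\<^esub> x) ` carrier S}"

definition blocks_of_size :: "nat \<Rightarrow> (nat \<times> nat) set \<Rightarrow> nat \<Rightarrow> nat set set"
  where "blocks_of_size n \<rho> i = {B \<in> {1..n} // \<rho>. card B = i}"

definition block_count :: "nat \<Rightarrow> (nat \<times> nat) set \<Rightarrow> nat \<Rightarrow> nat"
  where "block_count n \<rho> i = card (blocks_of_size n \<rho> i)"

definition young :: "nat \<Rightarrow> (nat \<times> nat) set \<Rightarrow> (nat \<Rightarrow> nat) set"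
  where "young n \<rho> = {p \<in> carrier (sym_group n). \<forall>B\<in>{1..n} // \<rho>. p ` B = B}"

definition young_quotient :: "nat \<Rightarrow> (nat \<times> nat) set \<Rightarrow> (nat \<Rightarrow> nat) set monoid"
  where "young_quotient n \<rho> =
    (sym_group n)\<lparr>carrier := normalizer (sym_group n) (young n \<rho>)\<rparr> Mod young n \<rho>"

text \<open>
  Given for each \<open>i\<close> an enumeration \<open>e i\<close> of the blocks of cardinality \<open>i\<close> by \<open>{1..k\<^sub>i}\<close>, this is the
  resulting isomorphism from the quotient of the normalizer onto the product of the symmetric
  groups of degrees \<open>k\<^sub>i\<close>. All elements of a coset \<open>g\<close> map a block to the same block, so the union
  below is the image of that block.
\<close>

definition block_hom ::
    "nat \<Rightarrow> (nat \<times> nat) set \<Rightarrow> (nat \<Rightarrow> nat \<Rightarrow> nat set) \<Rightarrow> (nat \<Rightarrow> nat) set \<Rightarrow> (nat \<Rightarrow> nat \<Rightarrow> nat)"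
  where "block_hom n \<rho> e g =
    (\<lambda>i\<in>{1..n}. \<lambda>j.
       if j \<in> {1..block_count n \<rho> i}
       then inv_into {1..block_count n \<rho> i} (e i) (\<Union>p\<in>g. p ` e i j)
       else j)"

definition specht_multi ::
    "nat \<Rightarrow> (nat \<times> nat) set \<Rightarrow> (nat \<Rightarrow> nat \<Rightarrow> nat set) \<Rightarrow> (nat \<Rightarrow> nat list)
      \<Rightarrow> ((nat \<Rightarrow> nat) set, (nat \<Rightarrow> (nat \<times> nat \<Rightarrow> nat) set) \<Rightarrow>\<^sub>0 complex) cmodule"
  where "specht_multi n \<rho> e l =
    pullback (block_hom n \<rho> e) (outer_tensor {1..n} (\<lambda>i. specht (block_count n \<rho> i) (l i)))"

definition young_L_class :: "nat \<Rightarrow> (nat \<times> nat) set \<Rightarrow> (nat \<Rightarrow> nat) set set set"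
  where "young_L_class n \<rho> = green_L_class (fp_monoid n) (fp_class n (young n \<rho>))"

text \<open>
  The action \<open>s x g\<close> on a basis element, where the left cosets of the Young subgroup are
  identified with their classes via \<open>fp_class n\<close>.
\<close>

definition coset_act :: "nat \<Rightarrow> (nat \<times> nat) set \<Rightarrow> (nat \<Rightarrow> nat) set set \<Rightarrow> (nat \<Rightarrow> nat) set
    \<Rightarrow> (nat \<Rightarrow> nat) set \<Rightarrow> ((nat \<Rightarrow> nat) set \<Rightarrow>\<^sub>0 complex)"
  where "coset_act n \<rho> s g x =
    (let y = s \<otimes>\<^bsub>fp_monoid n\<^esub> fp_class n x \<otimes>\<^bsub>fp_monoid n\<^esub> fp_class n g in
     if y \<in> young_L_class n \<rho>
     then basis_vec (inv_into (lcosets\<^bsub>sym_group n\<^esub> (young n \<rho>)) (fp_class n) y)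
     else 0)"

definition coset_bimodule :: "nat \<Rightarrow> (nat \<times> nat) set
    \<Rightarrow> ((nat \<Rightarrow> nat) set set, (nat \<Rightarrow> nat) set, (nat \<Rightarrow> nat) set \<Rightarrow>\<^sub>0 complex) cbimodule"
  where "coset_bimodule n \<rho> =
    \<lparr>carrier = free_on (lcosets\<^bsub>sym_group n\<^esub> (young n \<rho>)),
     monoid.mult = undefined, one = undefined, zero = 0, add = (+), smult = pscale,
     act = (\<lambda>s. lin_ext (coset_act n \<rho> s \<one>\<^bsub>young_quotient n \<rho>\<^esub>)),
     ract = (\<lambda>x g. lin_ext (coset_act n \<rho> \<one>\<^bsub>fp_monoid n\<^esub> g) x)\<rparr>"

definition induced_module :: "nat \<Rightarrow> (nat \<times> nat) set \<Rightarrow> ((nat \<Rightarrow> nat) set, 'v) cmodule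
    \<Rightarrow> ((nat \<Rightarrow> nat) set set, ((((nat \<Rightarrow> nat) set \<Rightarrow>\<^sub>0 complex) \<times> 'v) \<Rightarrow>\<^sub>0 complex) set) cmodule"
  where "induced_module n \<rho> X = tensor_over (young_quotient n \<rho>) (coset_bimodule n \<rho>) X"

end

theory Submission
  imports Defs "HOL-Algebra.Zassenhaus"
begin

text \<open>
  Put \<open>G = N/S\<^sub>\<rho>\<close> and choose a basis \<open>B\<^sub>l\<close> of every \<open>S\<^sup>l\<close>. The isomorphism sends \<open>x\<close> to the family
  of all \<open>x \<otimes> b\<close> with \<open>b \<in> B\<^sub>l\<close>. It is obviously linear and commutes with the left action. Since
  \<open>\<complex>[S\<^sub>n/S\<^sub>\<rho>]\<close> is a free right \<open>\<complex>[G]\<close>-module, it is bijective as soon as \<open>\<complex>[G]\<close> maps isomorphically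
  onto the product of the endomorphism rings of the \<open>S\<^sup>l\<close>.

  Surjectivity (\<open>density\<close>) is proved by hand: the column antisymmetrizer of a tableau \<open>t\<close> of shape
  \<open>l\<close> acts on \<open>S\<^sup>l\<close> as \<open>v \<mapsto> \<langle>v, e\<^sub>t\<rangle> e\<^sub>t\<close> and kills \<open>S\<^sup>m\<close> unless \<open>m = l\<close> or the sum of the row
  indices of the cells of \<open>m\<close> exceeds that of \<open>l\<close>, so a triangular argument yields all matrix units.
  Injectivity (\<open>faithful\<close>) follows from a dimension count: \<open>dim S\<^sup>l\<close> is at least the number of standard
  tableaux of shape \<open>l\<close>, and the squares of these numbers add up to \<open>k!\<close>.
\<close>

section \<open>Linear algebra on free vector spaces\<close>

text \<open>Density yields one group algebra element for every matrix unit of every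
  \<open>S^l\<close> at once. They are linearly independent because their matrix entries are those
  of the matrix units, so the estimate |G| <= sum of (dim S^l)^2 already forces them to be a basis.
  Lower bounds for the dimensions therefore suffice, and both estimates point in the direction in
  which standard tableaux are easy to handle. Tensor products over \<open>\<complex>[G]\<close> are
  quotients of very large free spaces by a span of relations, so equality and inequality of tensors
  need different certificates. Surjectivity moves group algebra elements across the tensor sign by
  explicit relations. Injectivity applies linear maps that vanish on all relations and read off the
  coefficients of \<open>x\<close> along one G-orbit of cosets; this is the form in which freeness
  of the right module enters. Multiplication by an element of the monoid is cut to 0 outside the
  L-class. That it is still an action, commuting with the right action of \<open>G\<close>, rests on
  the fact that a product which has left the class under left multiplication never returns to
  it.\<close>

abbreviation cf :: "('b \<Rightarrow>\<^sub>0 complex) \<Rightarrow> 'b \<Rightarrow> complex"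
  where "cf \<equiv> Poly_Mapping.lookup"

global_interpretation pmm: vector_space_pair
  "pscale :: complex \<Rightarrow> ('b \<Rightarrow>\<^sub>0 complex) \<Rightarrow> _" "pscale :: complex \<Rightarrow> ('c \<Rightarrow>\<^sub>0 complex) \<Rightarrow> _"
  by unfold_locales

abbreviation lin :: "(('b \<Rightarrow>\<^sub>0 complex) \<Rightarrow> ('c \<Rightarrow>\<^sub>0 complex)) \<Rightarrow> bool"
  where "lin \<equiv> Vector_Spaces.linear pscale pscale"

lemma linI:
  assumes "\<And>x y. L (x + y) = L x + L y" "\<And>c x. L (pscale c x) = pscale c (L x)"
  shows "lin L"
  unfolding Vector_Spaces.linear_iff by (intro conjI allI pm.vector_space_axioms assms)

lemma cf_basis_vec: "cf (basis_vec b) c = (if b = c then 1 else 0)"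
  by (simp add: basis_vec_def lookup_single when_def)

lemma keys_basis_vec [simp]: "Poly_Mapping.keys (basis_vec b) = {b}"
  by (simp add: basis_vec_def)

lemma cf_sum: "cf (sum f A) b = (\<Sum>a\<in>A. cf (f a) b)"
  by (induction A rule: infinite_finite_induct) (auto simp: lookup_add)

lemma pm_expand:
  assumes "finite A" "Poly_Mapping.keys f \<subseteq> A"
  shows "f = (\<Sum>b\<in>A. pscale (cf f b) (basis_vec b))"
proof (rule poly_mapping_eqI)
  fix k
  have "(\<Sum>b\<in>A. cf f b * cf (basis_vec b) k) = (\<Sum>b\<in>A. if b = k then cf f k else 0)"
    by (intro sum.cong) (auto simp: cf_basis_vec)
  also have "\<dots> = cf f k"
    using assms by (auto simp: in_keys_iff)
  finally show "cf f k = cf (\<Sum>b\<in>A. pscale (cf f b) (basis_vec b)) k"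
    by (simp add: cf_sum)
qed

text \<open>Outside the support the coefficient is 0. Summing over a common finite superset is what
  makes sums with different supports comparable.\<close>

lemma lin_ext_superset:
  assumes "finite A" "Poly_Mapping.keys f \<subseteq> A"
  shows "lin_ext h f = (\<Sum>b\<in>A. pscale (cf f b) (h b))"
  unfolding lin_ext_def
  by (rule sum.mono_neutral_left) (use assms in \<open>auto simp: in_keys_iff\<close>)

lemma lin_lin_ext: "lin (lin_ext h)"
proof (rule linI)
  fix x y :: "'a \<Rightarrow>\<^sub>0 complex"
  let ?A = "Poly_Mapping.keys x \<union> Poly_Mapping.keys y"
  have "lin_ext h (x + y) = (\<Sum>b\<in>?A. pscale (cf (x + y) b) (h b))"
    by (rule lin_ext_superset) (auto dest: keys_add[THEN subsetD])
  also have "\<dots> = (\<Sum>b\<in>?A. pscale (cf x b) (h b)) + (\<Sum>b\<in>?A. pscale (cf y b) (h b))"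
    by (simp add: lookup_add pm.scale_left_distrib sum.distrib)
  also have "\<dots> = lin_ext h x + lin_ext h y"
    by (simp add: lin_ext_superset[symmetric])
  finally show "lin_ext h (x + y) = lin_ext h x + lin_ext h y" .
next
  fix c and x :: "'a \<Rightarrow>\<^sub>0 complex"
  have "lin_ext h (pscale c x) = (\<Sum>b\<in>Poly_Mapping.keys x. pscale (cf (pscale c x) b) (h b))"
    by (rule lin_ext_superset) (auto simp: in_keys_iff)
  then show "lin_ext h (pscale c x) = pscale c (lin_ext h x)"
    by (simp add: lin_ext_def pm.scale_sum_right)
qed

lemmas lin_ext_add = pmm.linear_add[OF lin_lin_ext]
lemmas lin_ext_diff = pmm.linear_diff[OF lin_lin_ext]
lemmas lin_ext_scale = pmm.linear_scale[OF lin_lin_ext]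
lemmas lin_ext_sum = pmm.linear_sum[OF lin_lin_ext]
lemmas lin_ext_0 = pmm.linear_0[OF lin_lin_ext]

lemma lin_ext_basis_vec [simp]: "lin_ext h (basis_vec b) = h b"
  by (simp add: lin_ext_def cf_basis_vec)

lemma lin_eq_lin_ext: assumes "lin L" shows "L f = lin_ext (\<lambda>b. L (basis_vec b)) f"
  by (subst pm_expand[of "Poly_Mapping.keys f" f], simp_all)
     (simp add: pmm.linear_sum[OF assms] pmm.linear_scale[OF assms] lin_ext_def)

lemma lin_sum: "(\<And>a. a \<in> A \<Longrightarrow> lin (L a)) \<Longrightarrow> lin (\<lambda>v. \<Sum>a\<in>A. L a v)"
  by (rule linI) (simp_all add: pmm.linear_add pmm.linear_scale sum.distrib pm.scale_sum_right)

lemma lin_pscale: "lin L \<Longrightarrow> lin (\<lambda>v. pscale c (L v))"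
  by (rule linI) (simp_all add: pmm.linear_add pmm.linear_scale pm.scale_right_distrib mult.commute)

lemma lin_comp: "lin L \<Longrightarrow> lin L' \<Longrightarrow> lin (\<lambda>v. L (L' v))"
  by (rule linI) (simp_all add: pmm.linear_add pmm.linear_scale)

lemma subspace_free_on: "pm.subspace (free_on B)"
  unfolding free_on_def
proof (rule pm.subspaceI; clarify)
  fix x y :: "'a \<Rightarrow>\<^sub>0 complex" and k
  assume "Poly_Mapping.keys x \<subseteq> B" "Poly_Mapping.keys y \<subseteq> B" "k \<in> Poly_Mapping.keys (x + y)"
  then show "k \<in> B" using keys_add[of x y] by blast
qed (auto simp: in_keys_iff)

lemma free_on_add: "f \<in> free_on B \<Longrightarrow> h \<in> free_on B \<Longrightarrow> f + h \<in> free_on B"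
  by (rule pm.subspace_add[OF subspace_free_on])
lemma free_on_scale: "f \<in> free_on B \<Longrightarrow> pscale c f \<in> free_on B"
  by (rule pm.subspace_scale[OF subspace_free_on])
lemma free_on_diff: "f \<in> free_on B \<Longrightarrow> h \<in> free_on B \<Longrightarrow> f - h \<in> free_on B"
  by (rule pm.subspace_diff[OF subspace_free_on])
lemma free_on_0: "0 \<in> free_on B"
  by (rule pm.subspace_0[OF subspace_free_on])
lemma basis_vec_free_on [simp]: "basis_vec b \<in> free_on B \<longleftrightarrow> b \<in> B"
  by (simp add: free_on_def)
lemma free_on_sum: "(\<And>a. a \<in> A \<Longrightarrow> f a \<in> free_on B) \<Longrightarrow> sum f A \<in> free_on B"
  by (rule pm.subspace_sum[OF subspace_free_on])

lemma lin_ext_free_on: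
  assumes "f \<in> free_on A" "\<And>a. a \<in> A \<Longrightarrow> h a \<in> free_on B" shows "lin_ext h f \<in> free_on B"
  unfolding lin_ext_def
  by (rule free_on_sum, rule free_on_scale) (use assms in \<open>auto simp: free_on_def\<close>)

lemma free_on_eq_span: "free_on B = pm.span (basis_vec ` B)"
proof
  show "free_on B \<subseteq> pm.span (basis_vec ` B)"
  proof
    fix f :: "'a \<Rightarrow>\<^sub>0 complex" assume f: "f \<in> free_on B"
    have "(\<Sum>b\<in>Poly_Mapping.keys f. pscale (cf f b) (basis_vec b)) \<in> pm.span (basis_vec ` B)"
      using f by (intro pm.span_sum pm.span_scale pm.span_base) (auto simp: free_on_def)
    then show "f \<in> pm.span (basis_vec ` B)"
      using pm_expand[of "Poly_Mapping.keys f" f] by simp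
  qed
  show "pm.span (basis_vec ` B) \<subseteq> free_on B"
    by (rule pm.span_minimal[OF _ subspace_free_on]) auto
qed

text \<open>The Hermitian form for which the basis vectors are orthonormal, linear in the first and
  conjugate linear in the second argument. Conjugation makes it definite, so that orthogonal
  projection works over the complex numbers.\<close>

definition ip :: "('b \<Rightarrow>\<^sub>0 complex) \<Rightarrow> ('b \<Rightarrow>\<^sub>0 complex) \<Rightarrow> complex"
  where "ip f h = (\<Sum>b\<in>Poly_Mapping.keys f. cf f b * cnj (cf h b))"

lemma ip_superset:
  assumes "finite A" "Poly_Mapping.keys f \<subseteq> A"
  shows "ip f h = (\<Sum>b\<in>A. cf f b * cnj (cf h b))"
  unfolding ip_def by (rule sum.mono_neutral_left) (use assms in \<open>auto simp: in_keys_iff\<close>)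

lemma ip_cnj: "ip f h = cnj (ip h f)"
  by (simp add: ip_superset[of "Poly_Mapping.keys f \<union> Poly_Mapping.keys h"] mult.commute)

lemma ip_add_left: "ip (f + g) h = ip f h + ip g h"
proof -
  let ?A = "Poly_Mapping.keys f \<union> Poly_Mapping.keys g"
  have "ip (f + g) h = (\<Sum>b\<in>?A. cf (f + g) b * cnj (cf h b))"
    by (rule ip_superset) (auto dest: keys_add[THEN subsetD])
  also have "\<dots> = ip f h + ip g h"
    by (simp add: ip_superset[of ?A] lookup_add distrib_right sum.distrib)
  finally show ?thesis .
qed

lemma ip_scale_left: "ip (pscale c f) h = c * ip f h"
proof -
  have "ip (pscale c f) h = (\<Sum>b\<in>Poly_Mapping.keys f. cf (pscale c f) b * cnj (cf h b))"
    by (rule ip_superset) (auto simp: in_keys_iff)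
  then show ?thesis by (simp add: ip_def sum_distrib_left mult.assoc)
qed

lemma ip_add_right: "ip h (f + g) = ip h f + ip h g"
  by (subst (1 2 3) ip_cnj) (simp add: ip_add_left)
lemma ip_scale_right: "ip h (pscale c f) = cnj c * ip h f"
  by (subst (1 2) ip_cnj) (simp add: ip_scale_left)
lemma ip_0_left [simp]: "ip 0 h = 0" by (simp add: ip_def)
lemma ip_0_right [simp]: "ip h 0 = 0" by (simp add: ip_def)
lemma ip_sum_left: "ip (sum f A) h = (\<Sum>a\<in>A. ip (f a) h)"
  by (induction A rule: infinite_finite_induct) (auto simp: ip_add_left)
lemma ip_basis_left: "ip (basis_vec b) h = cnj (cf h b)"
  by (simp add: ip_def cf_basis_vec)

lemma ip_self_eq_0 [simp]: "ip f f = 0 \<longleftrightarrow> f = 0"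
proof
  assume "ip f f = 0"
  moreover have "ip f f = of_real (\<Sum>b\<in>Poly_Mapping.keys f. (cmod (cf f b))\<^sup>2)"
    by (simp only: ip_def complex_norm_square of_real_sum)
  ultimately have "(\<Sum>b\<in>Poly_Mapping.keys f. (cmod (cf f b))\<^sup>2) = 0"
    by (metis of_real_eq_0_iff)
  then have "\<forall>b\<in>Poly_Mapping.keys f. (cmod (cf f b))\<^sup>2 = 0"
    by (subst (asm) sum_nonneg_eq_0_iff) auto
  then show "f = 0" by (intro poly_mapping_eqI) (auto simp: in_keys_iff)
qed simp

text \<open>Vectors are not normalized, which avoids square roots; the factors
  \<open>1 / ip b b\<close> below compensate for this.\<close>

definition orthogonal_set :: "('b \<Rightarrow>\<^sub>0 complex) set \<Rightarrow> bool"
  where "orthogonal_set B \<longleftrightarrow> 0 \<notin> B \<and> (\<forall>b\<in>B. \<forall>c\<in>B. b \<noteq> c \<longrightarrow> ip b c = 0)"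

text \<open>The Fourier expansion \<open>?E\<close> is linear and fixes every element of
  \<open>B\<close>, hence it is the identity on the span.\<close>

lemma orthogonal_expand:
  assumes B: "orthogonal_set B" "finite B" and v: "v \<in> pm.span B"
  shows "v = (\<Sum>b\<in>B. pscale (ip v b / ip b b) b)"
proof -
  let ?E = "\<lambda>v. \<Sum>b\<in>B. pscale (ip v b / ip b b) b"
  have "lin ?E"
    by (rule linI) (simp_all add: ip_add_left ip_scale_left add_divide_distrib pm.scale_left_distrib
          sum.distrib pm.scale_sum_right)
  moreover have "?E v = v" if "v \<in> B" for v
  proof -
    have "?E v = (\<Sum>b\<in>B. if b = v then b else 0)"
      using B that by (intro sum.cong) (auto simp: orthogonal_set_def)
    then show ?thesis using B that by simp
  qed
  ultimately have "?E v = id v"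
    using pmm.linear_eq_on[OF _ pm.linear_id v] by auto
  then show ?thesis by simp
qed

lemma orthogonal_independent:
  assumes "orthogonal_set B" "finite B" shows "pm.independent B"
proof (rule pm.independent_if_scalars_zero[OF assms(2)])
  fix f x assume 0: "(\<Sum>x\<in>B. pscale (f x) x) = 0" and x: "x \<in> B"
  have "0 = (\<Sum>y\<in>B. f y * ip y x)"
    by (metis (no_types, lifting) 0 ip_0_left ip_scale_left ip_sum_left sum.cong)
  also have "\<dots> = (\<Sum>y\<in>B. if y = x then f x * ip x x else 0)"
    using assms x by (intro sum.cong) (auto simp: orthogonal_set_def)
  also have "\<dots> = f x * ip x x" using assms x by simp
  finally show "f x = 0" using assms x by (auto simp: orthogonal_set_def)
qed

text \<open>A new vector \<open>x\<close> is replaced by \<open>y = x - p\<close>, where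
  \<open>p\<close> is its projection to the span so far. If \<open>y = 0\<close>, the old family
  already works.\<close>

lemma Gram_Schmidt:
  assumes "finite S"
  obtains B where "finite B" "pm.span B = pm.span S" "orthogonal_set B"
proof -
  have "\<exists>B. finite B \<and> pm.span B = pm.span S \<and> orthogonal_set B"
    using assms
  proof (induction S)
    case empty
    then show ?case by (intro exI[of _ "{}"]) (auto simp: orthogonal_set_def)
  next
    case (insert x S)
    then obtain B where B: "finite B" "pm.span B = pm.span S" "orthogonal_set B" by blast
    define p where "p = (\<Sum>b\<in>B. pscale (ip x b / ip b b) b)"
    define y where "y = x - p"
    have p: "p \<in> pm.span B" unfolding p_def by (intro pm.span_sum pm.span_scale pm.span_base)
    have span: "pm.span (insert y B) = pm.span (insert x S)"
    proof -
      have "pm.span (insert y B) = pm.span (insert x B)"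
        unfolding y_def by (rule pm.eq_span_insert_eq) (use p pm.span_neg in auto) 
      also have "\<dots> = pm.span (insert x S)"
        using B(2) pm.span_insert by blast
      finally show ?thesis .
    qed
    have orth: "ip y b = 0" if b: "b \<in> B" for b
    proof -
      have "ip p b = (\<Sum>c\<in>B. ip x c / ip c c * ip c b)"
        by (simp add: p_def ip_sum_left ip_scale_left)
      also have "\<dots> = (\<Sum>c\<in>B. if c = b then ip x b else 0)"
        using B b by (intro sum.cong) (auto simp: orthogonal_set_def)
      also have "\<dots> = ip x b" using B b by simp
      finally have "ip x b = ip (y + p) b" "ip p b = ip x b" by (simp_all add: y_def)
      then show ?thesis by (simp add: ip_add_left)
    qed
    show ?case
    proof (cases "y = 0")
      case True
      then show ?thesis using span B
        by (intro exI[of _ B]) (simp add: pm.span_insert_0)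
    next
      case False
      have "ip b y = 0" if "b \<in> B" for b by (subst ip_cnj) (simp add: orth that)
      then have "orthogonal_set (insert y B)"
        using B orth False by (auto simp: orthogonal_set_def)
      then show ?thesis using span B by blast
    qed
  qed
  then show ?thesis using that by blast
qed

section \<open>Counting standard tableaux\<close>

definition cells :: "(nat \<Rightarrow> nat) \<Rightarrow> (nat \<times> nat) set"
  where "cells p = {(i, j). j < p i}"

text \<open>Young diagrams with \<open>k\<close> cells, given by their row lengths as weakly
  decreasing functions that are eventually 0. With this encoding, adding or removing a cell is a
  function update.\<close>

definition shapes :: "nat \<Rightarrow> (nat \<Rightarrow> nat) set"
  where "shapes k = {p. antimono p \<and> finite (cells p) \<and> card (cells p) = k}"

definition removable :: "(nat \<Rightarrow> nat) \<Rightarrow> nat set"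
  where "removable p = {i. p (Suc i) < p i}"

text \<open>Row 0 can always grow, and row \<open>Suc i\<close> can grow exactly if row
  \<open>i\<close> is strictly longer, that is, if row \<open>i\<close> can shrink. The form of the
  definition makes the surplus of one addable row visible.\<close>

definition addable :: "(nat \<Rightarrow> nat) \<Rightarrow> nat set"
  where "addable p = insert 0 (Suc ` removable p)"

definition add_cell :: "(nat \<Rightarrow> nat) \<Rightarrow> nat \<Rightarrow> (nat \<Rightarrow> nat)"
  where "add_cell p i = p(i := Suc (p i))"

definition rem_cell :: "(nat \<Rightarrow> nat) \<Rightarrow> nat \<Rightarrow> (nat \<Rightarrow> nat)"
  where "rem_cell p i = p(i := p i - 1)"

text \<open>The number of standard tableaux, computed by the branching rule: the largest entry
  occupies a removable cell.\<close>

primrec nstd :: "nat \<Rightarrow> (nat \<Rightarrow> nat) \<Rightarrow> nat"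
  where "nstd 0 p = 1"
  | "nstd (Suc k) p = (\<Sum>i\<in>removable p. nstd k (rem_cell p i))"

declare nstd.simps(2) [simp del]

lemma mem_cells [simp]: "(i, j) \<in> cells p \<longleftrightarrow> j < p i"
  by (simp add: cells_def)

lemma antimono_Suc: "antimono (p :: nat \<Rightarrow> nat) \<longleftrightarrow> (\<forall>i. p (Suc i) \<le> p i)"
  using decseq_Suc_iff by blast

lemma finite_cells: "p \<in> shapes k \<Longrightarrow> finite (cells p)"
  by (simp add: shapes_def)

lemma addable_iff: "i \<in> addable p \<longleftrightarrow> i = 0 \<or> p i < p (i - 1)"
  by (cases i) (auto simp: addable_def removable_def)

lemma removable_iff: "i \<in> removable p \<longleftrightarrow> p (Suc i) < p i"
  by (simp add: removable_def)

lemma finite_removable: "finite (cells p) \<Longrightarrow> finite (removable p)"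
  by (rule finite_subset[of _ "fst ` cells p"]) (force simp: removable_def cells_def)+

lemma finite_addable: "finite (cells p) \<Longrightarrow> finite (addable p)"
  by (simp add: addable_def finite_removable)

lemma card_addable: "finite (cells p) \<Longrightarrow> card (addable p) = Suc (card (removable p))"
  unfolding addable_def by (subst card_insert_disjoint) (auto simp: finite_removable card_image)

lemma cells_add_cell: "cells (add_cell p i) = insert (i, p i) (cells p)"
  by (auto simp: cells_def add_cell_def split: if_splits)

lemma cells_rem_cell: "i \<in> removable p \<Longrightarrow> cells p = insert (i, p i - 1) (cells (rem_cell p i))"
  by (auto simp: cells_def rem_cell_def removable_def split: if_splits)

lemma corner_notin_rem_cell: "(i, p i - 1) \<notin> cells (rem_cell p i)"
  by (auto simp: rem_cell_def)

lemma add_rem_cell: "i \<in> removable p \<Longrightarrow> add_cell (rem_cell p i) i = p"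
  by (auto simp: add_cell_def rem_cell_def removable_def)

lemma rem_add_cell: "rem_cell (add_cell p i) i = p"
  by (auto simp: add_cell_def rem_cell_def)

lemma add_cell_shape: assumes "p \<in> shapes k" "i \<in> addable p" shows "add_cell p i \<in> shapes (Suc k)"
proof -
  have "antimono (add_cell p i)"
    unfolding antimono_Suc
  proof
    fix m show "add_cell p i (Suc m) \<le> add_cell p i m"
      using assms by (cases "Suc m = i") (auto simp: shapes_def antimono_Suc addable_iff add_cell_def le_SucI)
  qed
  then show ?thesis using assms by (auto simp: shapes_def cells_add_cell)
qed

lemma rem_cell_shape: assumes "p \<in> shapes (Suc k)" "i \<in> removable p" shows "rem_cell p i \<in> shapes k"
proof -
  have "antimono (rem_cell p i)"
    unfolding antimono_Suc
  proof
    fix m show "rem_cell p i (Suc m) \<le> rem_cell p i m"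
      using assms by (auto simp: shapes_def antimono_Suc removable_iff rem_cell_def intro: le_trans[OF diff_le_self])
  qed
  moreover have "finite (cells (rem_cell p i))"
    using assms cells_rem_cell[of i p] by (auto simp: shapes_def)
  ultimately show ?thesis
    using assms cells_rem_cell[of i p] corner_notin_rem_cell[of i p] by (auto simp: shapes_def)
qed

lemma removable_add_cell: "antimono p \<Longrightarrow> i \<in> removable (add_cell p i)"
  by (auto simp: removable_iff add_cell_def antimono_Suc less_Suc_eq_le)

lemma addable_rem_cell: "antimono p \<Longrightarrow> i \<in> removable p \<Longrightarrow> i \<in> addable (rem_cell p i)"
  by (cases i) (auto simp: removable_iff addable_iff rem_cell_def antimono_Suc
      intro: less_le_trans[OF diff_less])

text \<open>Adding in row \<open>i\<close> can influence what is removable only in row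
  \<open>i\<close> and the row above it; the case analysis on neighbouring rows shows that for
  \<open>i \<noteq> j\<close> the two moves do not obstruct each other.\<close>

lemma add_rem_commute:
  assumes "antimono p" "i \<noteq> j"
  shows "i \<in> addable p \<and> j \<in> removable (add_cell p i) \<longleftrightarrow> j \<in> removable p \<and> i \<in> addable (rem_cell p j)"
    and "rem_cell (add_cell p i) j = add_cell (rem_cell p j) i"
proof -
  have "p (Suc m) \<le> p m" for m using assms by (simp add: antimono_Suc)
  from this[of i] this[of j] this[of "i - 1"] this[of "j - 1"] assms(2)
  show "i \<in> addable p \<and> j \<in> removable (add_cell p i) \<longleftrightarrow> j \<in> removable p \<and> i \<in> addable (rem_cell p j)"
    by (cases i) (auto simp: addable_iff removable_iff add_cell_def rem_cell_def)
  show "rem_cell (add_cell p i) j = add_cell (rem_cell p j) i"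
    using assms(2) by (auto simp: add_cell_def rem_cell_def)
qed

lemma shapes_0: "shapes 0 = {\<lambda>_. 0}"
  by (auto simp: shapes_def cells_def antimono_def fun_eq_iff) (metis neq0_conv)

text \<open>
  Adding a cell and then removing one, versus the opposite order: both sides agree except for
  the terms that restore \<open>p\<close>, and there is one more addable than removable cell.
\<close>

lemma sum_nstd_add_cell:
  "p \<in> shapes k \<Longrightarrow> (\<Sum>i\<in>addable p. nstd (Suc k) (add_cell p i)) = Suc k * nstd k p"
proof (induction k arbitrary: p)
  case 0
  then have "p = (\<lambda>_. 0)" by (simp add: shapes_0)
  then have "removable p = {}" "addable p = {0}" "removable (add_cell p 0) = {0}"
    by (auto simp: removable_def addable_def add_cell_def)
  then show ?case by (simp add: nstd.simps(2))
next
  case (Suc k p)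
  have p: "antimono p" "finite (cells p)" using Suc.prems by (auto simp: shapes_def)
  \<comment> \<open>The terms in which the added and the removed cell lie in different rows; both
    sides of the identity are reduced to this sum.\<close>
  let ?X = "\<Sum>(i, j)\<in>(SIGMA i:addable p. removable (add_cell p i) - {i}). nstd (Suc k) (rem_cell (add_cell p i) j)"
  have fr: "finite (removable (add_cell p i))" for i
    using p by (intro finite_removable) (simp add: cells_add_cell)
  have fa: "finite (addable (rem_cell p j))" if "j \<in> removable p" for j
    using p cells_rem_cell[OF that] by (intro finite_addable) auto
  have "(\<Sum>i\<in>addable p. nstd (Suc (Suc k)) (add_cell p i))
      = (\<Sum>i\<in>addable p. \<Sum>j\<in>removable (add_cell p i). nstd (Suc k) (rem_cell (add_cell p i) j))"
    by (simp only: nstd.simps(2)[of "Suc k"])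
  also have "\<dots> = (\<Sum>i\<in>addable p. nstd (Suc k) p
      + (\<Sum>j\<in>removable (add_cell p i) - {i}. nstd (Suc k) (rem_cell (add_cell p i) j)))"
    by (intro sum.cong refl, subst sum.remove[OF fr removable_add_cell[OF p(1)]])
      (simp only: rem_add_cell)
  also have "\<dots> = Suc (card (removable p)) * nstd (Suc k) p + ?X"
    by (subst sum.Sigma[symmetric]) (use p fr in \<open>auto simp: finite_addable sum.distrib card_addable\<close>)
  finally have 1: "(\<Sum>i\<in>addable p. nstd (Suc (Suc k)) (add_cell p i))
      = Suc (card (removable p)) * nstd (Suc k) p + ?X" .
  note c = add_rem_commute(1)[OF p(1)]
  have comm: "j \<in> removable p" "i \<in> addable (rem_cell p j)"
    if "i \<in> addable p" "j \<in> removable (add_cell p i)" "j \<noteq> i" for i j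
    using c[of i j] that by auto
  have comm': "j \<in> removable (add_cell p i)" "i \<in> addable p"
    if "j \<in> removable p" "i \<in> addable (rem_cell p j)" "i \<noteq> j" for i j
    using c[of i j] that by auto
  note comm = comm comm' add_rem_commute(2)[OF p(1)]
  have "Suc k * nstd (Suc k) p = (\<Sum>j\<in>removable p. Suc k * nstd k (rem_cell p j))"
    by (subst nstd.simps(2)) (simp only: sum_distrib_left)
  also have "\<dots> = (\<Sum>j\<in>removable p. \<Sum>i\<in>addable (rem_cell p j). nstd (Suc k) (add_cell (rem_cell p j) i))"
    by (intro sum.cong refl Suc.IH[symmetric] rem_cell_shape[OF Suc.prems])
  also have "\<dots> = (\<Sum>j\<in>removable p. nstd (Suc k) p
      + (\<Sum>i\<in>addable (rem_cell p j) - {j}. nstd (Suc k) (add_cell (rem_cell p j) i)))"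
  proof (intro sum.cong refl)
    fix j assume j: "j \<in> removable p"
    show "(\<Sum>i\<in>addable (rem_cell p j). nstd (Suc k) (add_cell (rem_cell p j) i)) = nstd (Suc k) p
      + (\<Sum>i\<in>addable (rem_cell p j) - {j}. nstd (Suc k) (add_cell (rem_cell p j) i))"
      by (subst sum.remove[OF fa[OF j] addable_rem_cell[OF p(1) j]]) (simp only: add_rem_cell[OF j])
  qed
  also have "\<dots> = card (removable p) * nstd (Suc k) p
      + (\<Sum>(j, i)\<in>(SIGMA j:removable p. addable (rem_cell p j) - {j}). nstd (Suc k) (add_cell (rem_cell p j) i))"
    by (subst sum.Sigma[symmetric]) (use p fa in \<open>auto simp: finite_removable sum.distrib\<close>)
  also have "(\<Sum>(j, i)\<in>(SIGMA j:removable p. addable (rem_cell p j) - {j}). nstd (Suc k) (add_cell (rem_cell p j) i)) = ?X"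
  \<comment> \<open>Off the diagonal the order of the two moves is irrelevant, so swapping the pair
    of rows matches the two index sets.\<close>
  proof (rule sum.reindex_bij_witness[of _ prod.swap prod.swap], goal_cases)
    case (2 x)
    then show ?case using comm(3,4)[of "fst x" "snd x"] by (cases x) simp
  next
    case (4 x)
    then show ?case using comm(1,2)[of "fst x" "snd x"] by (cases x) simp
  next
    case (5 x)
    then show ?case using comm(5)[of "snd x" "fst x"] by (cases x) simp
  qed simp_all
  finally show ?case using 1 by simp
qed

text \<open>The last nonempty row is always removable.\<close>

lemma removable_nonempty: assumes "p \<in> shapes (Suc k)" shows "removable p \<noteq> {}"
proof -
  let ?R = "fst ` cells p"
  have f: "finite ?R" "?R \<noteq> {}" using assms by (auto simp: shapes_def)
  define i where "i = Max ?R"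
  have "i \<in> ?R" unfolding i_def by (rule Max_in[OF f])
  have "Suc i \<notin> ?R" using Max_ge[OF f(1), of "Suc i"] unfolding i_def by linarith
  have "0 < p i" "p (Suc i) = 0" using \<open>i \<in> ?R\<close> \<open>Suc i \<notin> ?R\<close> by (force simp: cells_def)+
  then show ?thesis using removable_iff[of i p] by auto
qed

text \<open>Every nonempty shape arises from a smaller one by adding a cell, and each shape has
  finitely many addable rows.\<close>

lemma finite_shapes: "finite (shapes k)"
proof (induction k)
  case 0 show ?case by (simp add: shapes_0)
next
  case (Suc k)
  have "shapes (Suc k) \<subseteq> (\<lambda>(p, i). add_cell p i) ` (SIGMA p:shapes k. addable p)"
  proof
    fix p assume p: "p \<in> shapes (Suc k)"
    then obtain i where i: "i \<in> removable p" using removable_nonempty by blast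
    have "i \<in> addable (rem_cell p i)"
      using p i by (intro addable_rem_cell) (auto simp: shapes_def)
    then show "p \<in> (\<lambda>(p, i). add_cell p i) ` (SIGMA p:shapes k. addable p)"
      using i p rem_cell_shape by (intro image_eqI[of _ _ "(rem_cell p i, i)"]) (auto simp: add_rem_cell)
  qed
  moreover have "finite (SIGMA p:shapes k. addable p)"
    using Suc by (intro finite_SigmaI finite_addable) (auto simp: shapes_def)
  ultimately show ?case by (meson finite_imageI finite_subset)
qed

text \<open>One factor of each square is expanded by the branching rule. The pairs (shape, removable
  row) are then viewed as pairs (smaller shape, addable row), and \<open>sum_nstd_add_cell\<close>
  turns the inner sum into \<open>Suc k * nstd k p\<close>, which supplies the next factor of the
  factorial.\<close>

lemma sum_nstd_squared: "(\<Sum>p\<in>shapes k. (nstd k p)\<^sup>2) = fact k"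
proof (induction k)
  case 0 show ?case by (simp add: shapes_0)
next
  case (Suc k)
  have "(\<Sum>p\<in>shapes (Suc k). (nstd (Suc k) p)\<^sup>2)
      = (\<Sum>p\<in>shapes (Suc k). \<Sum>i\<in>removable p. nstd (Suc k) p * nstd k (rem_cell p i))"
    by (simp only: power2_eq_square sum_distrib_left[symmetric] nstd.simps(2)[symmetric])
  also have "\<dots> = (\<Sum>(p, i)\<in>(SIGMA p:shapes (Suc k). removable p). nstd (Suc k) p * nstd k (rem_cell p i))"
    by (subst sum.Sigma) (auto simp: finite_shapes intro: finite_removable finite_cells)
  also have "\<dots> = (\<Sum>(p, i)\<in>(SIGMA p:shapes k. addable p). nstd (Suc k) (add_cell p i) * nstd k p)"
  proof (rule sum.reindex_bij_witness[of _ "\<lambda>(p, i). (add_cell p i, i)" "\<lambda>(p, i). (rem_cell p i, i)"])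
    fix a assume "a \<in> (SIGMA p:shapes (Suc k). removable p)"
    then obtain p i where a: "a = (p, i)" "p \<in> shapes (Suc k)" "i \<in> removable p" by auto
    then have "antimono p" by (simp add: shapes_def)
    with a show "(case case a of (p, i) \<Rightarrow> (rem_cell p i, i) of (p, i) \<Rightarrow> (add_cell p i, i)) = a"
      "(case a of (p, i) \<Rightarrow> (rem_cell p i, i)) \<in> (SIGMA p:shapes k. addable p)"
      "(case case a of (p, i) \<Rightarrow> (rem_cell p i, i) of (p, i) \<Rightarrow> nstd (Suc k) (add_cell p i) * nstd k p)
        = (case a of (p, i) \<Rightarrow> nstd (Suc k) p * nstd k (rem_cell p i))"
      by (auto simp: add_rem_cell addable_rem_cell rem_cell_shape)
  next
    fix a assume "a \<in> (SIGMA p:shapes k. addable p)"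
    then obtain p i where a: "a = (p, i)" "p \<in> shapes k" "i \<in> addable p" by auto
    then have "antimono p" by (simp add: shapes_def)
    with a show "(case case a of (p, i) \<Rightarrow> (add_cell p i, i) of (p, i) \<Rightarrow> (rem_cell p i, i)) = a"
      "(case a of (p, i) \<Rightarrow> (add_cell p i, i)) \<in> (SIGMA p:shapes (Suc k). removable p)"
      by (auto simp: rem_add_cell removable_add_cell add_cell_shape)
  qed
  also have "\<dots> = (\<Sum>p\<in>shapes k. \<Sum>i\<in>addable p. nstd (Suc k) (add_cell p i) * nstd k p)"
    by (subst sum.Sigma) (auto simp: finite_shapes intro: finite_addable finite_cells)
  also have "\<dots> = (\<Sum>p\<in>shapes k. Suc k * (nstd k p)\<^sup>2)"
    by (intro sum.cong refl)
      (simp only: sum_distrib_right[symmetric] sum_nstd_add_cell power2_eq_square mult.assoc)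
  also have "\<dots> = fact (Suc k)"
    by (simp only: sum_distrib_left[symmetric] Suc.IH fact_Suc of_nat_id)
  finally show ?case .
qed

section \<open>Partitions as lists and as row length functions\<close>

definition shape_of :: "nat list \<Rightarrow> (nat \<Rightarrow> nat)"
  where "shape_of l = (\<lambda>i. if i < length l then l ! i else 0)"

lemma cells_shape_of: "cells (shape_of l) = diagram l"
  by (auto simp: cells_def diagram_def shape_of_def split: if_splits)

lemma finite_diagram: "finite (diagram l)"
proof -
  have "diagram l = (SIGMA i:{..<length l}. {..<l ! i})" by (auto simp: diagram_def)
  then show ?thesis by simp
qed

lemma card_diagram: "card (diagram l) = sum_list l"
proof -
  have "diagram l = (SIGMA i:{..<length l}. {..<l ! i})" by (auto simp: diagram_def)
  then show ?thesis by (simp add: sum_list_sum_nth atLeast0LessThan)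
qed

lemma antimono_shape_of: "l \<in> partitions_of k \<Longrightarrow> antimono (shape_of l)"
  by (auto simp: antimono_Suc shape_of_def partitions_of_def sorted_wrt_iff_nth_less)

lemma shape_of_shapes: "l \<in> partitions_of k \<Longrightarrow> shape_of l \<in> shapes k"
  by (auto simp: shapes_def antimono_shape_of cells_shape_of finite_diagram card_diagram partitions_of_def)

text \<open>Parts are positive, so the length of the list is recovered as the size of the support of
  its shape.\<close>

lemma shape_of_inj: assumes "l \<in> partitions_of k" "m \<in> partitions_of k'" "shape_of l = shape_of m" shows "l = m"
proof -
  have len: "{i. shape_of l i \<noteq> 0} = {..<length l}" if "l \<in> partitions_of k" for l k
    using that nth_mem[of _ l] by (auto simp: shape_of_def partitions_of_def)
  have "length l = length m" using len[OF assms(1)] len[OF assms(2)] assms(3) by simp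
  then show ?thesis
  proof (rule nth_equalityI)
    fix i assume "i < length l"
    then show "l ! i = m ! i"
      using fun_cong[OF assms(3), of i] \<open>length l = length m\<close> by (simp add: shape_of_def)
  qed
qed

lemma bij_betw_shape_of: "bij_betw shape_of (partitions_of k) (shapes k)"
proof (rule bij_betw_imageI)
  show "inj_on shape_of (partitions_of k)" by (rule inj_onI) (rule shape_of_inj)
  show "shape_of ` partitions_of k = shapes k"
  proof (intro equalityI subsetI)
    fix p assume p: "p \<in> shapes k"
    then have anti: "i \<le> j \<Longrightarrow> p j \<le> p i" for i j by (auto simp: shapes_def antimono_def)
    have "finite (fst ` cells p)" using p by (auto simp: shapes_def)
    then obtain i where "i \<notin> fst ` cells p" by (metis ex_new_if_finite infinite_UNIV_nat)
    then have "p i = 0" by (force simp: cells_def)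
    \<comment> \<open>The first empty row; the values before it form the required list.\<close>
    define h where "h = (LEAST i. p i = 0)"
    have h0: "p h = 0" unfolding h_def using \<open>p i = 0\<close> by (rule LeastI)
    have h1: "0 < p i" if "i < h" for i using not_less_Least[of i "\<lambda>i. p i = 0"] that by (auto simp: h_def)
    have h2: "p i = 0" if "h \<le> i" for i using anti[OF that] h0 by simp
    let ?l = "map p [0..<h]"
    have sh: "shape_of ?l = p" by (auto simp: shape_of_def h2)
    have "sum_list ?l = k"
      using card_diagram[of ?l] p by (simp only: cells_shape_of[symmetric] sh) (simp add: shapes_def)
    then have "?l \<in> partitions_of k"
      using anti h1 by (auto simp: partitions_of_def sorted_wrt_iff_nth_less)
    then show "p \<in> shape_of ` partitions_of k" using sh by (metis image_eqI)
  qed (auto simp: shape_of_shapes)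
qed

lemma finite_partitions_of: "finite (partitions_of k)"
  using bij_betw_finite[OF bij_betw_shape_of] finite_shapes by blast

lemma sum_nstd_squared_partitions: "(\<Sum>l\<in>partitions_of k. (nstd k (shape_of l))\<^sup>2) = fact k"
  using sum.reindex_bij_betw[OF bij_betw_shape_of, of "\<lambda>p. (nstd k p)\<^sup>2" k] sum_nstd_squared by simp

section \<open>Tableaux, tabloids and column antisymmetrizers\<close>

(* keeps the intervals {1..k} folded *)
declare One_nat_def [simp del] atLeastAtMost_iff [simp del]

abbreviation Sym :: "nat \<Rightarrow> (nat \<Rightarrow> nat) set"
  where "Sym k \<equiv> carrier (sym_group k)"

lemma sym_iff: "p \<in> Sym k \<longleftrightarrow> p permutes {1..k}"
  by (rule sym_group_carrier)

lemma sym_comp: "p \<in> Sym k \<Longrightarrow> q \<in> Sym k \<Longrightarrow> p \<circ> q \<in> Sym k"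
  by (simp add: sym_iff permutes_compose)

lemma sym_inv: "p \<in> Sym k \<Longrightarrow> inv' p \<in> Sym k"
  by (simp add: sym_iff permutes_inv)

lemma sym_in: "p \<in> Sym k \<Longrightarrow> p x \<in> {1..k} \<longleftrightarrow> x \<in> {1..k}"
  by (simp only: sym_iff permutes_in_image)

lemma sym_inverses: assumes "p \<in> Sym k"
  shows "p (inv' p x) = x" "inv' p (p x) = x" "p \<circ> inv' p = id" "inv' p \<circ> p = id"
  using permutes_inverses[of p "{1..k}"] permutes_inv_o[of p "{1..k}"] assms by (auto simp: sym_iff)

lemma sym_sign: "p \<in> Sym k \<Longrightarrow> q \<in> Sym k \<Longrightarrow> sign (p \<circ> q) = sign p * sign q"
  by (metis sym_iff finite_atLeastAtMost permutation_permutes sign_compose)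

lemma finite_sym: "finite (Sym k)"
  by (simp add: sym_group_def finite_permutations)

text \<open>The coordinates of an entry, that is, the tableau read backwards. Row equivalence and
  column stabilizers become pointwise conditions on entries in these terms.\<close>

definition row_in :: "nat list \<Rightarrow> (nat \<times> nat \<Rightarrow> nat) \<Rightarrow> nat \<Rightarrow> nat"
  where "row_in l t x = fst (inv_into (diagram l) t x)"

definition col_in :: "nat list \<Rightarrow> (nat \<times> nat \<Rightarrow> nat) \<Rightarrow> nat \<Rightarrow> nat"
  where "col_in l t x = snd (inv_into (diagram l) t x)"

abbreviation tabloid :: "nat \<Rightarrow> nat list \<Rightarrow> (nat \<times> nat \<Rightarrow> nat) \<Rightarrow> (nat \<times> nat \<Rightarrow> nat) set"
  where "tabloid k l t \<equiv> row_equiv k l `` {t}"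

lemma tableau_at:
  assumes "t \<in> tableaux k l" "x \<in> {1..k}"
  shows "(row_in l t x, col_in l t x) \<in> diagram l" "t (row_in l t x, col_in l t x) = x"
proof -
  have "x \<in> t ` diagram l" using assms by (simp add: tableaux_def bij_betw_def)
  then show "(row_in l t x, col_in l t x) \<in> diagram l" "t (row_in l t x, col_in l t x) = x"
    unfolding row_in_def col_in_def by (simp_all only: prod.collapse inv_into_into f_inv_into_f)
qed

lemma tableau_entry:
  assumes "t \<in> tableaux k l" "c \<in> diagram l"
  shows "t c \<in> {1..k}" "row_in l t (t c) = fst c" "col_in l t (t c) = snd c"
  using assms by (auto simp: tableaux_def bij_betw_def row_in_def col_in_def)

lemma tableau_row: "t \<in> tableaux k l \<Longrightarrow> t ` diagram_row l i = {x \<in> {1..k}. row_in l t x = i}"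
  using tableau_at tableau_entry by (fastforce simp: diagram_row_def image_iff)

lemma tableau_col: "t \<in> tableaux k l \<Longrightarrow> t ` diagram_col l j = {x \<in> {1..k}. col_in l t x = j}"
  using tableau_at tableau_entry by (fastforce simp: diagram_col_def image_iff)

lemma bij_tableau: "t \<in> tableaux k l \<Longrightarrow> bij_betw (\<lambda>x. (row_in l t x, col_in l t x)) {1..k} (diagram l)"
  by (rule bij_betw_byWitness[where f' = t]) (auto simp: tableau_at tableau_entry)

lemma tableau_inj: "t \<in> tableaux k l \<Longrightarrow> x \<in> {1..k} \<Longrightarrow> y \<in> {1..k} \<Longrightarrow>
    row_in l t x = row_in l t y \<Longrightarrow> col_in l t x = col_in l t y \<Longrightarrow> x = y"
  using tableau_at(2) by metis

lemma tableau_act_tableaux: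
  assumes "p \<in> Sym k" "t \<in> tableaux k l"
  shows "tableau_act l p t \<in> tableaux k l"
proof -
  have "bij_betw (p \<circ> t) (diagram l) {1..k}"
    using assms by (intro bij_betw_trans) (auto simp: tableaux_def sym_iff permutes_imp_bij)
  then have "bij_betw (tableau_act l p t) (diagram l) {1..k}"
    by (rule bij_betw_cong[THEN iffD1, rotated]) (simp add: tableau_act_def)
  then show ?thesis by (simp add: tableaux_def tableau_act_def)
qed

lemma tableau_act_pos:
  assumes "p \<in> Sym k" "t \<in> tableaux k l" "x \<in> {1..k}"
  shows "row_in l (tableau_act l p t) (p x) = row_in l t x" "col_in l (tableau_act l p t) (p x) = col_in l t x"
proof -
  let ?c = "(row_in l t x, col_in l t x)"
  have "tableau_act l p t ?c = p x" using tableau_at[OF assms(2,3)] by (simp add: tableau_act_def)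
  then show "row_in l (tableau_act l p t) (p x) = row_in l t x" "col_in l (tableau_act l p t) (p x) = col_in l t x"
    using tableau_entry[OF tableau_act_tableaux[OF assms(1,2)] tableau_at(1)[OF assms(2,3)]] by auto
qed

lemma tableau_act_comp: "tableau_act l (p \<circ> q) t = tableau_act l p (tableau_act l q t)"
  by (auto simp: tableau_act_def fun_eq_iff)

lemma tableau_act_id: "t \<in> tableaux k l \<Longrightarrow> tableau_act l id t = t"
  by (auto simp: tableau_act_def tableaux_def extensional_def fun_eq_iff)

lemma tabloid_act_comp: "tabloid_act l (p \<circ> q) T = tabloid_act l p (tabloid_act l q T)"
  by (auto simp: tabloid_act_def tableau_act_comp image_image)

lemma row_equiv_iff:
  "(t, u) \<in> row_equiv k l \<longleftrightarrow> t \<in> tableaux k l \<and> u \<in> tableaux k l \<and> (\<forall>x\<in>{1..k}. row_in l t x = row_in l u x)"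
proof -
  have "(\<forall>i. {x \<in> {1..k}. row_in l t x = i} = {x \<in> {1..k}. row_in l u x = i}) \<longleftrightarrow>
      (\<forall>x\<in>{1..k}. row_in l t x = row_in l u x)" (is "?L \<longleftrightarrow> ?R")
  proof (intro iffI ballI)
    fix x assume ?L "x \<in> {1..k}"
    then have "x \<in> {y \<in> {1..k}. row_in l u y = row_in l t x}" by blast
    then show "row_in l t x = row_in l u x" by simp
  qed auto
  then show ?thesis unfolding row_equiv_def by (simp add: tableau_row cong: conj_cong)
qed

lemma tabloid_eq_iff:
  assumes "t \<in> tableaux k l" "u \<in> tableaux k l"
  shows "tabloid k l t = tabloid k l u \<longleftrightarrow> (\<forall>x\<in>{1..k}. row_in l t x = row_in l u x)"
  using assms by (auto simp: set_eq_iff row_equiv_iff)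

text \<open>An entry \<open>p x\<close> of the translated tableau has the row of \<open>x\<close> in
  the original one, so row equivalence is preserved. Any tableau in the target class is the image of
  its translate by the inverse of \<open>p\<close>.\<close>

lemma tabloid_act_tabloid:
  assumes "p \<in> Sym k" "t \<in> tableaux k l"
  shows "tabloid_act l p (tabloid k l t) = tabloid k l (tableau_act l p t)"
proof (intro equalityI subsetI)
  have eq: "row_in l (tableau_act l p u) x = row_in l u (inv' p x)" if "u \<in> tableaux k l" "x \<in> {1..k}" for u x
    using tableau_act_pos(1)[OF assms(1) that(1), of "inv' p x"] that(2) assms(1)
    by (simp only: sym_inverses sym_in sym_inv)
  fix v
  {
    assume "v \<in> tabloid_act l p (tabloid k l t)"
    then obtain u where u: "v = tableau_act l p u" "(t, u) \<in> row_equiv k l" by (auto simp: tabloid_act_def)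
    then have "(tableau_act l p t, v) \<in> row_equiv k l"
      using assms sym_in[OF sym_inv[OF assms(1)]]
      by (auto simp: row_equiv_iff tableau_act_tableaux eq)
    then show "v \<in> tabloid k l (tableau_act l p t)" by simp
  next
    assume "v \<in> tabloid k l (tableau_act l p t)"
    then have v: "v \<in> tableaux k l" "\<forall>x\<in>{1..k}. row_in l (tableau_act l p t) x = row_in l v x"
      by (auto simp: row_equiv_iff)
    have "v = tableau_act l p (tableau_act l (inv' p) v)"
      by (simp only: tableau_act_comp[symmetric] sym_inverses(3)[OF assms(1)] tableau_act_id[OF v(1)])
    moreover have "row_in l t x = row_in l (tableau_act l (inv' p) v) x" if x: "x \<in> {1..k}" for x
    proof -
      have "row_in l (tableau_act l (inv' p) v) x = row_in l v (p x)"
        using tableau_act_pos(1)[OF sym_inv[OF assms(1)] v(1), of "p x"] x assms(1)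
        by (simp only: sym_inverses sym_in)
      also have "\<dots> = row_in l (tableau_act l p t) (p x)"
        using v(2) x sym_in[OF assms(1)] by (simp)
      also have "\<dots> = row_in l t x" using tableau_act_pos(1)[OF assms x] .
      finally show ?thesis ..
    qed
    ultimately show "v \<in> tabloid_act l p (tabloid k l t)"
      using v assms
      by (auto simp: tabloid_act_def row_equiv_iff tableau_act_tableaux sym_inv
          intro!: image_eqI[of _ _ "tableau_act l (inv' p) v"])
  }
qed

lemma column_stabilizer_iff:
  assumes "t \<in> tableaux k l"
  shows "p \<in> column_stabilizer k l t \<longleftrightarrow> p \<in> Sym k \<and> (\<forall>x\<in>{1..k}. col_in l t (p x) = col_in l t x)"
proof -
  have "(\<forall>j. p ` {x \<in> {1..k}. col_in l t x = j} = {x \<in> {1..k}. col_in l t x = j})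
     \<longleftrightarrow> (\<forall>x\<in>{1..k}. col_in l t (p x) = col_in l t x)" (is "?L \<longleftrightarrow> ?R") if p: "p \<in> Sym k"
  proof
    assume L: ?L
    show ?R
    proof
      fix x assume "x \<in> {1..k}"
      then have "p x \<in> p ` {y \<in> {1..k}. col_in l t y = col_in l t x}" by blast
      then show "col_in l t (p x) = col_in l t x" using L by blast
    qed
  next
    assume R: ?R
    show ?L
    proof (intro allI equalityI subsetI)
      fix j y assume "y \<in> p ` {x \<in> {1..k}. col_in l t x = j}"
      then show "y \<in> {x \<in> {1..k}. col_in l t x = j}"
        using R sym_in[OF p] by auto
    next
      fix j y assume y: "y \<in> {x \<in> {1..k}. col_in l t x = j}"
      have "inv' p y \<in> {1..k}" using y sym_in[OF sym_inv[OF p]] by blast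
      then have "inv' p y \<in> {x \<in> {1..k}. col_in l t x = j}"
        using R y by (auto simp: sym_inverses[OF p] dest: bspec[of _ _ "inv' p y"])
      then show "y \<in> p ` {x \<in> {1..k}. col_in l t x = j}"
        using sym_inverses(1)[OF p, of y] by (metis image_eqI)
    qed
  qed
  then show ?thesis unfolding column_stabilizer_def by (auto simp only: tableau_col[OF assms] mem_Collect_eq)
qed

section \<open>The column stabilizer as a subgroup\<close>

context
  fixes k l t assumes t: "t \<in> tableaux k l"
begin

lemma column_stabilizer_sym: "p \<in> column_stabilizer k l t \<Longrightarrow> p \<in> Sym k"
  by (simp add: column_stabilizer_def)

lemma column_stabilizer_id: "id \<in> column_stabilizer k l t"
  by (simp add: column_stabilizer_iff[OF t] sym_iff permutes_id)

lemma column_stabilizer_comp: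
  "p \<in> column_stabilizer k l t \<Longrightarrow> q \<in> column_stabilizer k l t \<Longrightarrow> p \<circ> q \<in> column_stabilizer k l t"
  using sym_in[of q k] by (auto simp: column_stabilizer_iff[OF t] sym_comp)

lemma column_stabilizer_inv:
  assumes "p \<in> column_stabilizer k l t" shows "inv' p \<in> column_stabilizer k l t"
proof -
  have p: "p \<in> Sym k" using assms by (rule column_stabilizer_sym)
  have "col_in l t (inv' p x) = col_in l t x" if "x \<in> {1..k}" for x
  proof -
    have "inv' p x \<in> {1..k}" using that sym_in[OF sym_inv[OF p]] by blast
    then have "col_in l t (p (inv' p x)) = col_in l t (inv' p x)"
      using assms by (simp add: column_stabilizer_iff[OF t])
    then show ?thesis by (simp add: sym_inverses[OF p])
  qed
  then show ?thesis by (simp add: column_stabilizer_iff[OF t] p sym_inv)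
qed

lemma bij_column_stabilizer_right:
  assumes "q \<in> column_stabilizer k l t"
  shows "bij_betw (\<lambda>p. p \<circ> q) (column_stabilizer k l t) (column_stabilizer k l t)"
  by (rule bij_betw_byWitness[where f' = "\<lambda>p. p \<circ> inv' q"])
     (use assms in \<open>auto simp: column_stabilizer_comp column_stabilizer_inv o_assoc[symmetric]
        sym_inverses[OF column_stabilizer_sym]\<close>)

text \<open>Write \<open>p x = q y\<close>. Equality of tabloids puts \<open>x\<close> and
  \<open>y\<close> into the same row of \<open>t\<close>, and the stabilizer property puts them into
  the same column, so \<open>x = y\<close>. Hence no terms of a polytabloid cancel or merge.\<close>

lemma column_stabilizer_tabloid_inj:
  assumes p: "p \<in> column_stabilizer k l t" and q: "q \<in> column_stabilizer k l t"
    and eq: "tabloid k l (tableau_act l p t) = tabloid k l (tableau_act l q t)"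
  shows "p = q"
proof
  fix x
  have s: "p \<in> Sym k" "q \<in> Sym k" using p q column_stabilizer_sym by auto
  show "p x = q x"
  proof (cases "x \<in> {1..k}")
    case False
    then show ?thesis using s by (metis sym_iff permutes_def)
  next
    case True
    define y where "y = inv' q (p x)"
    have px: "p x = q y" by (simp add: y_def sym_inverses[OF s(2)])
    have y: "y \<in> {1..k}" using True s by (simp only: y_def sym_in sym_inv)
    have "row_in l t x = row_in l (tableau_act l p t) (p x)" using tableau_act_pos(1)[OF s(1) t True] ..
    also have "\<dots> = row_in l (tableau_act l q t) (p x)"
      using eq[unfolded tabloid_eq_iff[OF tableau_act_tableaux[OF s(1) t] tableau_act_tableaux[OF s(2) t]]]
        True sym_in[OF s(1)] by blast
    also have "\<dots> = row_in l t y" unfolding px by (rule tableau_act_pos(1)[OF s(2) t y])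
    finally have "row_in l t x = row_in l t y" .
    moreover have "col_in l t x = col_in l t y"
      using p q True y px by (auto simp: column_stabilizer_iff[OF t])
    ultimately have "x = y" using tableau_inj[OF t True y] by blast
    then show ?thesis using px by metis
  qed
qed

lemma finite_column_stabilizer: "finite (column_stabilizer k l t)"
  by (rule finite_subset[OF _ finite_sym]) (auto simp: column_stabilizer_def)

end

section \<open>The group algebra acting on the permutation module of tabloids\<close>

definition tabloids :: "nat \<Rightarrow> nat list \<Rightarrow> (nat \<times> nat \<Rightarrow> nat) set set"
  where "tabloids k l = tabloid k l ` tableaux k l"

definition tab_act :: "nat list \<Rightarrow> (nat \<Rightarrow> nat) \<Rightarrow> ((nat \<times> nat \<Rightarrow> nat) set \<Rightarrow>\<^sub>0 complex) \<Rightarrow> ((nat \<times> nat \<Rightarrow> nat) set \<Rightarrow>\<^sub>0 complex)"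
  where "tab_act l p = lin_ext (\<lambda>T. basis_vec (tabloid_act l p T))"

lemma lin_tab_act: "lin (tab_act l p)"
  unfolding tab_act_def by (rule lin_lin_ext)

lemma tab_act_basis [simp]: "tab_act l p (basis_vec T) = basis_vec (tabloid_act l p T)"
  by (simp add: tab_act_def)

lemma tab_act_comp: "tab_act l (p \<circ> q) v = tab_act l p (tab_act l q v)"
proof -
  have "lin (\<lambda>v. tab_act l p (tab_act l q v))" by (rule lin_comp[OF lin_tab_act lin_tab_act])
  from lin_eq_lin_ext[OF this, of v] show ?thesis
    by (simp add: tab_act_def[of l "p \<circ> q"] tabloid_act_comp)
qed

text \<open>An element of the group algebra is represented by its coefficient function
  \<open>a\<close>, so the same element can act on the modules of different shapes
  \<open>l\<close>.\<close>

definition alg_act :: "nat \<Rightarrow> nat list \<Rightarrow> ((nat \<Rightarrow> nat) \<Rightarrow> complex) \<Rightarrow> ((nat \<times> nat \<Rightarrow> nat) set \<Rightarrow>\<^sub>0 complex) \<Rightarrow> ((nat \<times> nat \<Rightarrow> nat) set \<Rightarrow>\<^sub>0 complex)"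
  where "alg_act k l a v = (\<Sum>p\<in>Sym k. pscale (a p) (tab_act l p v))"

lemma lin_alg_act: "lin (alg_act k l a)"
  unfolding alg_act_def by (intro lin_sum lin_pscale lin_tab_act)

text \<open>The signed column sum of \<open>t\<close>, as a coefficient function on the whole
  symmetric group; it will also act on tabloids of shapes other than that of
  \<open>t\<close>.\<close>

definition col_antisym :: "nat \<Rightarrow> nat list \<Rightarrow> (nat \<times> nat \<Rightarrow> nat) \<Rightarrow> (nat \<Rightarrow> nat) \<Rightarrow> complex"
  where "col_antisym k l t p = (if p \<in> column_stabilizer k l t then of_int (sign p) else 0)"

lemma alg_act_col_antisym:
  "alg_act k m (col_antisym k l t) v = (\<Sum>p\<in>column_stabilizer k l t. pscale (of_int (sign p)) (tab_act m p v))"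
  unfolding alg_act_def
  by (rule sum.mono_neutral_cong_right) (auto simp: col_antisym_def finite_sym column_stabilizer_def)

text \<open>The transposition of two elements in a common column of \<open>t\<close> and a common row of \<open>u\<close> fixes the tabloid of \<open>u\<close> but is odd.\<close>

lemma col_antisym_kills:
  assumes t: "t \<in> tableaux k l" and u: "u \<in> tableaux k m"
    and xy: "x \<in> {1..k}" "y \<in> {1..k}" "x \<noteq> y" "col_in l t x = col_in l t y" "row_in m u x = row_in m u y"
  shows "alg_act k m (col_antisym k l t) (basis_vec (tabloid k m u)) = 0" (is "?K = 0")
proof -
  let ?C = "column_stabilizer k l t" and ?\<tau> = "Transposition.transpose x y" and ?b = "basis_vec (tabloid k m u)"
  have \<tau>: "?\<tau> \<in> Sym k" using xy by (simp only: sym_iff permutes_swap_id)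
  have \<tau>C: "?\<tau> \<in> ?C"
    using xy \<tau> by (auto simp: column_stabilizer_iff[OF t] Transposition.transpose_def)
  have fixT: "tabloid_act m ?\<tau> (tabloid k m u) = tabloid k m u"
    unfolding tabloid_act_tabloid[OF \<tau> u] tabloid_eq_iff[OF tableau_act_tableaux[OF \<tau> u] u]
  proof
    fix z assume z: "z \<in> {1..k}"
    have "row_in m (tableau_act m ?\<tau> u) (?\<tau> (?\<tau> z)) = row_in m u (?\<tau> z)"
      using z sym_in[OF \<tau>] by (intro tableau_act_pos(1)[OF \<tau> u]) blast
    also have "row_in m u (?\<tau> z) = row_in m u z" using xy by (simp add: Transposition.transpose_def)
    finally show "row_in m (tableau_act m ?\<tau> u) z = row_in m u z" by simp
  qed
  have "?K = (\<Sum>p\<in>?C. pscale (of_int (sign (p \<circ> ?\<tau>))) (tab_act m (p \<circ> ?\<tau>) ?b))"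
    unfolding alg_act_col_antisym
    by (rule sum.reindex_bij_betw[OF bij_column_stabilizer_right[OF t \<tau>C], symmetric])
  also have "\<dots> = (\<Sum>p\<in>?C. pscale (of_int (- sign p)) (tab_act m p ?b))"
  proof (intro sum.cong refl)
    fix p assume "p \<in> ?C"
    then have "sign (p \<circ> ?\<tau>) = - sign p"
      using sym_sign[OF column_stabilizer_sym[OF t] \<tau>, of p] xy by (simp add: sign_swap_id)
    then show "pscale (of_int (sign (p \<circ> ?\<tau>))) (tab_act m (p \<circ> ?\<tau>) ?b) = pscale (of_int (- sign p)) (tab_act m p ?b)"
      by (simp only: tab_act_basis tabloid_act_comp fixT)
  qed
  also have "\<dots> = - ?K"
    by (simp add: alg_act_col_antisym sum_negf)
  \<comment> \<open>The sum equals its own negative, so it vanishes because 2 is invertible.\<close>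
  finally have "pscale 2 ?K = 0" by (metis (no_types) add.right_inverse pm.scale_left_distrib one_add_one pm.scale_one)
  then show ?thesis by (simp only: pm.scale_eq_0_iff) simp
qed

section \<open>Comparing shapes by the sum of row indices\<close>

lemma down_closed_lessThan:
  assumes "finite R" "\<And>i i'. i \<in> R \<Longrightarrow> i' \<le> i \<Longrightarrow> i' \<in> R"
  shows "\<exists>b. R = {..<b :: nat}"
proof -
  obtain i where "i \<notin> R" using assms(1) by (metis ex_new_if_finite infinite_UNIV_nat)
  define b where "b = (LEAST b. b \<notin> R)"
  have b: "b \<notin> R" unfolding b_def using \<open>i \<notin> R\<close> by (rule LeastI)
  have "R = {..<b}"
  proof (intro equalityI subsetI)
    fix i assume "i \<in> R"
    then have "\<not> b \<le> i" using assms(2) b by blast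
    then show "i \<in> {..<b}" by simp
  next
    fix i assume "i \<in> {..<b}"
    then show "i \<in> R" using not_less_Least[of i "\<lambda>b. b \<notin> R"] by (auto simp: b_def)
  qed
  then show ?thesis ..
qed

text \<open>The maximum of \<open>h + 1\<close> distinct naturals is at least \<open>h\<close>.
  Removing it allows induction, and equality of the sums forces the maximum to be exactly
  \<open>h\<close>.\<close>

lemma sum_lessThan_card_le:
  "finite A \<Longrightarrow> card A = h \<Longrightarrow> \<Sum>{..<h} \<le> \<Sum>A \<and> (\<Sum>A = \<Sum>{..<h} \<longrightarrow> A = {..<h})" for A :: "nat set"
proof (induction h arbitrary: A)
  case (Suc h)
  have "A \<noteq> {}" using Suc.prems by auto
  define M where "M = Max A"
  have M: "M \<in> A" unfolding M_def using Suc.prems(1) \<open>A \<noteq> {}\<close> by (rule Max_in)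
  have "A \<subseteq> {..M}" unfolding M_def using Suc.prems(1) by auto
  then have "Suc h \<le> Suc M" using card_mono[of "{..M}" A] Suc.prems by simp
  then have hM: "h \<le> M" by simp
  have IH: "\<Sum>{..<h} \<le> \<Sum>(A - {M})" "\<Sum>(A - {M}) = \<Sum>{..<h} \<longrightarrow> A - {M} = {..<h}"
    using Suc.IH[of "A - {M}"] Suc.prems M by auto
  have s: "\<Sum>A = M + \<Sum>(A - {M})" using Suc.prems(1) M by (rule sum.remove)
  show ?case
  proof (intro conjI impI)
    show "\<Sum>{..<Suc h} \<le> \<Sum>A" using IH(1) hM s by simp
    assume "\<Sum>A = \<Sum>{..<Suc h}"
    then have "M = h" "\<Sum>(A - {M}) = \<Sum>{..<h}" using IH(1) hM s by simp_all
    then have "A = insert h {..<h}" using IH(2) M by blast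
    then show "A = {..<Suc h}" by (simp only: lessThan_Suc)
  qed
qed simp

text \<open>The sum of \<open>i * l ! i\<close> over the rows \<open>i\<close>, usually written
  \<open>n(l)\<close>. It serves as a numerical order on shapes: flat diagrams have small weight,
  tall ones large weight.\<close>

definition row_weight :: "nat list \<Rightarrow> nat"
  where "row_weight l = (\<Sum>c\<in>diagram l. fst c)"

lemma sum_row_in: "t \<in> tableaux k l \<Longrightarrow> (\<Sum>x\<in>{1..k}. row_in l t x) = row_weight l"
  unfolding row_weight_def using sum.reindex_bij_betw[OF bij_tableau, of t k l fst] by simp

lemma card_row: "t \<in> tableaux k l \<Longrightarrow> card {x \<in> {1..k}. row_in l t x = i} = shape_of l i"
proof -
  assume t: "t \<in> tableaux k l"
  have "inj_on t (diagram_row l i)"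
    using t by (auto simp: tableaux_def bij_betw_def diagram_row_def inj_on_def)
  then have "card {x \<in> {1..k}. row_in l t x = i} = card (diagram_row l i)"
    by (simp only: tableau_row[OF t, symmetric] card_image)
  also have "diagram_row l i = Pair i ` {..<shape_of l i}"
    by (auto simp: diagram_row_def cells_shape_of[symmetric])
  also have "card \<dots> = shape_of l i" by (subst card_image) (auto simp: inj_on_def)
  finally show ?thesis .
qed

text \<open>
  If every row of \<open>u\<close> meets every column of \<open>t\<close> at most once, then within each column of \<open>t\<close> the
  row numbers in \<open>u\<close> are distinct, so their sum is at least the sum of the row numbers in \<open>t\<close>.
  This replaces the comparison of shapes in the dominance order.
\<close>

lemma row_weight_le:
  assumes l: "l \<in> partitions_of k" and m: "m \<in> partitions_of k"
    and t: "t \<in> tableaux k l" and u: "u \<in> tableaux k m"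
    and dist: "\<And>x y. x \<in> {1..k} \<Longrightarrow> y \<in> {1..k} \<Longrightarrow> x \<noteq> y \<Longrightarrow> col_in l t x = col_in l t y \<Longrightarrow> row_in m u x \<noteq> row_in m u y"
  shows "row_weight l \<le> row_weight m"
    and "row_weight l = row_weight m \<Longrightarrow>
           m = l \<and> (\<exists>p\<in>column_stabilizer k l t. tabloid k l u = tabloid k l (tableau_act l p t))"
proof -
  let ?I = "{1..k}"
  define X where "X j = {x \<in> ?I. col_in l t x = j}" for j
  define h where "h j = card (X j)" for j
  have finX: "finite (X j)" for j by (simp add: X_def)
  have injt: "inj_on (row_in l t) (X j)" for j
    using tableau_inj[OF t] by (auto simp: inj_on_def X_def)
  have inju: "inj_on (row_in m u) (X j)" for j
  proof (rule inj_onI, rule ccontr)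
    fix x y assume "x \<in> X j" "y \<in> X j" "row_in m u x = row_in m u y" "x \<noteq> y"
    then show False using dist[of x y] by (auto simp: X_def)
  qed
  \<comment> \<open>A column of a Young diagram occupies an initial segment of the rows, so its row
    indices have the least sum possible for their number.\<close>
  have imt: "row_in l t ` X j = {..<h j}" for j
  proof -
    let ?R = "{i. j < shape_of l i}"
    have "row_in l t ` X j = ?R"
    proof (intro equalityI subsetI)
      fix i assume "i \<in> row_in l t ` X j"
      then show "i \<in> ?R"
        using tableau_at(1)[OF t] by (auto simp: X_def cells_shape_of[symmetric])
    next
      fix i assume "i \<in> ?R"
      then have "(i, j) \<in> diagram l" by (simp add: cells_shape_of[symmetric])
      from tableau_entry[OF t this] show "i \<in> row_in l t ` X j"
        by (intro image_eqI[of _ _ "t (i, j)"]) (auto simp: X_def)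
    qed
    moreover have "\<exists>b. ?R = {..<b}"
    proof (intro down_closed_lessThan)
      show "finite ?R" using calculation finX[of j] by (metis finite_imageI)
      show "i' \<in> ?R" if "i \<in> ?R" "i' \<le> i" for i i'
        using that antimonoD[OF antimono_shape_of[OF l] that(2)] by simp
    qed
    ultimately obtain b where "row_in l t ` X j = {..<b}" by auto
    then show ?thesis using card_image[OF injt[of j]] by (simp add: h_def)
  qed
  have le: "(\<Sum>x\<in>X j. row_in l t x) \<le> (\<Sum>x\<in>X j. row_in m u x)" (is ?le)
    and eq: "(\<Sum>x\<in>X j. row_in l t x) = (\<Sum>x\<in>X j. row_in m u x) \<Longrightarrow> row_in m u ` X j = {..<h j}" (is "_ \<Longrightarrow> ?eq") for j
  proof -
    have "(\<Sum>x\<in>X j. row_in l t x) = \<Sum>{..<h j}"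
      using sum.reindex[OF injt[of j], of "\<lambda>x. x"] by (simp add: imt)
    moreover have "(\<Sum>x\<in>X j. row_in m u x) = \<Sum>(row_in m u ` X j)"
      using sum.reindex[OF inju[of j], of "\<lambda>x. x"] by simp
    moreover note sum_lessThan_card_le[of "row_in m u ` X j" "h j"]
    moreover have "card (row_in m u ` X j) = h j" by (simp add: h_def card_image[OF inju])
    ultimately show ?le "(\<Sum>x\<in>X j. row_in l t x) = (\<Sum>x\<in>X j. row_in m u x) \<Longrightarrow> ?eq"
      using finX[of j] by auto
  qed
  let ?J = "col_in l t ` ?I"
  have split: "(\<Sum>x\<in>?I. f x) = (\<Sum>j\<in>?J. \<Sum>x\<in>X j. f x)" for f :: "nat \<Rightarrow> nat"
    unfolding X_def by (rule sum.image_gen) simp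
  show "row_weight l \<le> row_weight m"
    unfolding sum_row_in[OF t, symmetric] sum_row_in[OF u, symmetric] split by (rule sum_mono) (rule le)
  assume "row_weight l = row_weight m"
  then have "(\<Sum>j\<in>?J. \<Sum>x\<in>X j. row_in l t x) = (\<Sum>j\<in>?J. \<Sum>x\<in>X j. row_in m u x)"
    unfolding sum_row_in[OF t, symmetric] sum_row_in[OF u, symmetric] split .
  \<comment> \<open>The inequality holds column by column, so equality of the totals forces equality
    in each column.\<close>
  then have "(\<Sum>x\<in>X j. row_in l t x) = (\<Sum>x\<in>X j. row_in m u x)" if "j \<in> ?J" for j
    by (rule sum_mono_inv) (rule le that, simp_all add: that)
  then have imu: "row_in m u ` X j = {..<h j}" if "j \<in> ?J" for j by (rule eq) (rule that)
  \<comment> \<open>Here \<open>f\<close> is the position of an entry in \<open>t\<close>, and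
    \<open>g\<close> combines its row in \<open>u\<close> with its column in \<open>t\<close>. Both
    are injective with the same image, so inverting \<open>g\<close> after \<open>f\<close> gives a
    permutation \<open>p\<close> that stays in the columns of \<open>t\<close> and carries the rows
    of \<open>t\<close> to those of \<open>u\<close>.\<close>
  define f where "f x = (row_in l t x, col_in l t x)" for x
  define g where "g x = (row_in m u x, col_in l t x)" for x
  have f: "bij_betw f ?I (f ` ?I)"
    using tableau_inj[OF t] by (auto simp: bij_betw_def inj_on_def f_def)
  have "inj_on g ?I" unfolding inj_on_def g_def using dist by blast
  moreover have "g ` ?I = f ` ?I"
  proof -
    have "(i, j) \<in> g ` ?I \<longleftrightarrow> j \<in> ?J \<and> i \<in> row_in m u ` X j" for i j
      by (auto simp: g_def X_def)
    moreover have "(i, j) \<in> f ` ?I \<longleftrightarrow> j \<in> ?J \<and> i \<in> row_in l t ` X j" for i j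
      by (auto simp: f_def X_def)
    ultimately show ?thesis using imu imt by (metis surj_pair subset_antisym subsetI)
  qed
  ultimately have g: "bij_betw g ?I (f ` ?I)" by (simp add: bij_betw_def)
  define p where "p x = (if x \<in> ?I then inv_into ?I g (f x) else x)" for x
  have "bij_betw (inv_into ?I g \<circ> f) ?I ?I" by (rule bij_betw_trans[OF f bij_betw_inv_into[OF g]])
  then have "bij_betw p ?I ?I" by (rule bij_betw_cong[THEN iffD1, rotated]) (simp add: p_def)
  then have p: "p \<in> Sym k" unfolding sym_iff by (rule bij_imp_permutes) (simp add: p_def)
  have "g (p x) = f x" if "x \<in> ?I" for x
    using that g by (simp add: p_def bij_betw_def f_inv_into_f)
  then have rc: "row_in m u (p x) = row_in l t x" "col_in l t (p x) = col_in l t x" if "x \<in> ?I" for x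
    using that unfolding f_def g_def by blast+
  have pC: "p \<in> column_stabilizer k l t" by (simp add: column_stabilizer_iff[OF t] p rc)
  \<comment> \<open>The permutation \<open>p\<close> matches the rows of the two tableaux, so the
    row lengths agree and the shapes coincide.\<close>
  have "card {x \<in> ?I. row_in m u x = i} = card {x \<in> ?I. row_in l t x = i}" for i
  proof -
    have "bij_betw p {x \<in> ?I. row_in l t x = i} {x \<in> ?I. row_in m u x = i}"
    proof (rule bij_betw_imageI)
      show "inj_on p {x \<in> ?I. row_in l t x = i}"
        using p permutes_inj[of p ?I] by (auto simp: sym_iff inj_on_def)
      show "p ` {x \<in> ?I. row_in l t x = i} = {x \<in> ?I. row_in m u x = i}"
      proof (intro equalityI subsetI)
        fix x assume x: "x \<in> {x \<in> ?I. row_in m u x = i}"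
        then have "inv' p x \<in> ?I" using sym_in[OF sym_inv[OF p]] by blast
        then show "x \<in> p ` {x \<in> ?I. row_in l t x = i}"
          using rc(1)[of "inv' p x"] x by (intro image_eqI[of _ _ "inv' p x"]) (auto simp: sym_inverses[OF p])
      qed (use rc sym_in[OF p] in \<open>auto\<close>)
    qed
    then show ?thesis by (rule bij_betw_same_card[symmetric])
  qed
  then have "shape_of m = shape_of l" by (simp add: card_row[OF t] card_row[OF u] fun_eq_iff)
  then have ml: "m = l" using shape_of_inj[OF m l] by blast
  moreover have "row_in l u y = row_in l (tableau_act l p t) y" if "y \<in> ?I" for y
  proof -
    have "inv' p y \<in> ?I" using that sym_in[OF sym_inv[OF p]] by blast
    then show ?thesis
      using rc(1)[of "inv' p y"] tableau_act_pos(1)[OF p t, of "inv' p y"] ml by (simp add: sym_inverses[OF p])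
  qed
  ultimately have "tabloid k l u = tabloid k l (tableau_act l p t)"
    using u by (subst tabloid_eq_iff) (auto simp: tableau_act_tableaux p t)
  then show "m = l \<and> (\<exists>p\<in>column_stabilizer k l t. tabloid k l u = tabloid k l (tableau_act l p t))"
    using ml pC by blast
qed

section \<open>Rank one operators on Specht modules\<close>

lemma alg_act_basis: "alg_act k m (col_antisym k l t) (basis_vec T)
    = (\<Sum>q\<in>column_stabilizer k l t. pscale (of_int (sign q)) (basis_vec (tabloid_act m q T)))"
  by (simp add: alg_act_col_antisym)

lemma polytabloid_sum:
  assumes t: "t \<in> tableaux k l"
  shows "polytabloid k l t
    = (\<Sum>q\<in>column_stabilizer k l t. pscale (of_int (sign q)) (basis_vec (tabloid k l (tableau_act l q t))))"
  unfolding polytabloid_def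
  by (intro sum.cong refl) (simp add: tabloid_act_tabloid[OF column_stabilizer_sym[OF t] t])

text \<open>The tabloids occurring in a polytabloid are pairwise distinct by
  \<open>column_stabilizer_tabloid_inj\<close>, so each coefficient is a single sign or 0.\<close>

lemma lookup_polytabloid:
  assumes t: "t \<in> tableaux k l"
  shows "p \<in> column_stabilizer k l t \<Longrightarrow> cf (polytabloid k l t) (tabloid k l (tableau_act l p t)) = of_int (sign p)"
    and "\<nexists>p. p \<in> column_stabilizer k l t \<and> T = tabloid k l (tableau_act l p t) \<Longrightarrow> cf (polytabloid k l t) T = 0"
proof -
  let ?C = "column_stabilizer k l t"
  have cf: "cf (polytabloid k l t) T
      = (\<Sum>q\<in>?C. if tabloid k l (tableau_act l q t) = T then of_int (sign q) else 0)" for T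
    by (simp add: polytabloid_sum[OF t] cf_sum cf_basis_vec if_distrib cong: if_cong)
  show "cf (polytabloid k l t) (tabloid k l (tableau_act l p t)) = of_int (sign p)" if p: "p \<in> ?C"
  proof -
    have "cf (polytabloid k l t) (tabloid k l (tableau_act l p t))
        = (\<Sum>q\<in>?C. if q = p then of_int (sign p) else 0)"
      unfolding cf using column_stabilizer_tabloid_inj[OF t _ p] by (intro sum.cong) auto
    then show ?thesis using p finite_column_stabilizer[OF t] by simp
  qed
  show "cf (polytabloid k l t) T = 0" if "\<nexists>p. p \<in> ?C \<and> T = tabloid k l (tableau_act l p t)"
    unfolding cf using that by (intro sum.neutral) auto
qed

text \<open>Reindexing by right multiplication with \<open>p\<close> reproduces the polytabloid and
  leaves the sign of \<open>p\<close> in front.\<close>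

lemma col_antisym_column:
  assumes t: "t \<in> tableaux k l" and p: "p \<in> column_stabilizer k l t"
  shows "alg_act k l (col_antisym k l t) (basis_vec (tabloid k l (tableau_act l p t)))
    = pscale (of_int (sign p)) (polytabloid k l t)" (is "?K = _")
proof -
  let ?C = "column_stabilizer k l t"
  have ps: "p \<in> Sym k" using p by (rule column_stabilizer_sym[OF t])
  have "?K = (\<Sum>q\<in>?C. pscale (of_int (sign q)) (basis_vec (tabloid_act l (q \<circ> p) (tabloid k l t))))"
    unfolding alg_act_basis by (simp only: tabloid_act_comp tabloid_act_tabloid[OF ps t])
  also have "\<dots> = (\<Sum>q\<in>?C. pscale (of_int (sign p)) (pscale (of_int (sign (q \<circ> p))) (basis_vec (tabloid_act l (q \<circ> p) (tabloid k l t)))))"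
  proof (intro sum.cong refl)
    fix q assume "q \<in> ?C"
    then have "sign (q \<circ> p) = sign q * sign p" by (intro sym_sign[OF _ ps] column_stabilizer_sym[OF t])
    then have "sign q = sign p * sign (q \<circ> p)"
      using sign_idempotent[of p] by (simp add: mult.left_commute)
    then show "pscale (of_int (sign q)) (basis_vec (tabloid_act l (q \<circ> p) (tabloid k l t))) =
       pscale (of_int (sign p)) (pscale (of_int (sign (q \<circ> p))) (basis_vec (tabloid_act l (q \<circ> p) (tabloid k l t))))"
      by (simp only: pm.scale_scale of_int_mult[symmetric])
  qed
  also have "\<dots> = pscale (of_int (sign p)) (\<Sum>q\<in>?C. pscale (of_int (sign (q \<circ> p))) (basis_vec (tabloid_act l (q \<circ> p) (tabloid k l t))))"
    by (simp only: pm.scale_sum_right)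
  also have "(\<Sum>q\<in>?C. pscale (of_int (sign (q \<circ> p))) (basis_vec (tabloid_act l (q \<circ> p) (tabloid k l t)))) = polytabloid k l t"
    unfolding polytabloid_def by (rule sum.reindex_bij_betw[OF bij_column_stabilizer_right[OF t p]])
  finally show ?thesis .
qed

text \<open>If the antisymmetrizer does not kill the tabloid, no two entries share a column of
  \<open>t\<close> and a row of \<open>u\<close>. The resulting bound on the weights meets the
  assumed one, which is the equality case of \<open>row_weight_le\<close>.\<close>

lemma col_antisym_cases:
  assumes "l \<in> partitions_of k" "m \<in> partitions_of k" and t: "t \<in> tableaux k l" and u: "u \<in> tableaux k m"
    and "row_weight m \<le> row_weight l"
    and nz: "alg_act k m (col_antisym k l t) (basis_vec (tabloid k m u)) \<noteq> 0"
  shows "m = l \<and> (\<exists>p\<in>column_stabilizer k l t. tabloid k l u = tabloid k l (tableau_act l p t))"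
proof -
  have dist: "row_in m u x \<noteq> row_in m u y"
    if "x \<in> {1..k}" "y \<in> {1..k}" "x \<noteq> y" "col_in l t x = col_in l t y" for x y
    using col_antisym_kills[OF t u that] nz by blast
  have "row_weight l \<le> row_weight m" by (rule row_weight_le(1)[OF assms(1,2) t u]) (rule dist)
  then have "row_weight l = row_weight m" using assms(5) by (rule antisym)
  then show ?thesis by (intro row_weight_le(2)[OF assms(1,2) t u]) (rule dist)
qed

text \<open>Both sides are linear in \<open>v\<close>, so it suffices to treat a single tabloid. It
  is either a column translate of \<open>t\<close>, with inner product equal to a sign, or
  orthogonal to the polytabloid and annihilated.\<close>

lemma alg_act_col_antisym_eq:
  assumes l: "l \<in> partitions_of k" and m: "m \<in> partitions_of k" and t: "t \<in> tableaux k l"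
    and le: "row_weight m \<le> row_weight l" and v: "v \<in> free_on (tabloids k m)"
  shows "alg_act k m (col_antisym k l t) v = (if m = l then pscale (ip v (polytabloid k l t)) (polytabloid k l t) else 0)"
proof -
  let ?R = "\<lambda>v. if m = l then pscale (ip v (polytabloid k l t)) (polytabloid k l t) else 0"
  have "lin ?R" by (rule linI) (simp_all add: ip_add_left ip_scale_left pm.scale_left_distrib)
  moreover have "alg_act k m (col_antisym k l t) b = ?R b" if b: "b \<in> basis_vec ` tabloids k m" for b
  proof -
    obtain u where u: "u \<in> tableaux k m" "b = basis_vec (tabloid k m u)"
      using b by (auto simp: tabloids_def)
    show ?thesis
    proof (cases "m = l \<and> (\<exists>p\<in>column_stabilizer k l t. tabloid k l u = tabloid k l (tableau_act l p t))")
      case True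
      then obtain p where p: "m = l" "p \<in> column_stabilizer k l t" "tabloid k l u = tabloid k l (tableau_act l p t)"
        by blast
      then show ?thesis
        using lookup_polytabloid(1)[OF t p(2)] col_antisym_column[OF t p(2)] by (simp add: u(2) ip_basis_left)
    next
      case False
      then have "alg_act k m (col_antisym k l t) b = 0"
        using col_antisym_cases[OF l m t u(1) le] u(2) by blast
      moreover have "m = l \<Longrightarrow> cf (polytabloid k l t) (tabloid k m u) = 0"
        using lookup_polytabloid(2)[OF t, of "tabloid k m u"] False by blast
      ultimately show ?thesis by (simp add: u(2) ip_basis_left)
    qed
  qed
  moreover have "v \<in> pm.span (basis_vec ` tabloids k m)" using v by (simp add: free_on_eq_span)
  ultimately show ?thesis using pmm.linear_eq_on[OF lin_alg_act] by blast
qed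

section \<open>Operations on group algebra elements and translation of polytabloids\<close>

lemma alg_act_add: "alg_act k m (\<lambda>p. a p + b p) v = alg_act k m a v + alg_act k m b v"
  by (simp add: alg_act_def pm.scale_left_distrib sum.distrib)

lemma alg_act_diff: "alg_act k m (\<lambda>p. a p - b p) v = alg_act k m a v - alg_act k m b v"
  by (simp add: alg_act_def pm.scale_left_diff_distrib sum_subtractf)

lemma alg_act_scale: "alg_act k m (\<lambda>p. c * a p) v = pscale c (alg_act k m a v)"
  by (simp add: alg_act_def pm.scale_sum_right)

lemma alg_act_sum: "alg_act k m (\<lambda>p. \<Sum>i\<in>I. a i p) v = (\<Sum>i\<in>I. alg_act k m (a i) v)"
  by (simp only: alg_act_def pm.scale_sum_left) (rule sum.swap)

text \<open>The coefficient function on the left is that of the product of \<open>s\<close> with the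
  group algebra element \<open>a\<close>.\<close>

lemma alg_act_translate:
  assumes s: "s \<in> Sym k"
  shows "alg_act k m (\<lambda>p. a (inv' s \<circ> p)) v = tab_act m s (alg_act k m a v)"
proof -
  have "bij_betw (\<lambda>p. s \<circ> p) (Sym k) (Sym k)"
    by (rule bij_betw_byWitness[where f' = "\<lambda>p. inv' s \<circ> p"])
       (use s in \<open>auto simp: sym_comp sym_inv o_assoc sym_inverses\<close>)
  from sum.reindex_bij_betw[OF this, of "\<lambda>p. pscale (a (inv' s \<circ> p)) (tab_act m p v)"]
  have "alg_act k m (\<lambda>p. a (inv' s \<circ> p)) v = (\<Sum>p\<in>Sym k. pscale (a p) (tab_act m (s \<circ> p) v))"
    by (simp add: alg_act_def o_assoc sym_inverses[OF s])
  also have "\<dots> = tab_act m s (alg_act k m a v)"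
    by (simp only: alg_act_def tab_act_comp pmm.linear_sum[OF lin_tab_act] pmm.linear_scale[OF lin_tab_act])
  finally show ?thesis .
qed

text \<open>Conjugation by \<open>s\<close> maps the column stabilizer of \<open>t\<close> onto that
  of the translated tableau and preserves signs.\<close>

lemma tab_act_polytabloid:
  assumes s: "s \<in> Sym k" and t: "t \<in> tableaux k l"
  shows "tab_act l s (polytabloid k l t) = polytabloid k l (tableau_act l s t)"
proof -
  let ?C = "column_stabilizer k l t" and ?C' = "column_stabilizer k l (tableau_act l s t)"
  have st: "tableau_act l s t \<in> tableaux k l" by (rule tableau_act_tableaux[OF s t])
  have col: "col_in l (tableau_act l s t) y = col_in l t (inv' s y)" if "y \<in> {1..k}" for y
  proof -
    have "inv' s y \<in> {1..k}" using that sym_in[OF sym_inv[OF s]] by blast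
    from tableau_act_pos(2)[OF s t this] show ?thesis by (simp add: sym_inverses[OF s])
  qed
  have bij: "bij_betw (\<lambda>p. s \<circ> p \<circ> inv' s) ?C ?C'"
  proof (rule bij_betw_byWitness[where f' = "\<lambda>p. inv' s \<circ> p \<circ> s"])
    show "(\<lambda>p. s \<circ> p \<circ> inv' s) ` ?C \<subseteq> ?C'"
    proof safe
      fix p assume p: "p \<in> ?C"
      then have ps: "p \<in> Sym k" by (rule column_stabilizer_sym[OF t])
      have "col_in l (tableau_act l s t) ((s \<circ> p \<circ> inv' s) x) = col_in l (tableau_act l s t) x" if x: "x \<in> {1..k}" for x
      proof -
        have i: "inv' s x \<in> {1..k}" using x sym_in[OF sym_inv[OF s]] by blast
        then have "s (p (inv' s x)) \<in> {1..k}" using s ps by (simp add: sym_in)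
        then show ?thesis using i p x by (simp add: col sym_inverses[OF s] column_stabilizer_iff[OF t])
      qed
      then show "s \<circ> p \<circ> inv' s \<in> ?C'" using s ps by (simp add: column_stabilizer_iff[OF st] sym_comp sym_inv)
    qed
    show "(\<lambda>p. inv' s \<circ> p \<circ> s) ` ?C' \<subseteq> ?C"
    proof safe
      fix p assume p: "p \<in> ?C'"
      then have ps: "p \<in> Sym k" by (rule column_stabilizer_sym[OF st])
      have "col_in l t ((inv' s \<circ> p \<circ> s) x) = col_in l t x" if x: "x \<in> {1..k}" for x
      proof -
        have sx: "s x \<in> {1..k}" using x sym_in[OF s] by blast
        then have "p (s x) \<in> {1..k}" using sym_in[OF ps] by blast
        then have "col_in l t (inv' s (p (s x))) = col_in l (tableau_act l s t) (p (s x))" by (simp add: col)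
        also have "\<dots> = col_in l (tableau_act l s t) (s x)" using p sx by (simp add: column_stabilizer_iff[OF st])
        also have "\<dots> = col_in l t x" using x by (rule tableau_act_pos(2)[OF s t])
        finally show ?thesis by simp
      qed
      then show "inv' s \<circ> p \<circ> s \<in> ?C" using s ps by (simp add: column_stabilizer_iff[OF t] sym_comp sym_inv)
    qed
  qed (auto simp: fun_eq_iff sym_inverses[OF s])
  have "tab_act l s (polytabloid k l t)
      = (\<Sum>p\<in>?C. pscale (of_int (sign p)) (basis_vec (tabloid_act l (s \<circ> p) (tabloid k l t))))"
    unfolding polytabloid_def
    by (simp only: pmm.linear_sum[OF lin_tab_act] pmm.linear_scale[OF lin_tab_act] tab_act_basis tabloid_act_comp)
  also have "\<dots> = (\<Sum>p\<in>?C. pscale (of_int (sign (s \<circ> p \<circ> inv' s))) (basis_vec (tabloid_act l (s \<circ> p \<circ> inv' s) (tabloid k l (tableau_act l s t)))))"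
  proof (intro sum.cong refl)
    fix p assume "p \<in> ?C"
    then have ps: "p \<in> Sym k" by (rule column_stabilizer_sym[OF t])
    have "sign (inv' s) * sign s = 1"
      using sym_sign[OF sym_inv[OF s] s] by (simp add: sym_inverses[OF s] del: o_def)
    moreover have "sign (s \<circ> p \<circ> inv' s) = sign p * (sign (inv' s) * sign s)"
      by (simp only: sym_sign[OF sym_comp[OF s ps] sym_inv[OF s]] sym_sign[OF s ps] mult_ac)
    ultimately have "sign (s \<circ> p \<circ> inv' s) = sign p" by simp
    moreover have "tabloid_act l (s \<circ> p \<circ> inv' s) (tabloid k l (tableau_act l s t)) = tabloid_act l (s \<circ> p) (tabloid k l t)"
      unfolding tabloid_act_tabloid[OF s t, symmetric] tabloid_act_comp[symmetric]
      by (simp only: o_assoc[symmetric] sym_inverses[OF s] o_id)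
    ultimately show "pscale (of_int (sign p)) (basis_vec (tabloid_act l (s \<circ> p) (tabloid k l t))) =
       pscale (of_int (sign (s \<circ> p \<circ> inv' s))) (basis_vec (tabloid_act l (s \<circ> p \<circ> inv' s) (tabloid k l (tableau_act l s t))))"
      by simp
  qed
  also have "\<dots> = polytabloid k l (tableau_act l s t)"
    unfolding polytabloid_def by (rule sum.reindex_bij_betw[OF bij])
  finally show ?thesis .
qed

abbreviation specht_space :: "nat \<Rightarrow> nat list \<Rightarrow> ((nat \<times> nat \<Rightarrow> nat) set \<Rightarrow>\<^sub>0 complex) set"
  where "specht_space k l \<equiv> pm.span (polytabloid k l ` tableaux k l)"

lemma specht_space_free_on: "specht_space k l \<subseteq> free_on (tabloids k l)"
proof (rule pm.span_minimal[OF _ subspace_free_on], safe)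
  fix t assume t: "t \<in> tableaux k l"
  show "polytabloid k l t \<in> free_on (tabloids k l)"
    unfolding polytabloid_sum[OF t]
    by (intro free_on_sum free_on_scale)
       (auto simp: tabloids_def intro!: imageI tableau_act_tableaux t column_stabilizer_sym[OF t])
qed

lemma specht_space_tab_act: "s \<in> Sym k \<Longrightarrow> v \<in> specht_space k l \<Longrightarrow> tab_act l s v \<in> specht_space k l"
proof -
  assume s: "s \<in> Sym k" and v: "v \<in> specht_space k l"
  have "tab_act l s v \<in> tab_act l s ` specht_space k l" using v by blast
  also have "\<dots> = pm.span (tab_act l s ` polytabloid k l ` tableaux k l)"
    by (rule pmm.linear_span_image[OF lin_tab_act, symmetric])
  also have "\<dots> \<subseteq> specht_space k l"
    by (rule pm.span_mono) (auto simp: tab_act_polytabloid[OF s] intro!: imageI tableau_act_tableaux[OF s])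
  finally show ?thesis .
qed

lemma specht_space_alg_act: "v \<in> specht_space k l \<Longrightarrow> alg_act k l a v \<in> specht_space k l"
  unfolding alg_act_def by (rule pm.span_sum, rule pm.span_scale, rule specht_space_tab_act)

text \<open>On the Specht module of \<open>m\<close>, the element \<open>a\<close> acts as
  \<open>v \<mapsto> \<langle>v, b\<rangle> w\<close> if \<open>m = l\<close> and as 0 otherwise.
  The shape \<open>m\<close> is an argument so that the property can first be established for only
  some of the shapes.\<close>

definition rank_one :: "nat \<Rightarrow> nat list \<Rightarrow> ((nat \<times> nat \<Rightarrow> nat) set \<Rightarrow>\<^sub>0 complex) \<Rightarrow> ((nat \<times> nat \<Rightarrow> nat) set \<Rightarrow>\<^sub>0 complex) \<Rightarrow> nat list \<Rightarrow> ((nat \<Rightarrow> nat) \<Rightarrow> complex) \<Rightarrow> bool"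
  where "rank_one k l b w m a \<longleftrightarrow>
    (\<forall>v\<in>specht_space k m. alg_act k m a v = (if m = l then pscale (ip v b) w else 0))"

lemma finite_tableaux: "finite (tableaux k l)"
proof (rule finite_subset)
  show "tableaux k l \<subseteq> (\<Pi>\<^sub>E c\<in>diagram l. {1..k})"
    by (auto simp: tableaux_def PiE_def bij_betw_def)
qed (simp add: finite_PiE finite_diagram)

text \<open>
  On the Specht module of \<open>l\<close> the antisymmetrizer of \<open>t\<close> is a multiple of the projection to
  \<open>polytabloid k l t\<close>; translating it and taking linear combinations gives all operators of rank one.
\<close>

lemma rank_one_lower:
  assumes l: "l \<in> partitions_of k" and b: "b \<in> specht_space k l" and w: "w \<in> specht_space k l"
  shows "\<exists>a. \<forall>m\<in>partitions_of k. row_weight m \<le> row_weight l \<longrightarrow> rank_one k l b w m a"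
proof -
  define P where "P b w \<longleftrightarrow> (\<exists>a. \<forall>m\<in>partitions_of k. row_weight m \<le> row_weight l \<longrightarrow> rank_one k l b w m a)" for b w
  have base: "P (polytabloid k l s) (polytabloid k l t)" if s: "s \<in> tableaux k l" and t: "t \<in> tableaux k l" for s t
  proof -
    \<comment> \<open>The permutation carrying the tableau \<open>s\<close> to \<open>t\<close>.
      Composed with the antisymmetrizer of \<open>s\<close> it sends \<open>v\<close> to a multiple
      of the polytabloid of \<open>t\<close>.\<close>
    define g where "g x = (if x \<in> {1..k} then t (inv_into (diagram l) s x) else x)" for x
    have "bij_betw (t \<circ> inv_into (diagram l) s) {1..k} {1..k}"
      using s t by (intro bij_betw_trans[OF bij_betw_inv_into]) (auto simp: tableaux_def)
    then have "bij_betw g {1..k} {1..k}" by (rule bij_betw_cong[THEN iffD1, rotated]) (simp add: g_def)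
    then have g: "g \<in> Sym k" unfolding sym_iff by (rule bij_imp_permutes) (simp add: g_def)
    have "tableau_act l g s = t"
    proof
      fix c show "tableau_act l g s c = t c"
      proof (cases "c \<in> diagram l")
        case True
        then show ?thesis using tableau_entry(1)[OF s True] s
          by (simp add: tableau_act_def g_def tableaux_def bij_betw_def)
      next
        case False
        then have "t c = undefined" using t by (auto simp: tableaux_def intro: extensional_arb)
        then show ?thesis using False by (simp add: tableau_act_def)
      qed
    qed
    then have e: "tab_act l g (polytabloid k l s) = polytabloid k l t"
      by (simp add: tab_act_polytabloid[OF g s])
    have "rank_one k l (polytabloid k l s) (polytabloid k l t) m (\<lambda>p. col_antisym k l s (inv' g \<circ> p))"
      if m: "m \<in> partitions_of k" "row_weight m \<le> row_weight l" for m
      unfolding rank_one_def alg_act_translate[OF g]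
      using alg_act_col_antisym_eq[OF l m(1) s m(2)] specht_space_free_on[of k m]
      by (auto simp: pmm.linear_scale[OF lin_tab_act] pmm.linear_0[OF lin_tab_act] e)
    then show ?thesis unfolding P_def by blast
  qed
  have base': "P (polytabloid k l s) w" if s: "s \<in> tableaux k l" for s
    using w
  proof (induction rule: pm.span_induct_alt)
    case base
    show ?case unfolding P_def rank_one_def by (intro exI[of _ "\<lambda>_. 0"]) (simp add: alg_act_def)
  next
    case (step c x y)
    then obtain a a' where a: "\<forall>m\<in>partitions_of k. row_weight m \<le> row_weight l \<longrightarrow> rank_one k l (polytabloid k l s) x m a"
      "\<forall>m\<in>partitions_of k. row_weight m \<le> row_weight l \<longrightarrow> rank_one k l (polytabloid k l s) y m a'"
      using base[OF s] unfolding P_def by blast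
    show ?case unfolding P_def
    proof (intro exI ballI impI)
      fix m assume "m \<in> partitions_of k" "row_weight m \<le> row_weight l"
      then show "rank_one k l (polytabloid k l s) (pscale c x + y) m (\<lambda>p. c * a p + a' p)"
        using a by (auto simp: rank_one_def alg_act_add alg_act_scale pm.scale_right_distrib mult.commute)
    qed
  qed
  have "P b w" using b
  proof (induction rule: pm.span_induct_alt)
    case base
    show ?case unfolding P_def rank_one_def by (intro exI[of _ "\<lambda>_. 0"]) (simp add: alg_act_def)
  next
    case (step c x y)
    then obtain a a' where a: "\<forall>m\<in>partitions_of k. row_weight m \<le> row_weight l \<longrightarrow> rank_one k l x w m a"
      "\<forall>m\<in>partitions_of k. row_weight m \<le> row_weight l \<longrightarrow> rank_one k l y w m a'"
      using base' unfolding P_def by blast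
    show ?case unfolding P_def
    proof (intro exI ballI impI)
      fix m assume "m \<in> partitions_of k" "row_weight m \<le> row_weight l"
      \<comment> \<open>The operator depends conjugate linearly on \<open>x\<close>, hence the
        conjugated coefficient.\<close>
      then show "rank_one k l (pscale c x + y) w m (\<lambda>p. cnj c * a p + a' p)"
        using a by (auto simp: rank_one_def alg_act_add alg_act_scale ip_add_right ip_scale_right pm.scale_left_distrib)
    qed
  qed
  then show ?thesis unfolding P_def .
qed

text \<open>Induction from large weights downwards. The element \<open>a0\<close> behaves correctly
  on all shapes of weight at most that of \<open>l\<close>. On each heavier shape its action is a
  sum of rank one operators; by induction these are realized by elements that vanish on all other
  shapes, and subtracting them corrects \<open>a0\<close> without disturbing anything else.\<close>

lemma rank_one_exists:
  assumes "l \<in> partitions_of k" "b \<in> specht_space k l" "w \<in> specht_space k l"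
  shows "\<exists>a. \<forall>m\<in>partitions_of k. rank_one k l b w m a"
proof -
  \<comment> \<open>An upper bound for all weights, so that \<open>N - row_weight l\<close> is a
    measure that decreases as the weight grows.\<close>
  define N where "N = Max (row_weight ` partitions_of k)"
  have le_N: "row_weight m \<le> N" if "m \<in> partitions_of k" for m
    unfolding N_def using that finite_partitions_of by (intro Max_ge) auto
  show ?thesis using assms
  proof (induction "N - row_weight l" arbitrary: l b w rule: less_induct)
    case less
    obtain a0 where a0: "\<And>m. m \<in> partitions_of k \<Longrightarrow> row_weight m \<le> row_weight l \<Longrightarrow> rank_one k l b w m a0"
      using rank_one_lower[OF less.prems] by blast
    define H where "H = {m \<in> partitions_of k. row_weight l < row_weight m}"
    have finH: "finite H" unfolding H_def using finite_partitions_of by simp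
    have "\<exists>B. finite B \<and> pm.span B = specht_space k m \<and> orthogonal_set B" for m
    proof (rule Gram_Schmidt[of "polytabloid k m ` tableaux k m"])
      show "finite (polytabloid k m ` tableaux k m)" by (simp add: finite_tableaux)
    qed blast
    then obtain B where B: "\<And>m. finite (B m)" "\<And>m. pm.span (B m) = specht_space k m" "\<And>m. orthogonal_set (B m)"
      by metis
    have Bs: "x \<in> specht_space k m" if "x \<in> B m" for x m using that pm.span_base[OF that] B(2) by simp
    \<comment> \<open>For an orthogonal basis, \<open>a0\<close> maps \<open>v\<close> to the sum of
      \<open>\<langle>v, x\<rangle> / \<langle>x, x\<rangle>\<close> times \<open>a0 x\<close>; each
      summand is a rank one operator on the heavier shape \<open>m\<close>.\<close>
    have "\<exists>a. \<forall>m'\<in>partitions_of k. rank_one k m x (pscale (1 / ip x x) (alg_act k m a0 x)) m' a"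
      if m: "m \<in> H" and x: "x \<in> B m" for m x
    proof (rule less.hyps)
      show "N - row_weight m < N - row_weight l" using m le_N[of m] by (auto simp: H_def)
    qed (use m x Bs in \<open>auto simp: H_def intro: pm.span_scale specht_space_alg_act\<close>)
    then obtain c where c: "\<And>m x m'. m \<in> H \<Longrightarrow> x \<in> B m \<Longrightarrow> m' \<in> partitions_of k \<Longrightarrow>
        rank_one k m x (pscale (1 / ip x x) (alg_act k m a0 x)) m' (c m x)"
      by metis
    define a where "a = (\<lambda>p. a0 p - (\<Sum>m\<in>H. \<Sum>x\<in>B m. c m x p))"
    have "rank_one k l b w m a" if m: "m \<in> partitions_of k" for m
      unfolding rank_one_def
    proof
      fix v assume v: "v \<in> specht_space k m"
      have cv: "alg_act k m (c m' x) v = (if m = m' then pscale (ip v x / ip x x) (alg_act k m a0 x) else 0)"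
        if "m' \<in> H" "x \<in> B m'" for m' x
        using c[OF that m] v by (auto simp: rank_one_def)
      have "alg_act k m a v = alg_act k m a0 v - (\<Sum>m'\<in>H. \<Sum>x\<in>B m'. alg_act k m (c m' x) v)"
        by (simp add: a_def alg_act_diff alg_act_sum)
      also have "(\<Sum>m'\<in>H. \<Sum>x\<in>B m'. alg_act k m (c m' x) v)
          = (\<Sum>m'\<in>H. if m' = m then \<Sum>x\<in>B m. pscale (ip v x / ip x x) (alg_act k m a0 x) else 0)"
        by (intro sum.cong refl) (auto simp: cv)
      also have "\<dots> = (if m \<in> H then \<Sum>x\<in>B m. pscale (ip v x / ip x x) (alg_act k m a0 x) else 0)"
        using finH by simp
      also have "(\<Sum>x\<in>B m. pscale (ip v x / ip x x) (alg_act k m a0 x))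
          = alg_act k m a0 (\<Sum>x\<in>B m. pscale (ip v x / ip x x) x)"
        by (simp only: pmm.linear_sum[OF lin_alg_act] pmm.linear_scale[OF lin_alg_act])
      also have "(\<Sum>x\<in>B m. pscale (ip v x / ip x x) x) = v"
        using orthogonal_expand[OF B(3) B(1), of v m] v by (simp add: B(2))
      finally have av: "alg_act k m a v = alg_act k m a0 v - (if m \<in> H then alg_act k m a0 v else 0)" .
      show "alg_act k m a v = (if m = l then pscale (ip v b) w else 0)"
      proof (cases "m \<in> H")
        case True
        then show ?thesis using av by (auto simp: H_def)
      next
        case False
        then show ?thesis using av a0[OF m] v m by (auto simp: H_def rank_one_def)
      qed
    qed
    then show ?case by blast
  qed
qed

section \<open>Standard polytabloids\<close>

definition std_tableaux :: "nat \<Rightarrow> (nat \<Rightarrow> nat) \<Rightarrow> (nat \<times> nat \<Rightarrow> nat) set"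
  where "std_tableaux k p = {t \<in> extensional (cells p). bij_betw t (cells p) {1..k} \<and>
    (\<forall>c\<in>cells p. \<forall>d\<in>cells p. fst c \<le> fst d \<and> snd c \<le> snd d \<and> c \<noteq> d \<longrightarrow> t c < t d)}"

lemma finite_std_tableaux: "finite (cells p) \<Longrightarrow> finite (std_tableaux k p)"
proof (rule finite_subset)
  show "std_tableaux k p \<subseteq> (\<Pi>\<^sub>E c\<in>cells p. {1..k})"
    by (auto simp: std_tableaux_def PiE_def bij_betw_def)
qed (simp add: finite_PiE)

text \<open>The removed cell is a corner: no other cell lies weakly below and weakly to the right of
  it. It can therefore receive the new largest entry.\<close>

lemma std_tableaux_extend:
  assumes p: "p \<in> shapes (Suc k)" and i: "i \<in> removable p" and t: "t \<in> std_tableaux k (rem_cell p i)"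
  shows "t((i, p i - 1) := Suc k) \<in> std_tableaux (Suc k) p"
proof -
  let ?c = "(i, p i - 1)" and ?q = "rem_cell p i"
  let ?t = "t(?c := Suc k)"
  have cells: "cells p = insert ?c (cells ?q)" by (rule cells_rem_cell[OF i])
  have notin: "?c \<notin> cells ?q" by (rule corner_notin_rem_cell)
  have anti: "p b \<le> p a" if "a \<le> b" for a b using p that by (auto simp: shapes_def antimono_def)
  have bij: "bij_betw t (cells ?q) {1..k}" and ext: "t \<in> extensional (cells ?q)"
    and mono: "\<And>c d. c \<in> cells ?q \<Longrightarrow> d \<in> cells ?q \<Longrightarrow> fst c \<le> fst d \<Longrightarrow> snd c \<le> snd d \<Longrightarrow> c \<noteq> d \<Longrightarrow> t c < t d"
    using t by (auto simp: std_tableaux_def)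
  have "?t ` cells ?q = t ` cells ?q" using notin by (intro image_cong) auto
  then have im: "?t ` cells ?q = {1..k}" using bij by (simp add: bij_betw_def)
  have "inj_on ?t (cells ?q)" using bij notin by (auto simp: bij_betw_def inj_on_def)
  then have "bij_betw ?t (cells ?q) {1..k}" using im by (simp add: bij_betw_def)
  then have "bij_betw ?t (insert ?c (cells ?q)) (insert (?t ?c) {1..k})"
    using notin by (subst notIn_Un_bij_betw3[symmetric, of ?c, simplified]) (auto simp: atLeastAtMost_iff)
  moreover have "insert (?t ?c) {1..k} = {1..Suc k}" by (auto simp: atLeastAtMost_iff)
  ultimately have bij': "bij_betw ?t (cells p) {1..Suc k}" by (simp add: cells)
  have ext': "?t \<in> extensional (cells p)" using ext by (auto simp: extensional_def cells)
  have mono': "?t c < ?t d" if c: "c \<in> cells p" and d: "d \<in> cells p" and le: "fst c \<le> fst d" "snd c \<le> snd d" and ne: "c \<noteq> d" for c d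
  proof (cases "c = ?c")
    case True
    obtain a b where ab: "d = (a, b)" by (cases d)
    then have b: "b < p a" "i \<le> a" "p i - 1 \<le> b" using d le True by auto
    \<comment> \<open>A cell in a lower row would have column at least \<open>p i - 1\<close>, but
      those rows have length at most \<open>p (Suc i) < p i\<close>.\<close>
    have "a = i"
    proof (rule ccontr)
      assume "a \<noteq> i"
      then have "p a \<le> p (Suc i)" using b by (intro anti) simp
      then show False using b i by (simp add: removable_iff)
    qed
    then show ?thesis using b ab ne True by simp
  next
    case False
    then have cq: "c \<in> cells ?q" using c cells by blast
    show ?thesis
    proof (cases "d = ?c")
      case True
      have "t c \<in> {1..k}" using bij cq by (auto simp: bij_betw_def)
      then show ?thesis using True False by (simp add: atLeastAtMost_iff)
    next
      case False
      then show ?thesis using mono[OF cq _ le ne] d cells \<open>c \<noteq> ?c\<close> by auto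
    qed
  qed
  show ?thesis unfolding std_tableaux_def using bij' ext' mono' by blast
qed

text \<open>Each removable cell contributes the tableaux whose largest entry is placed there.
  Different cells give disjoint families, since a tableau is injective.\<close>

lemma nstd_le_card: "p \<in> shapes k \<Longrightarrow> nstd k p \<le> card (std_tableaux k p)"
proof (induction k arbitrary: p)
  case 0
  then have "cells p = {}" by (auto simp: shapes_0 cells_def)
  then have "std_tableaux 0 p = {\<lambda>_. undefined}" by (auto simp: std_tableaux_def bij_betw_def)
  then show ?case by simp
next
  case (Suc k)
  have fin: "finite (cells p)" using Suc.prems by (rule finite_cells)
  have finq: "finite (cells (rem_cell p i))" if "i \<in> removable p" for i
    using fin cells_rem_cell[OF that] by simp
  define E where "E i = (\<lambda>t. t((i, p i - 1) := Suc k)) ` std_tableaux k (rem_cell p i)" for i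
  have sub: "E i \<subseteq> std_tableaux (Suc k) p" if "i \<in> removable p" for i
    using std_tableaux_extend[OF Suc.prems that] by (auto simp: E_def)
  have card: "card (E i) = card (std_tableaux k (rem_cell p i))" for i
    unfolding E_def
  proof (rule card_image, rule inj_onI)
    fix t u assume tu: "t \<in> std_tableaux k (rem_cell p i)" "u \<in> std_tableaux k (rem_cell p i)"
      and eq: "t((i, p i - 1) := Suc k) = u((i, p i - 1) := Suc k)"
    have "t (i, p i - 1) = u (i, p i - 1)"
      using tu corner_notin_rem_cell[of i p] by (auto simp: std_tableaux_def extensional_def)
    then show "t = u" using eq by (metis fun_upd_triv fun_upd_upd)
  qed
  have disj: "E i \<inter> E j = {}" if i: "i \<in> removable p" and j: "j \<in> removable p" and "i \<noteq> j" for i j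
  proof (rule ccontr)
    assume "E i \<inter> E j \<noteq> {}"
    then obtain t where t: "t \<in> E i" "t \<in> E j" by blast
    have "t (i, p i - 1) = Suc k" using t(1) by (auto simp: E_def)
    moreover have "t (j, p j - 1) = Suc k" using t(2) by (auto simp: E_def)
    moreover have "inj_on t (cells p)" using sub[OF i] t(1) by (auto simp: std_tableaux_def bij_betw_def)
    moreover have "(i, p i - 1) \<in> cells p" "(j, p j - 1) \<in> cells p"
      using cells_rem_cell[OF i] cells_rem_cell[OF j] by blast+
    ultimately have "(i, p i - 1) = (j, p j - 1)" by (metis inj_onD)
    then show False using \<open>i \<noteq> j\<close> by simp
  qed
  have "nstd (Suc k) p \<le> (\<Sum>i\<in>removable p. card (E i))"
    unfolding nstd.simps(2) card by (intro sum_mono Suc.IH rem_cell_shape[OF Suc.prems])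
  also have "\<dots> = card (\<Union>i\<in>removable p. E i)"
    by (rule card_UN_disjoint[symmetric])
       (use fin finq disj in \<open>auto simp: finite_removable E_def finite_std_tableaux\<close>)
  also have "\<dots> \<le> card (std_tableaux (Suc k) p)"
    using sub by (intro card_mono finite_std_tableaux fin) blast
  finally show ?case .
qed

lemma std_tableaux_tableaux: "t \<in> std_tableaux k (shape_of l) \<Longrightarrow> t \<in> tableaux k l"
  by (simp add: std_tableaux_def tableaux_def cells_shape_of)

lemma std_tableaux_less:
  assumes t: "t \<in> std_tableaux k (shape_of l)" and xy: "x \<in> {1..k}" "y \<in> {1..k}"
    and "row_in l t x \<le> row_in l t y" "col_in l t x \<le> col_in l t y" "x \<noteq> y"
  shows "x < y"
proof -
  note tt = std_tableaux_tableaux[OF t]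
  have "(row_in l t x, col_in l t x) \<noteq> (row_in l t y, col_in l t y)"
    using tableau_inj[OF tt xy] assms(6) by auto
  then have "t (row_in l t x, col_in l t x) < t (row_in l t y, col_in l t y)"
    using t tableau_at(1)[OF tt xy(1)] tableau_at(1)[OF tt xy(2)] assms(4,5)
    by (auto simp: std_tableaux_def cells_shape_of)
  then show ?thesis using tableau_at(2)[OF tt] xy by simp
qed

text \<open>The entries to the left of \<open>x\<close> are exactly the smaller entries of its row.
  So the tabloid, which knows only the rows, determines the columns of a standard tableau as
  well.\<close>

lemma col_in_std_tableau:
  assumes l: "l \<in> partitions_of k" and t: "t \<in> std_tableaux k (shape_of l)" and x: "x \<in> {1..k}"
  shows "col_in l t x = card {y \<in> {1..k}. row_in l t y = row_in l t x \<and> y < x}"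
proof -
  note tt = std_tableaux_tableaux[OF t]
  let ?r = "row_in l t x" and ?c = "col_in l t x"
  have cell: "(?r, j) \<in> diagram l" if "j < ?c" for j
    using tableau_at(1)[OF tt x] that by (simp add: cells_shape_of[symmetric])
  have "{y \<in> {1..k}. row_in l t y = ?r \<and> y < x} = (\<lambda>j. t (?r, j)) ` {..<?c}"
  proof (intro equalityI subsetI)
    fix y assume y: "y \<in> {y \<in> {1..k}. row_in l t y = ?r \<and> y < x}"
    then have "col_in l t y < ?c"
      using std_tableaux_less[OF t x, of y] by (fastforce simp: not_le)
    moreover have "y = t (?r, col_in l t y)" using tableau_at(2)[OF tt, of y] y by simp
    ultimately show "y \<in> (\<lambda>j. t (?r, j)) ` {..<?c}" by blast
  next
    fix y assume "y \<in> (\<lambda>j. t (?r, j)) ` {..<?c}"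
    then obtain j where j: "j < ?c" "y = t (?r, j)" by blast
    note e = tableau_entry[OF tt cell[OF j(1)]]
    have "y \<noteq> x" using e(3) j by auto
    then have "y < x"
      using std_tableaux_less[OF t e(1) x] e(2,3) j by simp
    then show "y \<in> {y \<in> {1..k}. row_in l t y = ?r \<and> y < x}" using e j by auto
  qed
  moreover have "inj_on (\<lambda>j. t (?r, j)) {..<?c}"
    using tableau_entry(3)[OF tt cell] by (intro inj_onI) (metis lessThan_iff snd_conv)
  ultimately show ?thesis by (simp add: card_image)
qed

lemma inj_on_tabloid_std:
  assumes l: "l \<in> partitions_of k" shows "inj_on (tabloid k l) (std_tableaux k (shape_of l))"
proof (rule inj_onI)
  fix s t assume s: "s \<in> std_tableaux k (shape_of l)" and t: "t \<in> std_tableaux k (shape_of l)"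
    and eq: "tabloid k l s = tabloid k l t"
  note ss = std_tableaux_tableaux[OF s] and tt = std_tableaux_tableaux[OF t]
  have row: "row_in l s x = row_in l t x" if "x \<in> {1..k}" for x
    using eq that unfolding tabloid_eq_iff[OF ss tt] by blast
  have col: "col_in l s x = col_in l t x" if "x \<in> {1..k}" for x
    unfolding col_in_std_tableau[OF l s that] col_in_std_tableau[OF l t that]
    using row that by (intro arg_cong[of _ _ card]) auto
  show "s = t"
  proof
    fix c show "s c = t c"
    proof (cases "c \<in> diagram l")
      case True
      note e = tableau_entry[OF ss True]
      have "t (row_in l t (s c), col_in l t (s c)) = s c" by (rule tableau_at(2)[OF tt e(1)])
      moreover have "c = (row_in l t (s c), col_in l t (s c))"
        using row[OF e(1)] col[OF e(1)] e(2,3) by (simp add: prod_eq_iff)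
      ultimately show ?thesis by metis
    next
      case False
      then show ?thesis
        using ss tt extensional_arb[of s "diagram l" c] extensional_arb[of t "diagram l" c]
        by (simp add: tableaux_def)
    qed
  qed
qed

section \<open>Ordering tabloids and independence by leading terms\<close>

lemma sum_digits_less: "(\<And>x. r x < B) \<Longrightarrow> (\<Sum>x<M. r x * B ^ x) < (B :: nat) ^ M"
proof (induction M)
  case (Suc M)
  have "(\<Sum>x<Suc M. r x * B ^ x) < r M * B ^ M + B ^ M" using Suc by simp
  also have "\<dots> = Suc (r M) * B ^ M" by simp
  also have "\<dots> \<le> B * B ^ M" using Suc.prems[of M] by (intro mult_right_mono) auto
  finally show ?case by simp
qed simp

text \<open>Read \<open>r\<close> and \<open>r'\<close> as digit strings in base \<open>B\<close>.
  The digit at \<open>M\<close> is the most significant one in which they differ, and the lower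
  digits of \<open>r\<close> together stay below \<open>B ^ M\<close>.\<close>

lemma digits_less:
  fixes r r' :: "nat \<Rightarrow> nat"
  assumes "\<And>x. r x < B" "M \<in> {1..k}" "r M < r' M" "\<And>x. M < x \<Longrightarrow> x \<le> k \<Longrightarrow> r x = r' x"
  shows "(\<Sum>x\<in>{1..k}. r x * B ^ x) < (\<Sum>x\<in>{1..k}. r' x * B ^ x)"
proof -
  have split: "(\<Sum>x\<in>{1..k}. f x) = (\<Sum>x\<in>{1..<M}. f x) + f M + (\<Sum>x\<in>{M<..k}. f x)" for f :: "nat \<Rightarrow> nat"
  proof -
    have "{1..k} = insert M ({1..<M} \<union> {M<..k})" using assms(2) by (auto simp: atLeastAtMost_iff)
    moreover have "(\<Sum>x\<in>{1..<M} \<union> {M<..k}. f x) = (\<Sum>x\<in>{1..<M}. f x) + (\<Sum>x\<in>{M<..k}. f x)"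
      by (rule sum.union_disjoint) auto
    ultimately show ?thesis by simp
  qed
  have "(\<Sum>x\<in>{1..<M}. r x * B ^ x) \<le> (\<Sum>x<M. r x * B ^ x)"
    by (rule sum_mono2) auto
  also have "\<dots> < B ^ M" using assms(1) by (rule sum_digits_less)
  finally have "(\<Sum>x\<in>{1..<M}. r x * B ^ x) + r M * B ^ M < Suc (r M) * B ^ M" by simp
  also have "\<dots> \<le> r' M * B ^ M" using assms(3) by (intro mult_right_mono) auto
  finally have "(\<Sum>x\<in>{1..<M}. r x * B ^ x) + r M * B ^ M < (\<Sum>x\<in>{1..<M}. r' x * B ^ x) + r' M * B ^ M"
    by simp
  moreover have "(\<Sum>x\<in>{M<..k}. r x * B ^ x) = (\<Sum>x\<in>{M<..k}. r' x * B ^ x)"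
    using assms(4) by (intro sum.cong) auto
  ultimately show ?thesis unfolding split by simp
qed

text \<open>In a vanishing combination, take a vector with nonzero coefficient whose leading index
  \<open>h s\<close> has maximal weight. No other vector that takes part has a coefficient at
  \<open>h s\<close>, so this term cannot cancel.\<close>

lemma triangular_independent:
  fixes e :: "'t \<Rightarrow> ('b \<Rightarrow>\<^sub>0 complex)" and w :: "'b \<Rightarrow> nat"
  assumes fin: "finite T" and lead: "\<And>t. t \<in> T \<Longrightarrow> cf (e t) (h t) \<noteq> 0"
    and lower: "\<And>t b. t \<in> T \<Longrightarrow> cf (e t) b \<noteq> 0 \<Longrightarrow> b = h t \<or> w b < w (h t)" and inj: "inj_on h T"
  shows "inj_on e T" "pm.independent (e ` T)"
proof -
  have zero: "c t = 0" if 0: "(\<Sum>t\<in>T. pscale (c t) (e t)) = 0" and t: "t \<in> T" for c t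
  proof (rule ccontr)
    assume "c t \<noteq> 0"
    define U where "U = {t \<in> T. c t \<noteq> 0}"
    have U: "finite U" "U \<noteq> {}" using fin t \<open>c t \<noteq> 0\<close> by (auto simp: U_def)
    have "Max ((w \<circ> h) ` U) \<in> (w \<circ> h) ` U" using U by (intro Max_in) auto
    then obtain s where s: "s \<in> U" "w (h s) = Max ((w \<circ> h) ` U)" by auto
    have max: "w (h u) \<le> w (h s)" if "u \<in> U" for u
      unfolding s(2) using U that by (intro Max_ge) auto
    have "0 = (\<Sum>u\<in>T. c u * cf (e u) (h s))"
      using arg_cong[OF 0, of "\<lambda>f. cf f (h s)"] by (simp add: cf_sum)
    also have "\<dots> = (\<Sum>u\<in>T. if u = s then c s * cf (e s) (h s) else 0)"
    proof (intro sum.cong refl)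
      fix u assume u: "u \<in> T"
      have "cf (e u) (h s) = 0" if "u \<noteq> s" "c u \<noteq> 0"
      proof (rule ccontr)
        assume "cf (e u) (h s) \<noteq> 0"
        then have "h s = h u \<or> w (h s) < w (h u)" using lower[OF u] by blast
        then show False using inj u s(1) that max[of u] by (auto simp: U_def inj_on_def)
      qed
      then show "c u * cf (e u) (h s) = (if u = s then c s * cf (e s) (h s) else 0)" by auto
    qed
    also have "\<dots> = c s * cf (e s) (h s)" using s(1) fin by (simp add: U_def)
    finally show False using s(1) lead by (auto simp: U_def)
  qed
  show inj_e: "inj_on e T"
  proof (rule inj_onI, rule ccontr)
    fix s t assume st: "s \<in> T" "t \<in> T" "e s = e t" "s \<noteq> t"
    let ?c = "\<lambda>u. if u = s then 1 else if u = t then -1 else 0"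
    have "(\<Sum>u\<in>T. pscale (?c u) (e u)) = (\<Sum>u\<in>{s, t}. pscale (?c u) (e u))"
      using fin st by (intro sum.mono_neutral_right) auto
    also have "\<dots> = 0" using st by simp
    finally show False using zero[of ?c s] st(1) by simp
  qed
  show "pm.independent (e ` T)"
  proof (rule pm.independent_if_scalars_zero)
    fix f x assume "(\<Sum>x\<in>e ` T. pscale (f x) x) = 0" "x \<in> e ` T"
    then show "f x = 0" using zero[of "f \<circ> e"] by (auto simp: sum.reindex[OF inj_e])
  qed (simp add: fin)
qed

text \<open>Standard polytabloids are independent: for a standard tableau \<open>t\<close>, the
  tabloid of \<open>t\<close> itself is the greatest one in its polytabloid with respect to
  \<open>w\<close>. Independent families in the Specht module are bounded by any spanning
  set.\<close>

lemma nstd_le_card_basis: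
  assumes l: "l \<in> partitions_of k" and B: "finite B" "pm.span B = specht_space k l"
  shows "nstd k (shape_of l) \<le> card B"
proof -
  let ?T = "std_tableaux k (shape_of l)"
  \<comment> \<open>The rows of the entries form a digit string, with the largest entry most
    significant. The base exceeds every row index.\<close>
  define W where "W r = (\<Sum>x\<in>{1..k}. r x * Suc (length l) ^ x)" for r :: "nat \<Rightarrow> nat"
  \<comment> \<open>Row equivalent tableaux have the same rows, so the choice of a representative is
    immaterial.\<close>
  define w where "w T = W (row_in l (SOME u. u \<in> T))" for T
  have w: "w (tabloid k l u) = W (row_in l u)" if u: "u \<in> tableaux k l" for u
  proof -
    have "u \<in> tabloid k l u" using u by (simp add: row_equiv_iff)
    then have "(SOME v. v \<in> tabloid k l u) \<in> tabloid k l u"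
      by (rule someI[where P = "\<lambda>v. v \<in> tabloid k l u"])
    then show ?thesis unfolding w_def W_def by (intro sum.cong) (auto simp: row_equiv_iff)
  qed
  have lower: "W (row_in l (tableau_act l q t)) < W (row_in l t)"
    if t: "t \<in> ?T" and q: "q \<in> column_stabilizer k l t" and "q \<noteq> id" for t q
  proof -
    note tt = std_tableaux_tableaux[OF t]
    have qs: "q \<in> Sym k" using q by (rule column_stabilizer_sym[OF tt])
    have row: "row_in l (tableau_act l q t) x = row_in l t (inv' q x)" if "x \<in> {1..k}" for x
    proof -
      have "inv' q x \<in> {1..k}" using that sym_in[OF sym_inv[OF qs]] by blast
      from tableau_act_pos(1)[OF qs tt this] show ?thesis by (simp add: sym_inverses[OF qs])
    qed
    define U where "U = {x \<in> {1..k}. q x \<noteq> x}"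
    have "U \<noteq> {}"
    proof
      assume "U = {}"
      then have "q x = x" for x
        using qs by (cases "x \<in> {1..k}") (auto simp: U_def sym_iff permutes_def)
      then show False using \<open>q \<noteq> id\<close> by auto
    qed
    \<comment> \<open>The largest entry moved by \<open>q\<close>. Its place is taken from a smaller
      entry \<open>N\<close> of the same column, which is higher up because \<open>t\<close> is
      standard. So the digit at \<open>M\<close> drops while all digits above it stay the
      same.\<close>
    define M where "M = Max U"
    have finU: "finite U" by (simp add: U_def)
    have M: "M \<in> {1..k}" "q M \<noteq> M" using Max_in[OF finU \<open>U \<noteq> {}\<close>] by (auto simp: U_def M_def)
    define N where "N = inv' q M"
    have qN: "q N = M" by (simp add: N_def sym_inverses[OF qs])
    have N: "N \<in> {1..k}" using M sym_in[OF sym_inv[OF qs]] unfolding N_def by blast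
    have "N \<noteq> M" using qN M by auto
    then have "N \<in> U" using N qN by (auto simp: U_def)
    then have "N < M" using Max_ge[OF finU] \<open>N \<noteq> M\<close> unfolding M_def by fastforce
    have "col_in l t N = col_in l t M" using q N qN by (auto simp: column_stabilizer_iff[OF tt])
    then have less: "row_in l t N < row_in l t M"
      using std_tableaux_less[OF t M(1) N] \<open>N < M\<close> by (fastforce simp: not_le)
    \<comment> \<open>Set to 0 outside \<open>{1..k}\<close>, because \<open>digits_less\<close>
      asks for a bound on all digits.\<close>
    define r where "r x = (if x \<in> {1..k} then row_in l (tableau_act l q t) x else 0)" for x
    have "r x < Suc (length l)" for x
      using tableau_at(1)[OF tableau_act_tableaux[OF qs tt], of x] by (auto simp: r_def diagram_def)
    moreover have "r M < row_in l t M" using less M by (simp add: r_def row N_def)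
    moreover have "r x = row_in l t x" if "M < x" "x \<le> k" for x
    proof -
      have "x \<in> {1..k}" using that by (simp add: atLeastAtMost_iff)
      moreover have "x \<notin> U"
      proof
        assume "x \<in> U"
        then have "x \<le> M" unfolding M_def by (rule Max_ge[OF finU])
        then show False using that by simp
      qed
      then have "q x = x" using calculation by (simp add: U_def)
      then have "inv' q x = x" using sym_inverses(2)[OF qs, of x] by simp
      ultimately show ?thesis by (simp add: r_def row)
    qed
    ultimately have "(\<Sum>x\<in>{1..k}. r x * Suc (length l) ^ x) < W (row_in l t)"
      unfolding W_def using M(1) by (intro digits_less[of r _ M])
    moreover have "(\<Sum>x\<in>{1..k}. r x * Suc (length l) ^ x) = W (row_in l (tableau_act l q t))"
      unfolding W_def by (intro sum.cong) (auto simp: r_def)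
    ultimately show ?thesis by simp
  qed
  have fin: "finite ?T" using shape_of_shapes[OF l] by (intro finite_std_tableaux finite_cells)
  have lead: "cf (polytabloid k l t) (tabloid k l t) \<noteq> 0" if "t \<in> ?T" for t
    using lookup_polytabloid(1)[OF std_tableaux_tableaux[OF that] column_stabilizer_id[OF std_tableaux_tableaux[OF that]]]
    by (simp add: tableau_act_id[OF std_tableaux_tableaux[OF that]])
  have low: "T = tabloid k l t \<or> w T < w (tabloid k l t)" if t: "t \<in> ?T" and T: "cf (polytabloid k l t) T \<noteq> 0" for t T
  proof -
    note tt = std_tableaux_tableaux[OF t]
    obtain q where q: "q \<in> column_stabilizer k l t" "T = tabloid k l (tableau_act l q t)"
      using lookup_polytabloid(2)[OF tt] T by blast
    show ?thesis
    proof (cases "q = id")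
      case True
      then show ?thesis using q by (simp add: tableau_act_id[OF tt])
    next
      case False
      then show ?thesis
        using lower[OF t q(1)] w[OF tt] w[OF tableau_act_tableaux[OF column_stabilizer_sym[OF tt q(1)] tt]] q(2)
        by simp
    qed
  qed
  note ind = triangular_independent[where e = "polytabloid k l" and h = "tabloid k l" and w = w, OF fin lead low inj_on_tabloid_std[OF l]]
  have "polytabloid k l ` ?T \<subseteq> pm.span B"
    unfolding B(2) by (auto intro!: pm.span_base imageI std_tableaux_tableaux)
  then have "card (polytabloid k l ` ?T) \<le> card B"
    using pm.independent_span_bound[OF B(1) ind(2)] by blast
  then show ?thesis using nstd_le_card[OF shape_of_shapes[OF l]] card_image[OF ind(1)] by simp
qed

section \<open>Outer tensor products of Specht modules\<close>

text \<open>Basis tuples are extensional functions, so any other function has coefficient 0. Within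
  the extensional tuples the product vanishes automatically outside the product of the
  supports.\<close>

lemma lookup_pure_tensor:
  assumes "finite I"
  shows "cf (pure_tensor I v) x = (if x \<in> extensional I then \<Prod>i\<in>I. cf (v i) (x i) else 0)"
proof -
  let ?P = "\<Pi>\<^sub>E i\<in>I. Poly_Mapping.keys (v i)"
  have "cf (pure_tensor I v) x = (\<Sum>y\<in>?P. if y = x then \<Prod>i\<in>I. cf (v i) (x i) else 0)"
    unfolding pure_tensor_def cf_sum by (intro sum.cong) (auto simp: cf_basis_vec)
  also have "\<dots> = (if x \<in> ?P then \<Prod>i\<in>I. cf (v i) (x i) else 0)"
    using assms by (simp add: finite_PiE)
  also have "\<dots> = (if x \<in> extensional I then \<Prod>i\<in>I. cf (v i) (x i) else 0)"
    using assms by (auto simp: PiE_def Pi_def in_keys_iff)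
  finally show ?thesis .
qed

lemma pure_tensor_cong: "(\<And>i. i \<in> I \<Longrightarrow> v i = w i) \<Longrightarrow> pure_tensor I v = pure_tensor I w"
  unfolding pure_tensor_def by (simp cong: PiE_cong prod.cong)

lemma pure_tensor_basis:
  assumes "finite I" shows "pure_tensor I (\<lambda>i. basis_vec (x i)) = basis_vec (restrict x I)"
proof (rule poly_mapping_eqI)
  fix y
  have "(\<Prod>i\<in>I. cf (basis_vec (x i)) (y i)) = (if \<forall>i\<in>I. x i = y i then 1 else 0)"
    using assms by (auto simp: cf_basis_vec intro!: prod_zero)
  moreover have "restrict x I = y \<longleftrightarrow> y \<in> extensional I \<and> (\<forall>i\<in>I. x i = y i)"
    by (auto simp: fun_eq_iff extensional_def)
  ultimately show "cf (pure_tensor I (\<lambda>i. basis_vec (x i))) y = cf (basis_vec (restrict x I)) y"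
    by (simp add: lookup_pure_tensor[OF assms] cf_basis_vec)
qed

text \<open>Multilinearity, obtained coefficientwise by distributing a product of sums.\<close>

lemma pure_tensor_expand:
  assumes "finite I" "\<And>i. i \<in> I \<Longrightarrow> finite (A i)"
  shows "pure_tensor I (\<lambda>i. \<Sum>b\<in>A i. pscale (c i b) (w i b))
    = (\<Sum>x\<in>PiE I A. pscale (\<Prod>i\<in>I. c i (x i)) (pure_tensor I (\<lambda>i. w i (x i))))"
proof (rule poly_mapping_eqI)
  fix y
  have "(\<Prod>i\<in>I. \<Sum>b\<in>A i. c i b * cf (w i b) (y i))
      = (\<Sum>x\<in>PiE I A. (\<Prod>i\<in>I. c i (x i)) * (\<Prod>i\<in>I. cf (w i (x i)) (y i)))"
    using assms by (simp add: prod_sum_PiE prod.distrib)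
  then show "cf (pure_tensor I (\<lambda>i. \<Sum>b\<in>A i. pscale (c i b) (w i b))) y
    = cf (\<Sum>x\<in>PiE I A. pscale (\<Prod>i\<in>I. c i (x i)) (pure_tensor I (\<lambda>i. w i (x i)))) y"
    by (simp add: lookup_pure_tensor[OF assms(1)] cf_sum)
qed

lemma pure_tensor_scale:
  assumes "finite I"
  shows "pure_tensor I (\<lambda>i. pscale (c i) (w i)) = pscale (\<Prod>i\<in>I. c i) (pure_tensor I w)"
  by (rule poly_mapping_eqI) (simp add: lookup_pure_tensor[OF assms] prod.distrib)

lemma pure_tensor_zero:
  assumes "finite I" "i \<in> I" "w i = 0"
  shows "pure_tensor I w = 0"
  by (rule poly_mapping_eqI) (use assms in \<open>auto simp: lookup_pure_tensor intro!: prod_zero bexI[of _ i]\<close>)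

text \<open>The operator on tuples is the tensor product of the \<open>L i\<close>; it is prescribed
  on basis tuples only, and multilinearity gives its value on all pure tensors.\<close>

lemma pure_tensor_act:
  assumes fin: "finite I" and L: "\<And>i. i \<in> I \<Longrightarrow> lin (L i)"
  shows "lin_ext (\<lambda>x. pure_tensor I (\<lambda>i. L i (basis_vec (x i)))) (pure_tensor I v) = pure_tensor I (\<lambda>i. L i (v i))"
proof -
  have "pure_tensor I (\<lambda>i. L i (v i))
      = pure_tensor I (\<lambda>i. \<Sum>b\<in>Poly_Mapping.keys (v i). pscale (cf (v i) b) (L i (basis_vec b)))"
    by (rule pure_tensor_cong) (subst lin_eq_lin_ext[OF L], simp_all add: lin_ext_def)
  also have "\<dots> = (\<Sum>x\<in>(\<Pi>\<^sub>E i\<in>I. Poly_Mapping.keys (v i)). pscale (\<Prod>i\<in>I. cf (v i) (x i))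
      (pure_tensor I (\<lambda>i. L i (basis_vec (x i)))))"
    by (rule pure_tensor_expand) (simp_all add: fin)
  also have "\<dots> = lin_ext (\<lambda>x. pure_tensor I (\<lambda>i. L i (basis_vec (x i)))) (pure_tensor I v)"
    by (simp add: pure_tensor_def[of I v] lin_ext_sum lin_ext_scale)
  finally show ?thesis ..
qed

lemma ip_pure_tensor:
  assumes fin: "finite I"
  shows "ip (pure_tensor I v) (pure_tensor I w) = (\<Prod>i\<in>I. ip (v i) (w i))"
proof -
  let ?P = "\<Pi>\<^sub>E i\<in>I. Poly_Mapping.keys (v i)"
  have "Poly_Mapping.keys (pure_tensor I v) \<subseteq> ?P"
    using fin by (auto simp: in_keys_iff lookup_pure_tensor PiE_def split: if_splits)
  moreover have "finite ?P" using fin by (simp add: finite_PiE)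
  ultimately have "ip (pure_tensor I v) (pure_tensor I w)
      = (\<Sum>x\<in>?P. cf (pure_tensor I v) x * cnj (cf (pure_tensor I w) x))"
    by (intro ip_superset)
  also have "\<dots> = (\<Sum>x\<in>?P. \<Prod>i\<in>I. cf (v i) (x i) * cnj (cf (w i) (x i)))"
    by (intro sum.cong refl) (auto simp: lookup_pure_tensor[OF fin] prod.distrib PiE_def)
  also have "\<dots> = (\<Prod>i\<in>I. ip (v i) (w i))"
    unfolding ip_def using fin by (intro prod_sum_PiE[symmetric]) auto
  finally show ?thesis .
qed

text \<open>The form is multiplicative on pure tensors, so two different choices of basis vectors
  are orthogonal already in one factor. Expanding every factor shows that these products span the
  whole tensor product.\<close>

lemma pure_tensor_orthogonal:
  assumes fin: "finite I" and B: "\<And>i. i \<in> I \<Longrightarrow> finite (B i)" "\<And>i. i \<in> I \<Longrightarrow> orthogonal_set (B i)"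
  shows "inj_on (pure_tensor I) (PiE I B)" "orthogonal_set (pure_tensor I ` PiE I B)"
    "pm.span (pure_tensor I ` PiE I B) = pm.span {pure_tensor I v | v. v \<in> (\<Pi>\<^sub>E i\<in>I. pm.span (B i))}"
proof -
  have nz: "ip (pure_tensor I v) (pure_tensor I v) \<noteq> 0" if "v \<in> PiE I B" for v
    using that fin B(2) by (auto simp: ip_pure_tensor orthogonal_set_def PiE_def Pi_def)
  have orth: "ip (pure_tensor I v) (pure_tensor I w) = 0" if v: "v \<in> PiE I B" and w: "w \<in> PiE I B" and "v \<noteq> w" for v w
  proof -
    obtain i where i: "i \<in> I" "v i \<noteq> w i" using PiE_ext[OF v w] \<open>v \<noteq> w\<close> by blast
    then have "ip (v i) (w i) = 0" using v w B(2)[OF i(1)] by (auto simp: orthogonal_set_def PiE_def Pi_def)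
    then show ?thesis using fin i(1) by (auto simp: ip_pure_tensor)
  qed
  show "inj_on (pure_tensor I) (PiE I B)" using nz orth by (metis inj_onI)
  show "orthogonal_set (pure_tensor I ` PiE I B)"
    unfolding orthogonal_set_def
  proof (intro conjI ballI impI notI)
    assume "0 \<in> pure_tensor I ` PiE I B"
    then show False using nz by (metis imageE ip_0_left)
  next
    fix b c assume "b \<in> pure_tensor I ` PiE I B" "c \<in> pure_tensor I ` PiE I B" "b \<noteq> c"
    then show "ip b c = 0" using orth by blast
  qed
  show "pm.span (pure_tensor I ` PiE I B) = pm.span {pure_tensor I v | v. v \<in> (\<Pi>\<^sub>E i\<in>I. pm.span (B i))}"
  proof
    show "pm.span (pure_tensor I ` PiE I B) \<subseteq> pm.span {pure_tensor I v | v. v \<in> (\<Pi>\<^sub>E i\<in>I. pm.span (B i))}"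
    proof (rule pm.span_mono, safe)
      fix v assume "v \<in> PiE I B"
      then have "v \<in> (\<Pi>\<^sub>E i\<in>I. pm.span (B i))" by (auto simp: PiE_def Pi_def intro: pm.span_base)
      then show "\<exists>w. pure_tensor I v = pure_tensor I w \<and> w \<in> (\<Pi>\<^sub>E i\<in>I. pm.span (B i))" by blast
    qed
    show "pm.span {pure_tensor I v | v. v \<in> (\<Pi>\<^sub>E i\<in>I. pm.span (B i))} \<subseteq> pm.span (pure_tensor I ` PiE I B)"
    proof (rule pm.span_minimal[OF _ pm.subspace_span], safe)
      fix v assume v: "v \<in> (\<Pi>\<^sub>E i\<in>I. pm.span (B i))"
      have "pure_tensor I v = pure_tensor I (\<lambda>i. \<Sum>b\<in>B i. pscale (ip (v i) b / ip b b) b)"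
        by (intro pure_tensor_cong orthogonal_expand B PiE_mem[OF v])
      also have "\<dots> = (\<Sum>x\<in>PiE I B. pscale (\<Prod>i\<in>I. ip (v i) (x i) / ip (x i) (x i)) (pure_tensor I (\<lambda>i. x i)))"
        using fin B by (intro pure_tensor_expand)
      also have "\<dots> \<in> pm.span (pure_tensor I ` PiE I B)"
        by (intro pm.span_sum pm.span_scale pm.span_base) auto
      finally show "pure_tensor I v \<in> pm.span (pure_tensor I ` PiE I B)" .
    qed
  qed
qed

definition specht_basis :: "nat \<Rightarrow> nat list \<Rightarrow> ((nat \<times> nat \<Rightarrow> nat) set \<Rightarrow>\<^sub>0 complex) set"
  where "specht_basis k l = (SOME B. finite B \<and> pm.span B = specht_space k l \<and> orthogonal_set B)"

lemma specht_basis: "finite (specht_basis k l)" "pm.span (specht_basis k l) = specht_space k l"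
  "orthogonal_set (specht_basis k l)"
proof -
  have "\<exists>B. finite B \<and> pm.span B = specht_space k l \<and> orthogonal_set B"
  proof (rule Gram_Schmidt[of "polytabloid k l ` tableaux k l"])
    show "finite (polytabloid k l ` tableaux k l)" by (simp add: finite_tableaux)
  qed blast
  then have "finite (specht_basis k l) \<and> pm.span (specht_basis k l) = specht_space k l \<and> orthogonal_set (specht_basis k l)"
    unfolding specht_basis_def by (rule someI_ex)
  then show "finite (specht_basis k l)" "pm.span (specht_basis k l) = specht_space k l"
    "orthogonal_set (specht_basis k l)" by blast+
qed

context
  fixes n :: nat and k :: "nat \<Rightarrow> nat"
begin

abbreviation outer_specht :: "(nat \<Rightarrow> nat list) \<Rightarrow> (nat \<Rightarrow> nat \<Rightarrow> nat, (nat \<Rightarrow> (nat \<times> nat \<Rightarrow> nat) set) \<Rightarrow>\<^sub>0 complex) cmodule"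
  where "outer_specht l \<equiv> outer_tensor {1..n} (\<lambda>i. specht (k i) (l i))"

definition outer_basis :: "(nat \<Rightarrow> nat list) \<Rightarrow> ((nat \<Rightarrow> (nat \<times> nat \<Rightarrow> nat) set) \<Rightarrow>\<^sub>0 complex) set"
  where "outer_basis l = pure_tensor {1..n} ` (\<Pi>\<^sub>E i\<in>{1..n}. specht_basis (k i) (l i))"

lemma outer_basis:
  "finite (outer_basis l)" "orthogonal_set (outer_basis l)" "pm.span (outer_basis l) = carrier (outer_specht l)"
  "card (outer_basis l) = (\<Prod>i\<in>{1..n}. card (specht_basis (k i) (l i)))"
proof -
  note p = pure_tensor_orthogonal[of "{1..n}" "\<lambda>i. specht_basis (k i) (l i)", OF finite_atLeastAtMost specht_basis(1) specht_basis(3)]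
  show "finite (outer_basis l)" by (simp add: outer_basis_def finite_PiE specht_basis)
  show "orthogonal_set (outer_basis l)" unfolding outer_basis_def by (rule p(2))
  show "pm.span (outer_basis l) = carrier (outer_specht l)"
    using p(3) by (simp add: outer_basis_def specht_basis outer_tensor_def sub_free_def specht_def)
  show "card (outer_basis l) = (\<Prod>i\<in>{1..n}. card (specht_basis (k i) (l i)))"
    unfolding outer_basis_def card_image[OF p(1)] by (simp add: card_PiE)
qed

lemma outer_act: "act (outer_specht l) h = lin_ext (\<lambda>x. pure_tensor {1..n} (\<lambda>i. tab_act (l i) (h i) (basis_vec (x i))))"
  by (simp add: outer_tensor_def sub_free_def specht_def tab_act_def)

lemma lin_outer_act: "lin (act (outer_specht l) h)"
  unfolding outer_act by (rule lin_lin_ext)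

lemma outer_act_pure: "act (outer_specht l) h (pure_tensor {1..n} v) = pure_tensor {1..n} (\<lambda>i. tab_act (l i) (h i) (v i))"
  unfolding outer_act by (rule pure_tensor_act) (simp_all add: lin_tab_act)

text \<open>Agreement on \<open>{1..n}\<close> is enough because basis tuples are cut off outside
  this set. This is how the componentwise homomorphism property of \<phi> will be used.\<close>

lemma outer_act_comp:
  assumes "\<And>i. i \<in> {1..n} \<Longrightarrow> f i = g i \<circ> h i"
  shows "act (outer_specht l) f v = act (outer_specht l) g (act (outer_specht l) h v)"
proof -
  have b: "act (outer_specht l) h (basis_vec x) = basis_vec (\<lambda>i\<in>{1..n}. tabloid_act (l i) (h i) (x i))" for h x
    unfolding outer_act by (simp add: pure_tensor_basis)
  have "lin (\<lambda>v. act (outer_specht l) g (act (outer_specht l) h v))"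
    by (rule lin_comp[OF lin_outer_act lin_outer_act])
  moreover have "act (outer_specht l) f (basis_vec x) = act (outer_specht l) g (act (outer_specht l) h (basis_vec x))" for x
    unfolding b using assms by (intro arg_cong[of _ _ basis_vec] restrict_ext) (simp add: tabloid_act_comp)
  ultimately show ?thesis
    using lin_eq_lin_ext[OF lin_outer_act, of l f v] lin_eq_lin_ext[of "\<lambda>v. act (outer_specht l) g (act (outer_specht l) h v)" v]
    by simp
qed

lemma outer_act_closed:
  assumes h: "h \<in> (\<Pi>\<^sub>E i\<in>{1..n}. Sym (k i))" and v: "v \<in> carrier (outer_specht l)"
  shows "act (outer_specht l) h v \<in> carrier (outer_specht l)"
proof -
  let ?P = "{pure_tensor {1..n} v | v. v \<in> (\<Pi>\<^sub>E i\<in>{1..n}. specht_space (k i) (l i))}"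
  have c: "carrier (outer_specht l) = pm.span ?P"
    by (simp add: outer_tensor_def sub_free_def specht_def)
  have "act (outer_specht l) h v \<in> act (outer_specht l) h ` pm.span ?P" using v c by blast
  also have "\<dots> = pm.span (act (outer_specht l) h ` ?P)"
    by (rule pmm.linear_span_image[OF lin_outer_act, symmetric])
  also have "\<dots> \<subseteq> pm.span ?P"
  proof (rule pm.span_mono, safe)
    fix v assume v: "v \<in> (\<Pi>\<^sub>E i\<in>{1..n}. specht_space (k i) (l i))"
    let ?w = "\<lambda>i\<in>{1..n}. tab_act (l i) (h i) (v i)"
    have "act (outer_specht l) h (pure_tensor {1..n} v) = pure_tensor {1..n} ?w"
      unfolding outer_act_pure by (rule pure_tensor_cong) simp
    moreover have "?w \<in> (\<Pi>\<^sub>E i\<in>{1..n}. specht_space (k i) (l i))"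
      using h v by (auto intro!: specht_space_tab_act simp: PiE_def Pi_def)
    ultimately show "\<exists>w. act (outer_specht l) h (pure_tensor {1..n} v) = pure_tensor {1..n} w
        \<and> w \<in> (\<Pi>\<^sub>E i\<in>{1..n}. specht_space (k i) (l i))" by blast
  qed
  finally show ?thesis by (simp only: c)
qed

text \<open>A product of coefficient functions represents a pure tensor of group algebra elements,
  which acts on pure tensors factor by factor.\<close>

lemma outer_alg_act_pure:
  "(\<Sum>h\<in>(\<Pi>\<^sub>E i\<in>{1..n}. Sym (k i)). pscale (\<Prod>i\<in>{1..n}. a i (h i)) (act (outer_specht l) h (pure_tensor {1..n} v)))
   = pure_tensor {1..n} (\<lambda>i. alg_act (k i) (l i) (a i) (v i))"
  unfolding outer_act_pure alg_act_def
  by (rule pure_tensor_expand[symmetric]) (simp_all add: finite_sym)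

text \<open>Multiply rank one elements for the factors. If \<open>m \<noteq> l\<close>, the shapes
  differ in some component and that factor is mapped to 0.\<close>

lemma outer_rank_one_exists:
  assumes l: "l \<in> multipartitions n k" and b: "b \<in> outer_basis l" and w: "w \<in> outer_basis l"
  shows "\<exists>a. \<forall>m\<in>multipartitions n k. \<forall>v\<in>carrier (outer_specht m).
    (\<Sum>h\<in>(\<Pi>\<^sub>E i\<in>{1..n}. Sym (k i)). pscale (a h) (act (outer_specht m) h v)) = (if m = l then pscale (ip v b) w else 0)"
proof -
  obtain b' where b': "b = pure_tensor {1..n} b'" "b' \<in> (\<Pi>\<^sub>E i\<in>{1..n}. specht_basis (k i) (l i))"
    using b by (auto simp: outer_basis_def)
  obtain w' where w': "w = pure_tensor {1..n} w'" "w' \<in> (\<Pi>\<^sub>E i\<in>{1..n}. specht_basis (k i) (l i))"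
    using w by (auto simp: outer_basis_def)
  have "\<exists>a. \<forall>m\<in>partitions_of (k i). rank_one (k i) (l i) (b' i) (w' i) m a" if i: "i \<in> {1..n}" for i
  proof (rule rank_one_exists)
    show "l i \<in> partitions_of (k i)" using l i unfolding multipartitions_def by (rule PiE_mem)
    show "b' i \<in> specht_space (k i) (l i)" "w' i \<in> specht_space (k i) (l i)"
      using PiE_mem[OF b'(2) i] PiE_mem[OF w'(2) i] pm.span_base specht_basis(2) by blast+
  qed
  then obtain a where a: "\<And>i m. i \<in> {1..n} \<Longrightarrow> m \<in> partitions_of (k i) \<Longrightarrow> rank_one (k i) (l i) (b' i) (w' i) m (a i)"
    by metis
  let ?H = "\<Pi>\<^sub>E i\<in>{1..n}. Sym (k i)"
  show ?thesis
  proof (intro exI ballI)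
    fix m v assume m: "m \<in> multipartitions n k" and v: "v \<in> carrier (outer_specht m)"
    let ?L = "\<lambda>v. \<Sum>h\<in>?H. pscale (\<Prod>i\<in>{1..n}. a i (h i)) (act (outer_specht m) h v)"
    let ?R = "\<lambda>v. if m = l then pscale (ip v b) w else 0"
    have "lin ?L" by (intro lin_sum lin_pscale lin_outer_act)
    moreover have "lin ?R" by (rule linI) (simp_all add: ip_add_left ip_scale_left pm.scale_left_distrib)
    moreover have "v \<in> pm.span (outer_basis m)" using v by (simp only: outer_basis)
    moreover have "?L x = ?R x" if x: "x \<in> outer_basis m" for x
    proof -
      obtain x' where x': "x = pure_tensor {1..n} x'" "x' \<in> (\<Pi>\<^sub>E i\<in>{1..n}. specht_basis (k i) (m i))"
        using x by (auto simp: outer_basis_def)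
      have L: "?L x = pure_tensor {1..n} (\<lambda>i. if m i = l i then pscale (ip (x' i) (b' i)) (w' i) else 0)"
        unfolding x'(1) outer_alg_act_pure
      proof (rule pure_tensor_cong)
        fix i assume i: "i \<in> {1..n}"
        have "m i \<in> partitions_of (k i)" using m i unfolding multipartitions_def by (rule PiE_mem)
        moreover have "x' i \<in> specht_space (k i) (m i)"
          using PiE_mem[OF x'(2) i] pm.span_base specht_basis(2) by blast
        ultimately show "alg_act (k i) (m i) (a i) (x' i) = (if m i = l i then pscale (ip (x' i) (b' i)) (w' i) else 0)"
          using a[OF i] unfolding rank_one_def by blast
      qed
      show ?thesis
      proof (cases "m = l")
        case True
        then show ?thesis
          by (subst L) (simp add: x'(1) b'(1) w'(1) pure_tensor_scale ip_pure_tensor)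
      next
        case False
        then obtain i where "i \<in> {1..n}" "m i \<noteq> l i"
          using PiE_ext[of m "{1..n}" _ l] m l unfolding multipartitions_def by blast
        then show ?thesis using False
          by (subst L) (simp add: pure_tensor_zero[of "{1..n}" i])
      qed
    qed
    ultimately show "?L v = ?R v" by (rule pmm.linear_eq_on)
  qed
qed

text \<open>The factorials are sums of squares of tableau counts, each count bounds a dimension from
  below, and the product of the sums becomes a sum over multipartitions.\<close>

lemma card_outer_basis_squares:
  "card (\<Pi>\<^sub>E i\<in>{1..n}. Sym (k i)) \<le> (\<Sum>l\<in>multipartitions n k. (card (outer_basis l))\<^sup>2)"
proof -
  have "card (\<Pi>\<^sub>E i\<in>{1..n}. Sym (k i)) = (\<Prod>i\<in>{1..n}. fact (k i))"
    by (simp add: card_PiE sym_group_def card_permutations)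
  also have "\<dots> = (\<Prod>i\<in>{1..n}. \<Sum>l\<in>partitions_of (k i). (nstd (k i) (shape_of l))\<^sup>2)"
    by (simp add: sum_nstd_squared_partitions)
  also have "\<dots> \<le> (\<Prod>i\<in>{1..n}. \<Sum>l\<in>partitions_of (k i). (card (specht_basis (k i) l))\<^sup>2)"
    by (intro prod_mono conjI sum_mono power_mono nstd_le_card_basis specht_basis) auto
  also have "\<dots> = (\<Sum>l\<in>multipartitions n k. \<Prod>i\<in>{1..n}. (card (specht_basis (k i) (l i)))\<^sup>2)"
    unfolding multipartitions_def by (rule prod_sum_PiE) (simp_all add: finite_partitions_of)
  also have "\<dots> = (\<Sum>l\<in>multipartitions n k. (card (outer_basis l))\<^sup>2)"
    by (simp only: outer_basis prod_power_distrib)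
  finally show ?thesis .
qed

lemma finite_multipartitions: "finite (multipartitions n k)"
  unfolding multipartitions_def by (simp add: finite_PiE finite_partitions_of)

end

section \<open>Modules, direct sums and tensor products\<close>

lemma free_on_neg: "f \<in> free_on B \<Longrightarrow> - f \<in> free_on B"
  by (rule pm.subspace_neg[OF subspace_free_on])

lemma lin_eq_on_free:
  assumes "f \<in> free_on C" "lin L" "lin L'" "\<And>x. x \<in> C \<Longrightarrow> L (basis_vec x) = L' (basis_vec x)"
  shows "L f = L' f"
proof (rule pmm.linear_eq_on[OF assms(2,3)])
  show "f \<in> pm.span (basis_vec ` C)" using assms(1) by (simp only: free_on_eq_span)
  show "L b = L' b" if "b \<in> basis_vec ` C" for b using that by (rule imageE) (simp only: assms(4))
qed

section \<open>Complex vector spaces as module records, and direct sums\<close>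

lemma cring_complex: "cring complex_ring"
proof (rule cringI)
  show "abelian_group complex_ring"
    by (rule abelian_groupI) (auto simp: complex_ring_def algebra_simps intro: exI[of _ "- _"] left_minus)
  show "comm_monoid complex_ring"
    by (rule comm_monoidI) (auto simp: complex_ring_def)
qed (auto simp: complex_ring_def algebra_simps)

lemma complex_ring_simps [simp]:
  "carrier complex_ring = UNIV" "a \<otimes>\<^bsub>complex_ring\<^esub> b = a * b" "a \<oplus>\<^bsub>complex_ring\<^esub> b = a + b"
  "\<one>\<^bsub>complex_ring\<^esub> = 1" "\<zero>\<^bsub>complex_ring\<^esub> = 0"
  by (simp_all add: complex_ring_def)

lemma complex_moduleI:
  fixes M (structure)
  assumes zero: "\<zero> \<in> carrier M" and add: "\<And>x y. x \<in> carrier M \<Longrightarrow> y \<in> carrier M \<Longrightarrow> x \<oplus> y \<in> carrier M"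
    and assoc: "\<And>x y z. x \<in> carrier M \<Longrightarrow> y \<in> carrier M \<Longrightarrow> z \<in> carrier M \<Longrightarrow> x \<oplus> y \<oplus> z = x \<oplus> (y \<oplus> z)"
    and comm: "\<And>x y. x \<in> carrier M \<Longrightarrow> y \<in> carrier M \<Longrightarrow> x \<oplus> y = y \<oplus> x"
    and l_zero: "\<And>x. x \<in> carrier M \<Longrightarrow> \<zero> \<oplus> x = x"
    and neg: "\<And>x. x \<in> carrier M \<Longrightarrow> ((-1) \<odot> x) \<oplus> x = \<zero>"
    and smult: "\<And>c x. x \<in> carrier M \<Longrightarrow> c \<odot> x \<in> carrier M"
    and distr: "\<And>a b x. x \<in> carrier M \<Longrightarrow> (a + b) \<odot> x = (a \<odot> x) \<oplus> (b \<odot> x)"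
      "\<And>a x y. x \<in> carrier M \<Longrightarrow> y \<in> carrier M \<Longrightarrow> a \<odot> (x \<oplus> y) = (a \<odot> x) \<oplus> (a \<odot> y)"
    and mult: "\<And>a b x. x \<in> carrier M \<Longrightarrow> (a * b) \<odot> x = a \<odot> (b \<odot> x)" and one: "\<And>x. x \<in> carrier M \<Longrightarrow> 1 \<odot> x = x"
  shows "Module.module complex_ring M"
proof (rule moduleI[OF cring_complex])
  show "abelian_group M"
    by (rule abelian_groupI) (auto intro: zero add assoc comm l_zero neg smult)
qed (simp_all add: smult distr mult one)

lemma left_moduleD:
  assumes "left_module S M"
  shows "\<zero>\<^bsub>M\<^esub> \<in> carrier M" "\<And>x y. x \<in> carrier M \<Longrightarrow> y \<in> carrier M \<Longrightarrow> x \<oplus>\<^bsub>M\<^esub> y \<in> carrier M"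
    "\<And>x y z. x \<in> carrier M \<Longrightarrow> y \<in> carrier M \<Longrightarrow> z \<in> carrier M \<Longrightarrow> x \<oplus>\<^bsub>M\<^esub> y \<oplus>\<^bsub>M\<^esub> z = x \<oplus>\<^bsub>M\<^esub> (y \<oplus>\<^bsub>M\<^esub> z)"
    "\<And>x y. x \<in> carrier M \<Longrightarrow> y \<in> carrier M \<Longrightarrow> x \<oplus>\<^bsub>M\<^esub> y = y \<oplus>\<^bsub>M\<^esub> x"
    "\<And>x. x \<in> carrier M \<Longrightarrow> \<zero>\<^bsub>M\<^esub> \<oplus>\<^bsub>M\<^esub> x = x"
    "\<And>x. x \<in> carrier M \<Longrightarrow> ((-1) \<odot>\<^bsub>M\<^esub> x) \<oplus>\<^bsub>M\<^esub> x = \<zero>\<^bsub>M\<^esub>"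
    "\<And>c x. x \<in> carrier M \<Longrightarrow> c \<odot>\<^bsub>M\<^esub> x \<in> carrier M"
    "\<And>a b x. x \<in> carrier M \<Longrightarrow> (a + b) \<odot>\<^bsub>M\<^esub> x = (a \<odot>\<^bsub>M\<^esub> x) \<oplus>\<^bsub>M\<^esub> (b \<odot>\<^bsub>M\<^esub> x)"
    "\<And>a x y. x \<in> carrier M \<Longrightarrow> y \<in> carrier M \<Longrightarrow> a \<odot>\<^bsub>M\<^esub> (x \<oplus>\<^bsub>M\<^esub> y) = (a \<odot>\<^bsub>M\<^esub> x) \<oplus>\<^bsub>M\<^esub> (a \<odot>\<^bsub>M\<^esub> y)"
    "\<And>a b x. x \<in> carrier M \<Longrightarrow> (a * b) \<odot>\<^bsub>M\<^esub> x = a \<odot>\<^bsub>M\<^esub> (b \<odot>\<^bsub>M\<^esub> x)"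
    "\<And>x. x \<in> carrier M \<Longrightarrow> 1 \<odot>\<^bsub>M\<^esub> x = x"
    "\<And>c. c \<odot>\<^bsub>M\<^esub> \<zero>\<^bsub>M\<^esub> = \<zero>\<^bsub>M\<^esub>"
    "\<And>s. s \<in> carrier S \<Longrightarrow> act M s \<zero>\<^bsub>M\<^esub> = \<zero>\<^bsub>M\<^esub>"
    "\<And>s x. s \<in> carrier S \<Longrightarrow> x \<in> carrier M \<Longrightarrow> act M s x \<in> carrier M"
    "\<And>s x y. s \<in> carrier S \<Longrightarrow> x \<in> carrier M \<Longrightarrow> y \<in> carrier M \<Longrightarrow> act M s (x \<oplus>\<^bsub>M\<^esub> y) = act M s x \<oplus>\<^bsub>M\<^esub> act M s y"
    "\<And>s c x. s \<in> carrier S \<Longrightarrow> x \<in> carrier M \<Longrightarrow> act M s (c \<odot>\<^bsub>M\<^esub> x) = c \<odot>\<^bsub>M\<^esub> act M s x"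
    "\<And>s t x. s \<in> carrier S \<Longrightarrow> t \<in> carrier S \<Longrightarrow> x \<in> carrier M \<Longrightarrow> act M (s \<otimes>\<^bsub>S\<^esub> t) x = act M s (act M t x)"
    "\<And>x. x \<in> carrier M \<Longrightarrow> act M \<one>\<^bsub>S\<^esub> x = x"
proof -
  have m: "Module.module complex_ring M" using assms by (simp add: left_module_def)
  interpret Module.module complex_ring M by (rule m)
  show zero: "\<zero>\<^bsub>M\<^esub> \<in> carrier M" by simp
  show act_closed: "\<And>s x. s \<in> carrier S \<Longrightarrow> x \<in> carrier M \<Longrightarrow> act M s x \<in> carrier M"
    using assms by (simp add: left_module_def)
  show act_smult: "\<And>s c x. s \<in> carrier S \<Longrightarrow> x \<in> carrier M \<Longrightarrow> act M s (c \<odot>\<^bsub>M\<^esub> x) = c \<odot>\<^bsub>M\<^esub> act M s x"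
    using assms by (simp add: left_module_def)
  have null: "0 \<odot>\<^bsub>M\<^esub> x = \<zero>\<^bsub>M\<^esub>" if "x \<in> carrier M" for x
    using smult_l_null[OF that] by simp
  show "\<And>x y. x \<in> carrier M \<Longrightarrow> y \<in> carrier M \<Longrightarrow> x \<oplus>\<^bsub>M\<^esub> y \<in> carrier M" by simp
  show "\<And>x y z. x \<in> carrier M \<Longrightarrow> y \<in> carrier M \<Longrightarrow> z \<in> carrier M \<Longrightarrow> x \<oplus>\<^bsub>M\<^esub> y \<oplus>\<^bsub>M\<^esub> z = x \<oplus>\<^bsub>M\<^esub> (y \<oplus>\<^bsub>M\<^esub> z)"
    by (rule M.a_assoc)
  show "\<And>x y. x \<in> carrier M \<Longrightarrow> y \<in> carrier M \<Longrightarrow> x \<oplus>\<^bsub>M\<^esub> y = y \<oplus>\<^bsub>M\<^esub> x"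
    by (rule M.a_comm)
  show "\<And>x. x \<in> carrier M \<Longrightarrow> \<zero>\<^bsub>M\<^esub> \<oplus>\<^bsub>M\<^esub> x = x" by simp
  show closed: "\<And>c x. x \<in> carrier M \<Longrightarrow> c \<odot>\<^bsub>M\<^esub> x \<in> carrier M" using smult_closed by simp
  show distr: "\<And>a b x. x \<in> carrier M \<Longrightarrow> (a + b) \<odot>\<^bsub>M\<^esub> x = (a \<odot>\<^bsub>M\<^esub> x) \<oplus>\<^bsub>M\<^esub> (b \<odot>\<^bsub>M\<^esub> x)"
    using smult_l_distr by simp
  show "\<And>a x y. x \<in> carrier M \<Longrightarrow> y \<in> carrier M \<Longrightarrow> a \<odot>\<^bsub>M\<^esub> (x \<oplus>\<^bsub>M\<^esub> y) = (a \<odot>\<^bsub>M\<^esub> x) \<oplus>\<^bsub>M\<^esub> (a \<odot>\<^bsub>M\<^esub> y)"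
    using smult_r_distr by simp
  show "\<And>a b x. x \<in> carrier M \<Longrightarrow> (a * b) \<odot>\<^bsub>M\<^esub> x = a \<odot>\<^bsub>M\<^esub> (b \<odot>\<^bsub>M\<^esub> x)"
    using smult_assoc1 by simp
  show one: "\<And>x. x \<in> carrier M \<Longrightarrow> 1 \<odot>\<^bsub>M\<^esub> x = x" using smult_one by simp
  show "\<And>c. c \<odot>\<^bsub>M\<^esub> \<zero>\<^bsub>M\<^esub> = \<zero>\<^bsub>M\<^esub>" using smult_r_null by simp
  show "((-1) \<odot>\<^bsub>M\<^esub> x) \<oplus>\<^bsub>M\<^esub> x = \<zero>\<^bsub>M\<^esub>" if x: "x \<in> carrier M" for x
    using distr[OF x, of "-1" 1] null[OF x] one[OF x] by simp
  show "act M s \<zero>\<^bsub>M\<^esub> = \<zero>\<^bsub>M\<^esub>" if s: "s \<in> carrier S" for s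
    using act_smult[OF s zero, of 0] null[OF zero] null[OF act_closed[OF s zero]] by simp
qed (use assms in \<open>simp_all add: left_module_def\<close>)

lemma left_module_direct_sum:
  assumes "\<And>i. i \<in> I \<Longrightarrow> left_module S (M i)"
  shows "left_module S (direct_sum I M)"
proof -
  note D = left_moduleD[OF assms]
  let ?D = "direct_sum I M"
  let ?supp = "\<lambda>f. {i \<in> I. f i \<noteq> \<zero>\<^bsub>M i\<^esub>}"
  have carrier: "f \<in> carrier ?D \<longleftrightarrow> f \<in> extensional I \<and> (\<forall>i\<in>I. f i \<in> carrier (M i)) \<and> finite (?supp f)" for f
    by (auto simp: direct_sum_def PiE_def)
  have ops: "\<zero>\<^bsub>?D\<^esub> = (\<lambda>i\<in>I. \<zero>\<^bsub>M i\<^esub>)" "f \<oplus>\<^bsub>?D\<^esub> g = (\<lambda>i\<in>I. f i \<oplus>\<^bsub>M i\<^esub> g i)"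
    "c \<odot>\<^bsub>?D\<^esub> f = (\<lambda>i\<in>I. c \<odot>\<^bsub>M i\<^esub> f i)" "act ?D s f = (\<lambda>i\<in>I. act (M i) s (f i))" for f g c s
    by (simp_all add: direct_sum_def)
  have add: "f \<oplus>\<^bsub>?D\<^esub> g \<in> carrier ?D" if "f \<in> carrier ?D" "g \<in> carrier ?D" for f g
  proof -
    have "?supp (f \<oplus>\<^bsub>?D\<^esub> g) \<subseteq> ?supp f \<union> ?supp g" by (auto simp: ops D)
    then have "finite (?supp (f \<oplus>\<^bsub>?D\<^esub> g))" by (rule finite_subset) (use that in \<open>simp add: carrier\<close>)
    then show ?thesis using that by (simp add: carrier) (simp add: ops D)
  qed
  have smult: "c \<odot>\<^bsub>?D\<^esub> f \<in> carrier ?D" if "f \<in> carrier ?D" for c f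
  proof -
    have "?supp (c \<odot>\<^bsub>?D\<^esub> f) \<subseteq> ?supp f" by (auto simp: ops D)
    then have "finite (?supp (c \<odot>\<^bsub>?D\<^esub> f))" by (rule finite_subset) (use that in \<open>simp add: carrier\<close>)
    then show ?thesis using that by (simp add: carrier) (simp add: ops D)
  qed
  have act: "act ?D s f \<in> carrier ?D" if "s \<in> carrier S" "f \<in> carrier ?D" for s f
  proof -
    have "?supp (act ?D s f) \<subseteq> ?supp f" using that(1) by (auto simp: ops D)
    then have "finite (?supp (act ?D s f))" by (rule finite_subset) (use that in \<open>simp add: carrier\<close>)
    then show ?thesis using that by (simp add: carrier) (simp add: ops D)
  qed
  have mem: "f i \<in> carrier (M i)" if "f \<in> carrier ?D" "i \<in> I" for f i using that by (simp add: carrier)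
  have ext: "f \<in> extensional I" if "f \<in> carrier ?D" for f using that by (simp add: carrier)
  note eqI = extensionalityI[of _ I]
  have "Module.module complex_ring ?D"
  proof (rule complex_moduleI)
    have "?supp (\<lambda>i\<in>I. \<zero>\<^bsub>M i\<^esub>) = {}" by auto
    then have "finite (?supp (\<lambda>i\<in>I. \<zero>\<^bsub>M i\<^esub>))" by (simp only: finite.emptyI)
    then show "\<zero>\<^bsub>?D\<^esub> \<in> carrier ?D" unfolding carrier ops by (simp add: D)
  next
    fix x assume x: "x \<in> carrier ?D"
    show "\<zero>\<^bsub>?D\<^esub> \<oplus>\<^bsub>?D\<^esub> x = x"
      by (rule eqI) (simp_all add: ops D(5) mem[OF x] ext[OF x])
    show "1 \<odot>\<^bsub>?D\<^esub> x = x"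
      by (rule eqI) (simp_all add: ops D(11) mem[OF x] ext[OF x])
    show "((-1) \<odot>\<^bsub>?D\<^esub> x) \<oplus>\<^bsub>?D\<^esub> x = \<zero>\<^bsub>?D\<^esub>"
      by (rule eqI) (simp_all add: ops D(6) mem[OF x])
    show "(a + b) \<odot>\<^bsub>?D\<^esub> x = (a \<odot>\<^bsub>?D\<^esub> x) \<oplus>\<^bsub>?D\<^esub> (b \<odot>\<^bsub>?D\<^esub> x)" for a b
      by (rule eqI) (simp_all add: ops D(8) mem[OF x])
    show "(a * b) \<odot>\<^bsub>?D\<^esub> x = a \<odot>\<^bsub>?D\<^esub> (b \<odot>\<^bsub>?D\<^esub> x)" for a b
      by (rule eqI) (simp_all add: ops D(10) mem[OF x])
    fix y assume y: "y \<in> carrier ?D"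
    show "x \<oplus>\<^bsub>?D\<^esub> y = y \<oplus>\<^bsub>?D\<^esub> x"
      by (rule eqI) (simp_all add: ops D(4)[OF _ mem[OF x] mem[OF y]])
    show "a \<odot>\<^bsub>?D\<^esub> (x \<oplus>\<^bsub>?D\<^esub> y) = (a \<odot>\<^bsub>?D\<^esub> x) \<oplus>\<^bsub>?D\<^esub> (a \<odot>\<^bsub>?D\<^esub> y)" for a
      by (rule eqI) (simp_all add: ops D(9) mem[OF x] mem[OF y])
    fix z assume z: "z \<in> carrier ?D"
    show "x \<oplus>\<^bsub>?D\<^esub> y \<oplus>\<^bsub>?D\<^esub> z = x \<oplus>\<^bsub>?D\<^esub> (y \<oplus>\<^bsub>?D\<^esub> z)"
      by (rule eqI) (simp_all add: ops D(3) mem[OF x] mem[OF y] mem[OF z])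
  qed (rule add smult; assumption)+
  moreover have "act ?D \<one>\<^bsub>S\<^esub> x = x" if x: "x \<in> carrier ?D" for x
    by (rule eqI) (simp_all add: ops D(18) mem[OF x] ext[OF x])
  moreover have "act ?D s (x \<oplus>\<^bsub>?D\<^esub> y) = act ?D s x \<oplus>\<^bsub>?D\<^esub> act ?D s y"
    if "s \<in> carrier S" "x \<in> carrier ?D" "y \<in> carrier ?D" for s x y
    by (rule eqI) (simp_all add: ops D(15) that mem)
  moreover have "act ?D s (c \<odot>\<^bsub>?D\<^esub> x) = c \<odot>\<^bsub>?D\<^esub> act ?D s x" if "s \<in> carrier S" "x \<in> carrier ?D" for s c x
    by (rule eqI) (simp_all add: ops D(16) that mem)
  moreover have "act ?D (s \<otimes>\<^bsub>S\<^esub> t) x = act ?D s (act ?D t x)"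
    if "s \<in> carrier S" "t \<in> carrier S" "x \<in> carrier ?D" for s t x
    by (rule eqI) (simp_all add: ops D(17) that mem)
  ultimately show ?thesis
    unfolding left_module_def using act by blast
qed

lemma left_module_copies: "left_module S M \<Longrightarrow> left_module S (copies d M)"
  unfolding copies_def by (rule left_module_direct_sum)

text \<open>The compatibility \<open>act_ract\<close> of the two actions is what lets the left
  action descend to the tensor product.\<close>

locale tensor_setup =
  fixes S :: "('s, 'z) monoid_scheme" and G :: "('g, 'y) monoid_scheme"
    and M :: "('s, 'g, 'v, 'b) cbimodule_scheme" and X :: "('g, 'w, 'c) cmodule_scheme"
  assumes M: "left_module S M"
    and ract_closed: "\<And>x g. x \<in> carrier M \<Longrightarrow> g \<in> carrier G \<Longrightarrow> ract M x g \<in> carrier M"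
    and act_ract: "\<And>s x g. s \<in> carrier S \<Longrightarrow> x \<in> carrier M \<Longrightarrow> g \<in> carrier G \<Longrightarrow>
      act M s (ract M x g) = ract M (act M s x) g"
    and X_add: "\<And>x y. x \<in> carrier X \<Longrightarrow> y \<in> carrier X \<Longrightarrow> x \<oplus>\<^bsub>X\<^esub> y \<in> carrier X"
    and X_smult: "\<And>c x. x \<in> carrier X \<Longrightarrow> c \<odot>\<^bsub>X\<^esub> x \<in> carrier X"
    and X_act: "\<And>g x. g \<in> carrier G \<Longrightarrow> x \<in> carrier X \<Longrightarrow> act X g x \<in> carrier X"
begin

abbreviation "W \<equiv> free_on (carrier M \<times> carrier X)"
abbreviation "R \<equiv> pm.span (tensor_rels G M X)"
abbreviation "T \<equiv> tensor_over G M X"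
definition "tcl f = tensor_cong G M X `` {f}"
abbreviation "tact s \<equiv> lin_ext (\<lambda>(x, y). basis_vec (act M s x, y))"

lemmas MD = left_moduleD[OF M]

lemma tcl_mem: "f \<in> W \<Longrightarrow> h \<in> tcl f \<longleftrightarrow> h \<in> W \<and> f - h \<in> R"
  by (auto simp: tcl_def tensor_cong_def)

lemma tcl_eq: assumes "f \<in> W" "h \<in> W" shows "tcl f = tcl h \<longleftrightarrow> f - h \<in> R"
proof
  assume eq: "tcl f = tcl h"
  have "h \<in> tcl h" using assms by (simp add: tcl_mem pm.span_zero)
  then have "h \<in> tcl f" by (simp only: eq)
  then show "f - h \<in> R" using assms by (simp add: tcl_mem)
next
  assume fh: "f - h \<in> R"
  have "f - k \<in> R \<longleftrightarrow> h - k \<in> R" for k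
  proof
    assume "f - k \<in> R"
    from pm.span_diff[OF this fh] show "h - k \<in> R" by simp
  next
    assume "h - k \<in> R"
    from pm.span_add[OF fh this] show "f - k \<in> R" by simp
  qed
  then show "tcl f = tcl h" using assms by (auto simp: tcl_mem)
qed

lemma T_carrier: "carrier T = tcl ` W"
  by (auto simp: tensor_over_def quotient_def tcl_def Let_def)

text \<open>The operations on classes are unions over representatives. Such a union is a single
  class as soon as all members agree, which reduces each operation to independence of
  representatives.\<close>

lemma UN_const: "C \<noteq> {} \<Longrightarrow> (\<And>f. f \<in> C \<Longrightarrow> F f = Z) \<Longrightarrow> (\<Union>f\<in>C. F f) = Z"
  by auto

lemma tcl_ne: "f \<in> W \<Longrightarrow> tcl f \<noteq> {}"
  using tcl_mem[of f f] by (auto simp: pm.span_zero)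

lemma T_zero: "\<zero>\<^bsub>T\<^esub> = tcl 0"
  by (simp add: tensor_over_def tcl_def Let_def)

lemma T_add: assumes f: "f \<in> W" and h: "h \<in> W" shows "tcl f \<oplus>\<^bsub>T\<^esub> tcl h = tcl (f + h)"
proof -
  have "tcl f \<oplus>\<^bsub>T\<^esub> tcl h = (\<Union>f'\<in>tcl f. \<Union>h'\<in>tcl h. tcl (f' + h'))"
    by (simp add: tensor_over_def tcl_def Let_def)
  also have "\<dots> = tcl (f + h)"
  proof (intro UN_const tcl_ne f h)
    fix f' h' assume f': "f' \<in> tcl f" and h': "h' \<in> tcl h"
    then have r: "f - f' \<in> R" "h - h' \<in> R" "f' \<in> W" "h' \<in> W" using f h by (auto simp: tcl_mem)
    have "- (f - f') - (h - h') \<in> R" by (rule pm.span_diff[OF pm.span_neg[OF r(1)] r(2)])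
    then have "f' + h' - (f + h) \<in> R" by (simp add: algebra_simps)
    then show "tcl (f' + h') = tcl (f + h)"
      using f h r by (subst tcl_eq) (auto intro: free_on_add)
  qed
  finally show ?thesis .
qed

lemma T_smult: assumes f: "f \<in> W" shows "c \<odot>\<^bsub>T\<^esub> tcl f = tcl (pscale c f)"
proof -
  have "c \<odot>\<^bsub>T\<^esub> tcl f = (\<Union>f'\<in>tcl f. tcl (pscale c f'))"
    by (simp add: tensor_over_def tcl_def Let_def)
  also have "\<dots> = tcl (pscale c f)"
  proof (intro UN_const tcl_ne f)
    fix f' assume f': "f' \<in> tcl f"
    then have f'R: "f - f' \<in> R" "f' \<in> W" using f by (auto simp: tcl_mem)
    from pm.span_scale[OF this(1), of "- c"] have "pscale c f' - pscale c f \<in> R"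
      by (simp add: pm.scale_right_diff_distrib)
    then show "tcl (pscale c f') = tcl (pscale c f)"
      using f f'R by (subst tcl_eq) (auto intro: free_on_scale)
  qed
  finally show ?thesis .
qed

lemma tact_W: "s \<in> carrier S \<Longrightarrow> f \<in> W \<Longrightarrow> tact s f \<in> W"
  by (erule lin_ext_free_on) (auto simp: MD)

text \<open>Each of the five kinds of generating relations is mapped to a relation of the same
  kind.\<close>

lemma tact_R: assumes s: "s \<in> carrier S" and f: "f \<in> R" shows "tact s f \<in> R"
proof -
  have "tact s ` R = pm.span (tact s ` tensor_rels G M X)"
    by (rule pmm.linear_span_image[OF lin_lin_ext, symmetric])
  also have "\<dots> \<subseteq> R"
  proof (rule pm.span_mono, safe)
    fix r assume "r \<in> tensor_rels G M X"
    then consider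
      (a) x x' y where "r = basis_vec (x \<oplus>\<^bsub>M\<^esub> x', y) - basis_vec (x, y) - basis_vec (x', y)" "x \<in> carrier M" "x' \<in> carrier M" "y \<in> carrier X"
      | (b) x y y' where "r = basis_vec (x, y \<oplus>\<^bsub>X\<^esub> y') - basis_vec (x, y) - basis_vec (x, y')" "x \<in> carrier M" "y \<in> carrier X" "y' \<in> carrier X"
      | (c) c x y where "r = basis_vec (c \<odot>\<^bsub>M\<^esub> x, y) - pscale c (basis_vec (x, y))" "x \<in> carrier M" "y \<in> carrier X"
      | (d) c x y where "r = basis_vec (x, c \<odot>\<^bsub>X\<^esub> y) - pscale c (basis_vec (x, y))" "x \<in> carrier M" "y \<in> carrier X"
      | (e) x g y where "r = basis_vec (ract M x g, y) - basis_vec (x, act X g y)" "x \<in> carrier M" "g \<in> carrier G" "y \<in> carrier X"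
      unfolding tensor_rels_def by blast
    then show "tact s r \<in> tensor_rels G M X"
    proof cases
      case a
      then have "tact s r = basis_vec (act M s x \<oplus>\<^bsub>M\<^esub> act M s x', y) - basis_vec (act M s x, y) - basis_vec (act M s x', y)"
        using s by (simp add: lin_ext_diff MD)
      then show ?thesis using a MD(14)[OF s] unfolding tensor_rels_def by blast
    next
      case b
      then have "tact s r = basis_vec (act M s x, y \<oplus>\<^bsub>X\<^esub> y') - basis_vec (act M s x, y) - basis_vec (act M s x, y')"
        by (simp add: lin_ext_diff)
      then show ?thesis using b MD(14)[OF s] unfolding tensor_rels_def by blast
    next
      case c
      then have "tact s r = basis_vec (c \<odot>\<^bsub>M\<^esub> act M s x, y) - pscale c (basis_vec (act M s x, y))"
        using s by (simp add: lin_ext_diff lin_ext_scale MD)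
      then show ?thesis using c MD(14)[OF s] unfolding tensor_rels_def by blast
    next
      case d
      then have "tact s r = basis_vec (act M s x, c \<odot>\<^bsub>X\<^esub> y) - pscale c (basis_vec (act M s x, y))"
        by (simp add: lin_ext_diff lin_ext_scale)
      then show ?thesis using d MD(14)[OF s] unfolding tensor_rels_def by blast
    next
      case e
      then have "tact s r = basis_vec (ract M (act M s x) g, y) - basis_vec (act M s x, act X g y)"
        using s by (simp add: lin_ext_diff act_ract)
      then show ?thesis using e MD(14)[OF s] unfolding tensor_rels_def by blast
    qed
  qed
  finally show ?thesis using f by blast
qed

lemma T_act: assumes s: "s \<in> carrier S" and f: "f \<in> W" shows "act T s (tcl f) = tcl (tact s f)"
proof -
  have "act T s (tcl f) = (\<Union>f'\<in>tcl f. tcl (tact s f'))"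
    by (simp add: tensor_over_def tcl_def Let_def)
  also have "\<dots> = tcl (tact s f)"
  proof (intro UN_const tcl_ne f)
    fix f' assume f': "f' \<in> tcl f"
    then have f'R: "f - f' \<in> R" "f' \<in> W" using f by (auto simp: tcl_mem)
    then have "tact s f - tact s f' \<in> R" using tact_R[OF s] by (simp only: lin_ext_diff[symmetric])
    from pm.span_neg[OF this] have "tact s f' - tact s f \<in> R" by simp
    then show "tcl (tact s f') = tcl (tact s f)"
      using f f'R s by (subst tcl_eq) (auto intro: tact_W)
  qed
  finally show ?thesis .
qed

lemma left_module_tensor: assumes S: "Group.monoid S" shows "left_module S T"
proof -
  interpret S: Group.monoid S by (rule S)
  have "Module.module complex_ring T"
    by (rule complex_moduleI)
       (auto simp: T_carrier T_add T_smult T_zero free_on_0 free_on_add free_on_neg free_on_scale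
         pm.scale_left_distrib pm.scale_right_distrib ac_simps)
  moreover have mult: "tact (s \<otimes>\<^bsub>S\<^esub> t) f = tact s (tact t f)" if s: "s \<in> carrier S" "t \<in> carrier S" and f: "f \<in> W" for s t f
    by (rule lin_eq_on_free[OF f lin_lin_ext lin_comp[OF lin_lin_ext lin_lin_ext]]) (use s in \<open>auto simp: MD\<close>)
  moreover have one: "tact \<one>\<^bsub>S\<^esub> f = f" if f: "f \<in> W" for f
    using lin_eq_on_free[OF f lin_lin_ext pm.linear_id] by (auto simp: MD)
  ultimately show ?thesis
    unfolding left_module_def T_carrier
    by (auto simp: T_act T_add T_smult tact_W free_on_add free_on_scale lin_ext_add lin_ext_scale)
qed

end

section \<open>The left module of cosets of a Young subgroup\<close>

lemma mem_set_mult_sym: "c \<in> A <#>\<^bsub>sym_group n\<^esub> B \<longleftrightarrow> (\<exists>a\<in>A. \<exists>b\<in>B. c = a \<circ> b)"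
  by (auto simp: set_mult_def sym_group_mult)

definition subsets :: "nat \<Rightarrow> (nat \<Rightarrow> nat) set set"
  where "subsets n = {A. A \<noteq> {} \<and> A \<subseteq> Sym n}"

lemma subsets_mult: "A \<in> subsets n \<Longrightarrow> B \<in> subsets n \<Longrightarrow> A <#>\<^bsub>sym_group n\<^esub> B \<in> subsets n"
  by (fastforce simp: subsets_def set_mult_def sym_group_mult sym_comp)

lemma fp_rel_iff: "(A, B) \<in> fp_rel n \<longleftrightarrow> A \<in> subsets n \<and> B \<in> subsets n \<and> (\<forall>m\<in>{1..n}. (\<lambda>a. a m) ` A = (\<lambda>b. b m) ` B)"
  by (auto simp: fp_rel_def subsets_def Setcompr_eq_image)

lemma equiv_fp_rel: "equiv (subsets n) (fp_rel n)"
  by (rule equivI) (auto simp: refl_on_def sym_def trans_def fp_rel_iff)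

lemma fp_class_eq_iff: "A \<in> subsets n \<Longrightarrow> B \<in> subsets n \<Longrightarrow> fp_class n A = fp_class n B \<longleftrightarrow> (A, B) \<in> fp_rel n"
  unfolding fp_class_def by (rule eq_equiv_class_iff[OF equiv_fp_rel])

lemma fp_carrier: "carrier (fp_monoid n) = fp_class n ` subsets n"
  by (auto simp: fp_monoid_def subsets_def quotient_def fp_class_def)

text \<open>The image of \<open>m\<close> under \<open>AB\<close> is the union of the images
  \<open>A x\<close> for \<open>x \<in> B m\<close>, so it depends only on the images of points
  under the two sets.\<close>

lemma fp_rel_mult:
  assumes "(A, A') \<in> fp_rel n" "(B, B') \<in> fp_rel n"
  shows "(A <#>\<^bsub>sym_group n\<^esub> B, A' <#>\<^bsub>sym_group n\<^esub> B') \<in> fp_rel n"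
proof -
  have img: "(\<lambda>c. c m) ` (A <#>\<^bsub>sym_group n\<^esub> B) = (\<Union>x\<in>(\<lambda>b. b m) ` B. (\<lambda>a. a x) ` A)" for A B m
    by (simp add: set_mult_def sym_group_mult image_UN) blast
  have "(\<lambda>c. c m) ` (A <#>\<^bsub>sym_group n\<^esub> B) = (\<lambda>c. c m) ` (A' <#>\<^bsub>sym_group n\<^esub> B')" if m: "m \<in> {1..n}" for m
  proof -
    have eq: "(\<lambda>b. b m) ` B = (\<lambda>b. b m) ` B'" using assms(2) m by (simp add: fp_rel_iff)
    have "(\<lambda>a. a x) ` A = (\<lambda>a. a x) ` A'" if xB: "x \<in> (\<lambda>b. b m) ` B" for x
    proof -
      obtain b where b: "b \<in> B" "x = b m" using xB by blast
      then have "b \<in> Sym n" using assms(2) by (auto simp: fp_rel_iff subsets_def)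
      then have "x \<in> {1..n}" using m b sym_in by blast
      then show ?thesis using assms(1) by (simp add: fp_rel_iff)
    qed
    then show ?thesis unfolding img eq[symmetric] by blast
  qed
  then show ?thesis using assms by (auto simp: fp_rel_iff subsets_mult)
qed

lemma fp_mult:
  assumes "A \<in> subsets n" "B \<in> subsets n"
  shows "fp_class n A \<otimes>\<^bsub>fp_monoid n\<^esub> fp_class n B = fp_class n (A <#>\<^bsub>sym_group n\<^esub> B)"
proof -
  have const: "fp_class n (A' <#>\<^bsub>sym_group n\<^esub> B') = fp_class n (A <#>\<^bsub>sym_group n\<^esub> B)"
    if "A' \<in> fp_class n A" "B' \<in> fp_class n B" for A' B'
  proof -
    have "(A, A') \<in> fp_rel n" "(B, B') \<in> fp_rel n" using that by (auto simp: fp_class_def)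
    from fp_rel_mult[OF this] show ?thesis by (auto simp: fp_rel_iff fp_class_eq_iff)
  qed
  have ne: "fp_class n A \<noteq> {}" "fp_class n B \<noteq> {}" using assms by (auto simp: fp_class_def fp_rel_iff)
  have "(\<Union>A'\<in>fp_class n A. \<Union>B'\<in>fp_class n B. fp_class n (A' <#>\<^bsub>sym_group n\<^esub> B'))
      = (\<Union>A'\<in>fp_class n A. \<Union>B'\<in>fp_class n B. fp_class n (A <#>\<^bsub>sym_group n\<^esub> B))"
    by (intro SUP_cong refl const)
  also have "\<dots> = fp_class n (A <#>\<^bsub>sym_group n\<^esub> B)" using ne by (simp only: UN_constant if_False)
  finally show ?thesis by (simp add: fp_monoid_def)
qed

lemma set_mult_assoc_sym:
  "(A <#>\<^bsub>sym_group n\<^esub> B) <#>\<^bsub>sym_group n\<^esub> C = A <#>\<^bsub>sym_group n\<^esub> (B <#>\<^bsub>sym_group n\<^esub> C)"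
  by (auto simp: set_mult_def sym_group_mult o_assoc)

lemma set_mult_id: "{id} <#>\<^bsub>sym_group n\<^esub> A = A" "A <#>\<^bsub>sym_group n\<^esub> {id} = A"
  by (auto simp: set_mult_def sym_group_mult)

lemma id_subsets: "{id} \<in> subsets n"
  by (simp add: subsets_def sym_iff permutes_id)

lemma monoid_fp_monoid: "monoid (fp_monoid n)"
proof (rule monoidI)
  have one: "\<one>\<^bsub>fp_monoid n\<^esub> = fp_class n {id}" by (simp add: fp_monoid_def sym_group_one)
  show "\<one>\<^bsub>fp_monoid n\<^esub> \<in> carrier (fp_monoid n)" by (simp add: one fp_carrier id_subsets)
  fix x y z assume "x \<in> carrier (fp_monoid n)"
  then obtain A where A: "A \<in> subsets n" "x = fp_class n A" by (auto simp: fp_carrier)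
  show "\<one>\<^bsub>fp_monoid n\<^esub> \<otimes>\<^bsub>fp_monoid n\<^esub> x = x" "x \<otimes>\<^bsub>fp_monoid n\<^esub> \<one>\<^bsub>fp_monoid n\<^esub> = x"
    by (simp_all add: one A fp_mult id_subsets set_mult_id)
  assume "y \<in> carrier (fp_monoid n)"
  then obtain B where B: "B \<in> subsets n" "y = fp_class n B" by (auto simp: fp_carrier)
  show "x \<otimes>\<^bsub>fp_monoid n\<^esub> y \<in> carrier (fp_monoid n)"
    by (simp add: A B fp_mult fp_carrier subsets_mult)
  assume "z \<in> carrier (fp_monoid n)"
  then obtain C where C: "C \<in> subsets n" "z = fp_class n C" by (auto simp: fp_carrier)
  show "x \<otimes>\<^bsub>fp_monoid n\<^esub> y \<otimes>\<^bsub>fp_monoid n\<^esub> z = x \<otimes>\<^bsub>fp_monoid n\<^esub> (y \<otimes>\<^bsub>fp_monoid n\<^esub> z)"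
    by (simp add: A B C fp_mult subsets_mult set_mult_assoc_sym)
qed

section \<open>Cosets of the Young subgroup and the L-class\<close>

locale young_setup =
  fixes n :: nat and \<rho> :: "(nat \<times> nat) set"
  assumes equiv: "equiv {1..n} \<rho>"
begin

abbreviation "Y \<equiv> young n \<rho>"
abbreviation "Cos \<equiv> lcosets\<^bsub>sym_group n\<^esub> Y"
abbreviation "FP \<equiv> fp_monoid n"
abbreviation "Q \<equiv> young_quotient n \<rho>"
abbreviation "Nz \<equiv> normalizer (sym_group n) Y"
abbreviation fp_prod (infixl \<open>\<cdot>\<close> 70) where "x \<cdot> y \<equiv> x \<otimes>\<^bsub>FP\<^esub> y"
abbreviation prodset (infixl \<open>**\<close> 70) where "A ** B \<equiv> A <#>\<^bsub>sym_group n\<^esub> B"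
abbreviation "cl \<equiv> fp_class n"

sublocale fp: monoid FP by (rule monoid_fp_monoid)
sublocale sg: group "sym_group n" by (rule sym_group_is_group)

lemma rho_in: "(a, b) \<in> \<rho> \<Longrightarrow> a \<in> {1..n} \<and> b \<in> {1..n}"
  using equiv by (auto simp: equiv_def refl_on_def)

lemma rho_refl: "m \<in> {1..n} \<Longrightarrow> (m, m) \<in> \<rho>"
  using equiv by (auto simp: equiv_def refl_on_def)

lemma young_iff: "p \<in> Y \<longleftrightarrow> p \<in> Sym n \<and> (\<forall>m\<in>{1..n}. (m, p m) \<in> \<rho>)"
proof (intro iffI conjI ballI)
  assume p: "p \<in> Y"
  then show "p \<in> Sym n" by (simp add: young_def)
  fix m assume m: "m \<in> {1..n}"
  have "m \<in> \<rho> `` {m}" using rho_refl[OF m] by simp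
  moreover have "p ` (\<rho> `` {m}) = \<rho> `` {m}" using p m by (auto simp: young_def quotientI)
  ultimately show "(m, p m) \<in> \<rho>" by blast
next
  assume p: "p \<in> Sym n \<and> (\<forall>m\<in>{1..n}. (m, p m) \<in> \<rho>)"
  have "p ` B = B" if B: "B \<in> {1..n} // \<rho>" for B
  proof -
    have "finite B" using B equiv by (meson finite_atLeastAtMost finite_subset in_quotient_imp_subset)
    moreover have "p ` B \<subseteq> B"
    proof safe
      fix x assume x: "x \<in> B"
      then have "x \<in> {1..n}" using in_quotient_imp_subset[OF equiv B] by blast
      then show "p x \<in> B" using p in_quotient_imp_closed[OF equiv B x] by blast
    qed
    moreover have "inj_on p B" using p permutes_inj[of p "{1..n}"] by (auto simp: sym_iff inj_on_def)
    ultimately show ?thesis by (metis endo_inj_surj)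
  qed
  then show "p \<in> Y" using p by (simp add: young_def)
qed

text \<open>Any point of the block of \<open>m\<close> is reached by a transposition, which lies in
  the Young subgroup.\<close>

lemma young_orbit: assumes "m \<in> {1..n}" shows "(\<lambda>p. p m) ` Y = \<rho> `` {m}"
proof (intro equalityI subsetI)
  fix x assume x: "x \<in> \<rho> `` {m}"
  then have xm: "x \<in> {1..n}" "(m, x) \<in> \<rho>" "(x, m) \<in> \<rho>" using rho_in equiv by (auto simp: equiv_def sym_def)
  have "Transposition.transpose m x \<in> Y"
    using assms xm equiv by (auto simp: young_iff sym_iff permutes_swap_id Transposition.transpose_def equiv_def refl_on_def)
  then show "x \<in> (\<lambda>p. p m) ` Y" by (intro image_eqI[of _ _ "Transposition.transpose m x"]) auto
qed (use assms in \<open>auto simp: young_iff\<close>)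

lemma subgroup_young: "subgroup Y (sym_group n)"
proof (rule sg.subgroupI)
  show "Y \<subseteq> Sym n" by (auto simp: young_def)
  have "id \<in> Y" by (simp add: young_iff sym_iff permutes_id rho_refl)
  then show "Y \<noteq> {}" by blast
  fix p q assume p: "p \<in> Y"
  then have ps: "p \<in> Sym n" by (simp add: young_def)
  show "inv\<^bsub>sym_group n\<^esub> p \<in> Y"
  proof -
    have "(m, inv' p m) \<in> \<rho>" if "m \<in> {1..n}" for m
    proof -
      have "inv' p m \<in> {1..n}" using that sym_in[OF sym_inv[OF ps]] by blast
      then have "(inv' p m, p (inv' p m)) \<in> \<rho>" using p by (simp add: young_iff)
      then show ?thesis using equiv by (simp add: sym_inverses[OF ps]) (auto simp: equiv_def sym_def)
    qed
    then show ?thesis using ps by (simp add: young_iff sym_inv)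
  qed
  assume q: "q \<in> Y"
  have "(m, p (q m)) \<in> \<rho>" if m: "m \<in> {1..n}" for m
  proof -
    have "(m, q m) \<in> \<rho>" using q m by (simp add: young_iff)
    moreover from this have "(q m, p (q m)) \<in> \<rho>" using p rho_in by (simp add: young_iff)
    ultimately show ?thesis using equiv by (auto simp: equiv_def dest: transD)
  qed
  then show "p \<otimes>\<^bsub>sym_group n\<^esub> q \<in> Y"
    using ps q by (simp add: young_iff sym_group_mult sym_comp)
qed

lemma young_id: "id \<in> Y"
  using subgroup.one_closed[OF subgroup_young] by (simp add: sym_group_one)

lemma young_mult: "Y ** Y = Y"
  using sg.subgroup_mult_id[OF subgroup_young] .

lemma young_sym: "p \<in> Y \<Longrightarrow> p \<in> Sym n"
  by (simp add: young_def)

lemma young_subsets: "Y \<in> subsets n"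
  using young_id young_sym by (auto simp: subsets_def)

lemma Cos_iff: "x \<in> Cos \<longleftrightarrow> (\<exists>t\<in>Sym n. x = {t} ** Y)"
  by (auto simp: LCOSETS_def l_coset_eq_set_mult)

lemma sing_subsets: "t \<in> Sym n \<Longrightarrow> {t} \<in> subsets n"
  by (simp add: subsets_def)

lemma Cos_subsets: "x \<in> Cos \<Longrightarrow> x \<in> subsets n"
  by (auto simp: Cos_iff intro!: subsets_mult sing_subsets young_subsets)

lemma Cos_young: "x \<in> Cos \<Longrightarrow> x ** Y = x"
  by (auto simp: Cos_iff set_mult_assoc_sym young_mult)

lemma finite_Cos: "finite Cos"
  by (simp add: LCOSETS_def finite_sym)

lemma in_translate: assumes "t \<in> Sym n" "inv' t \<circ> a \<in> Y" shows "a \<in> {t} ** Y"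
proof -
  have "a = t \<circ> (inv' t \<circ> a)" by (simp add: o_assoc sym_inverses[OF assms(1)])
  then show ?thesis using assms(2) unfolding mem_set_mult_sym by blast
qed

lemma Cos_mem_eq: assumes "s \<in> Sym n" "t \<in> Sym n" "s \<in> {t} ** Y" shows "{s} ** Y = {t} ** Y"
  using sg.l_repr_independence[OF _ assms(2) subgroup_young, of s] assms(3)
  by (simp add: l_coset_eq_set_mult)

text \<open>The coset of \<open>u\<close> sends \<open>m\<close> onto the image under
  \<open>u\<close> of the block of \<open>m\<close>. If two cosets have these images in common, then
  \<open>inv' t \<circ> s\<close> preserves every block.\<close>

lemma cl_inj: "inj_on cl Cos"
proof (rule inj_onI)
  fix x y assume x: "x \<in> Cos" and y: "y \<in> Cos" and eq: "cl x = cl y"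
  obtain s where s: "s \<in> Sym n" "x = {s} ** Y" using x by (auto simp: Cos_iff)
  obtain t where t: "t \<in> Sym n" "y = {t} ** Y" using y by (auto simp: Cos_iff)
  have rel: "(x, y) \<in> fp_rel n" using eq fp_class_eq_iff[OF Cos_subsets[OF x] Cos_subsets[OF y]] by simp
  have img: "(\<lambda>a. a m) ` ({u} ** Y) = u ` (\<rho> `` {m})" if "m \<in> {1..n}" for u m
    unfolding young_orbit[OF that, symmetric] by (auto simp: set_mult_def sym_group_mult image_iff)
  have "(m, (inv' t \<circ> s) m) \<in> \<rho>" if m: "m \<in> {1..n}" for m
  proof -
    have "s ` (\<rho> `` {m}) = t ` (\<rho> `` {m})"
    proof -
      have "(\<lambda>a. a m) ` x = (\<lambda>a. a m) ` y" using rel m by (simp add: fp_rel_iff)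
      then show ?thesis by (simp only: s t img[OF m])
    qed
    moreover have "m \<in> \<rho> `` {m}" using rho_refl[OF m] by simp
    ultimately obtain w where "w \<in> \<rho> `` {m}" "s m = t w" by blast
    then show ?thesis by (simp add: sym_inverses[OF t(1)])
  qed
  then have "s \<in> {t} ** Y"
    using s t by (intro in_translate) (simp_all add: young_iff sym_comp sym_inv)
  then show "x = y" using Cos_mem_eq s t by blast
qed

text \<open>A coset class differs from that of \<open>Y\<close> by an invertible left factor, so
  both generate the same left ideal. Conversely, if \<open>z\<close> is the class of
  \<open>AY\<close> and left multiplication by the class of some \<open>T\<close> leads back to that
  of \<open>Y\<close>, then all products \<open>t \<circ> a\<close> preserve the blocks; fixing one
  \<open>t\<close> shows that every \<open>a \<in> A\<close> lies in the coset of its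
  inverse.\<close>

lemma L_class: "young_L_class n \<rho> = cl ` Cos"
proof (intro equalityI subsetI)
  fix z assume "z \<in> cl ` Cos"
  then obtain t where t: "t \<in> Sym n" "z = cl ({t} ** Y)" by (auto simp: Cos_iff)
  let ?e = "cl Y" and ?t = "cl {t}" and ?t' = "cl {inv' t}"
  have c: "?e \<in> carrier FP" "?t \<in> carrier FP" "?t' \<in> carrier FP" "z \<in> carrier FP"
    using t by (auto simp: fp_carrier young_subsets sing_subsets sym_inv subsets_mult)
  have z: "z = ?t \<cdot> ?e" using t by (simp add: fp_mult sing_subsets young_subsets)
  have e: "?e = ?t' \<cdot> z"
  proof -
    have "{inv' t} ** ({t} ** Y) = Y"
      unfolding set_mult_assoc_sym[symmetric]
      by (simp add: set_mult_def sym_group_mult sym_inverses[OF t(1)])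
    then show ?thesis using t by (simp add: fp_mult sing_subsets sym_inv young_subsets subsets_mult)
  qed
  have "(\<lambda>s. s \<cdot> z) ` carrier FP = (\<lambda>s. s \<cdot> ?e) ` carrier FP"
  proof (intro equalityI subsetI)
    fix y assume "y \<in> (\<lambda>s. s \<cdot> z) ` carrier FP"
    then obtain s where s: "s \<in> carrier FP" "y = s \<cdot> z" by blast
    then have "y = s \<cdot> ?t \<cdot> ?e" using c by (simp add: z fp.m_assoc)
    then show "y \<in> (\<lambda>s. s \<cdot> ?e) ` carrier FP" using s c by (intro image_eqI[of _ _ "s \<cdot> ?t"]) auto
  next
    fix y assume "y \<in> (\<lambda>s. s \<cdot> ?e) ` carrier FP"
    then obtain s where s: "s \<in> carrier FP" "y = s \<cdot> ?e" by blast
    have "y = s \<cdot> ?t' \<cdot> z" using s(1) c unfolding s(2) by (subst e) (simp add: fp.m_assoc)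
    then show "y \<in> (\<lambda>s. s \<cdot> z) ` carrier FP" using s c by (intro image_eqI[of _ _ "s \<cdot> ?t'"]) auto
  qed
  then show "z \<in> young_L_class n \<rho>" using c by (simp add: young_L_class_def green_L_class_def)
next
  fix z assume "z \<in> young_L_class n \<rho>"
  then have z: "z \<in> carrier FP" and eq: "(\<lambda>s. s \<cdot> z) ` carrier FP = (\<lambda>s. s \<cdot> cl Y) ` carrier FP"
    by (auto simp: young_L_class_def green_L_class_def)
  have e: "cl Y \<in> carrier FP" by (simp add: fp_carrier young_subsets)
  have "z \<in> (\<lambda>s. s \<cdot> z) ` carrier FP" using z by (intro image_eqI[of _ _ "\<one>\<^bsub>FP\<^esub>"]) auto
  then obtain s where s: "s \<in> carrier FP" "z = s \<cdot> cl Y" using eq by auto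
  then obtain A where A: "A \<in> subsets n" "s = cl A" by (auto simp: fp_carrier)
  have "cl Y \<in> (\<lambda>s. s \<cdot> cl Y) ` carrier FP" using e by (intro image_eqI[of _ _ "\<one>\<^bsub>FP\<^esub>"]) auto
  then have "cl Y \<in> (\<lambda>s. s \<cdot> z) ` carrier FP" by (simp only: eq)
  then obtain r where r: "r \<in> carrier FP" "cl Y = r \<cdot> z" by blast
  then obtain T where T: "T \<in> subsets n" "r = cl T" by (auto simp: fp_carrier)
  have "cl Y = cl (T ** (A ** Y))" using r(2) unfolding s(2) A(2) T(2) by (simp add: fp_mult A T young_subsets subsets_mult)
  then have rel: "(Y, T ** (A ** Y)) \<in> fp_rel n"
    using A T by (simp add: fp_class_eq_iff young_subsets subsets_mult)
  have ta: "t \<circ> a \<in> Y" if t: "t \<in> T" and a: "a \<in> A" for t a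
  proof -
    have ts: "t \<in> Sym n" "a \<in> Sym n" using t a A T by (auto simp: subsets_def)
    have "a \<circ> id \<in> A ** Y" using a young_id unfolding mem_set_mult_sym by blast
    then have "t \<circ> (a \<circ> id) \<in> T ** (A ** Y)" using t by (subst mem_set_mult_sym) blast
    then have im: "(t \<circ> a) m \<in> (\<lambda>p. p m) ` (T ** (A ** Y))" for m
      by (intro image_eqI[of _ _ "t \<circ> (a \<circ> id)"]) simp_all
    have "(t \<circ> a) m \<in> \<rho> `` {m}" if "m \<in> {1..n}" for m
    proof -
      have "(\<lambda>p. p m) ` (T ** (A ** Y)) = \<rho> `` {m}"
        using rel that young_orbit[OF that] by (simp add: fp_rel_iff)
      then show ?thesis using im[of m] by (simp only:)
    qed
    then show ?thesis using ts by (simp add: young_iff sym_comp)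
  qed
  obtain t where t: "t \<in> T" "t \<in> Sym n" using T by (auto simp: subsets_def)
  let ?u = "inv' t"
  have u: "?u \<in> Sym n" using t by (simp add: sym_inv)
  have Au: "{a} ** Y = {?u} ** Y" if a: "a \<in> A" for a
  proof (rule Cos_mem_eq[OF _ u])
    show "a \<in> Sym n" using a A by (auto simp: subsets_def)
    have "inv' ?u = t" using t(2) by (simp add: sym_iff permutes_inv_inv)
    then show "a \<in> {?u} ** Y" using ta[OF t(1) a] u by (intro in_translate) simp_all
  qed
  have "A ** Y = (\<Union>a\<in>A. {a} ** Y)" by (auto simp: set_mult_def)
  also have "\<dots> = {?u} ** Y" using Au A by (auto simp: subsets_def)
  finally have "z = cl ({?u} ** Y)" using s(2) A by (simp add: fp_mult young_subsets)
  moreover have "{?u} ** Y \<in> Cos" unfolding Cos_iff using u by blast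
  ultimately show "z \<in> cl ` Cos" by blast
qed

section \<open>The normalizer quotient and its right action on cosets\<close>

lemma normal_young: "Y \<lhd> (sym_group n)\<lparr>carrier := Nz\<rparr>"
  by (rule sg.subgroup_in_normalizer[OF subgroup_young])

lemma group_Q: "group Q"
  unfolding young_quotient_def by (rule normal.factorgroup_is_group[OF normal_young])

sublocale Q: group Q by (rule group_Q)

lemma Q_one: "\<one>\<^bsub>Q\<^esub> = Y"
  by (simp add: young_quotient_def FactGroup_def)

lemma Q_mult: "g \<otimes>\<^bsub>Q\<^esub> h = g ** h"
  by (simp add: young_quotient_def FactGroup_def)

text \<open>The stabilizer of \<open>Y\<close> under conjugation, rewritten as equality of the left
  and the right coset.\<close>

lemma Nz_iff: "s \<in> Nz \<longleftrightarrow> s \<in> Sym n \<and> {s} ** Y = Y ** {s}"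
proof -
  have Ys: "Y \<subseteq> Sym n" using young_sym by blast
  have "({s} ** Y ** {inv' s} = Y) \<longleftrightarrow> {s} ** Y = Y ** {s}" if s: "s \<in> Sym n"
  proof
    assume eq: "{s} ** Y ** {inv' s} = Y"
    have "Y ** {s} = {s} ** Y ** ({inv' s} ** {s})" by (subst eq[symmetric]) (simp only: set_mult_assoc_sym)
    also have "{inv' s} ** {s} = {id}" by (simp add: set_mult_def sym_group_mult sym_inverses[OF s])
    finally show "{s} ** Y = Y ** {s}" by (simp only: set_mult_id)
  next
    assume "{s} ** Y = Y ** {s}"
    then have "{s} ** Y ** {inv' s} = Y ** ({s} ** {inv' s})" by (simp only: set_mult_assoc_sym)
    also have "{s} ** {inv' s} = {id}" by (simp add: set_mult_def sym_group_mult sym_inverses[OF s])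
    finally show "{s} ** Y ** {inv' s} = Y" by (simp only: set_mult_id)
  qed
  then show ?thesis
    using Ys by (auto simp: normalizer_def stabilizer_def l_coset_eq_set_mult r_coset_eq_set_mult)
qed

lemma Q_carrier: "g \<in> carrier Q \<longleftrightarrow> (\<exists>s\<in>Nz. g = {s} ** Y)"
proof -
  have "g \<in> carrier Q \<longleftrightarrow> (\<exists>s\<in>Nz. g = Y ** {s})"
    by (auto simp: young_quotient_def FactGroup_def RCOSETS_def r_coset_eq_set_mult)
  also have "\<dots> \<longleftrightarrow> (\<exists>s\<in>Nz. g = {s} ** Y)" by (metis Nz_iff)
  finally show ?thesis .
qed

lemma Q_Cos: assumes "g \<in> carrier Q" shows "g \<in> Cos"
proof -
  obtain s where "s \<in> Nz" "g = {s} ** Y" using assms unfolding Q_carrier by (rule bexE)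
  then show ?thesis unfolding Cos_iff by (intro bexI[of _ s]) (simp_all add: Nz_iff)
qed

lemma Q_subsets: "g \<in> carrier Q \<Longrightarrow> g \<in> subsets n"
  by (rule Cos_subsets[OF Q_Cos])

lemma finite_Q: "finite (carrier Q)"
  by (rule finite_subset[OF _ finite_Cos]) (auto simp: Q_Cos)

lemma Cos_act: assumes x: "x \<in> Cos" and g: "g \<in> carrier Q" shows "x ** g \<in> Cos"
proof -
  obtain t where t: "t \<in> Sym n" "x = {t} ** Y" using x by (auto simp: Cos_iff)
  obtain s where s: "s \<in> Sym n" "{s} ** Y = Y ** {s}" "g = {s} ** Y" using g by (auto simp: Q_carrier Nz_iff)
  have "x ** g = {t} ** (Y ** {s}) ** Y" by (simp only: t s(3) set_mult_assoc_sym)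
  also have "\<dots> = ({t} ** {s}) ** (Y ** Y)" by (simp only: s(2)[symmetric] set_mult_assoc_sym)
  also have "{t} ** {s} = {t \<circ> s}" by (simp add: set_mult_def sym_group_mult)
  finally show ?thesis using t s by (auto simp: Cos_iff young_mult sym_comp)
qed

abbreviation "lft s \<equiv> coset_act n \<rho> s \<one>\<^bsub>Q\<^esub>"
abbreviation "rgt g \<equiv> coset_act n \<rho> \<one>\<^bsub>FP\<^esub> g"

definition rep :: "(nat \<Rightarrow> nat) set set \<Rightarrow> (nat \<Rightarrow> nat) set"
  where "rep z = inv_into Cos cl z"

lemma rep_cl: "x \<in> Cos \<Longrightarrow> rep (cl x) = x"
  unfolding rep_def using cl_inj by simp

lemma cl_carrier: "x \<in> Cos \<Longrightarrow> cl x \<in> carrier FP"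
  by (simp add: fp_carrier Cos_subsets)

lemma cl_Y: "cl Y \<in> carrier FP"
  by (simp add: fp_carrier young_subsets)

lemma lft_eq:
  assumes "s \<in> carrier FP" "x \<in> Cos"
  shows "lft s x = (if s \<cdot> cl x \<in> cl ` Cos then basis_vec (rep (s \<cdot> cl x)) else 0)"
proof -
  have "s \<cdot> cl x \<cdot> cl Y = s \<cdot> (cl x \<cdot> cl Y)"
    using assms(1) cl_carrier[OF assms(2)] cl_Y by (rule fp.m_assoc)
  \<comment> \<open>The identity of the quotient is \<open>Y\<close>, and a left coset absorbs it on
    the right.\<close>
  also have "cl x \<cdot> cl Y = cl x"
    using assms by (simp add: fp_mult Cos_subsets young_subsets Cos_young)
  finally show ?thesis by (simp add: coset_act_def L_class Q_one rep_def Let_def)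
qed

text \<open>The product of a coset with an element of the quotient is again a coset, so the cut-off
  never applies on the right.\<close>

lemma rgt_eq: assumes "x \<in> Cos" "g \<in> carrier Q" shows "rgt g x = basis_vec (x ** g)"
proof -
  have "\<one>\<^bsub>FP\<^esub> \<cdot> cl x \<cdot> cl g = cl (x ** g)"
    using assms by (simp add: cl_carrier fp_mult Cos_subsets Q_subsets)
  moreover have "inv_into Cos cl (cl (x ** g)) = x ** g"
    using rep_cl[OF Cos_act[OF assms]] by (simp add: rep_def)
  ultimately show ?thesis
    using Cos_act[OF assms] by (simp add: coset_act_def L_class Let_def)
qed

lemma lft_cases:
  assumes "s \<in> carrier FP" "x \<in> Cos"
  obtains y where "y \<in> Cos" "s \<cdot> cl x = cl y" "lft s x = basis_vec y"
  | "s \<cdot> cl x \<notin> cl ` Cos" "lft s x = 0"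
proof (cases "s \<cdot> cl x \<in> cl ` Cos")
  case True
  then obtain y where y: "y \<in> Cos" "s \<cdot> cl x = cl y" by blast
  moreover have "lft s x = basis_vec y" using True y by (simp add: lft_eq[OF assms] rep_cl)
  ultimately show ?thesis by (rule that(1))
next
  case False
  moreover have "lft s x = 0" using False by (simp add: lft_eq[OF assms])
  ultimately show ?thesis by (rule that(2))
qed

lemma cl_act: "x \<in> Cos \<Longrightarrow> g \<in> carrier Q \<Longrightarrow> cl (x ** g) = cl x \<cdot> cl g"
  by (simp add: fp_mult Cos_subsets Q_subsets)

text \<open>If \<open>s t x\<close> lies in the L-class, then so does \<open>t x\<close>, since \<open>S x = S s t x \<subseteq> S t x \<subseteq> S x\<close>.\<close>

lemma L_class_factor:
  assumes s: "s \<in> carrier FP" and t: "t \<in> carrier FP" and x: "x \<in> Cos" and st: "s \<cdot> (t \<cdot> cl x) \<in> cl ` Cos"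
  shows "t \<cdot> cl x \<in> cl ` Cos"
proof -
  have L: "(\<lambda>s. s \<cdot> z) ` carrier FP = (\<lambda>s. s \<cdot> cl Y) ` carrier FP" if "z \<in> cl ` Cos" for z
    using that unfolding L_class[symmetric] by (simp add: young_L_class_def green_L_class_def)
  let ?z = "t \<cdot> cl x"
  have xc: "cl x \<in> carrier FP" using x by (rule cl_carrier)
  have h1: "(\<lambda>s. s \<cdot> ?z) ` carrier FP \<subseteq> (\<lambda>s. s \<cdot> cl x) ` carrier FP"
    using t xc by (auto simp: fp.m_assoc[symmetric])
  have h2: "(\<lambda>r. r \<cdot> (s \<cdot> ?z)) ` carrier FP \<subseteq> (\<lambda>s. s \<cdot> ?z) ` carrier FP"
    using s t xc by (auto simp: fp.m_assoc[symmetric])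
  have h3: "(\<lambda>s. s \<cdot> cl x) ` carrier FP = (\<lambda>r. r \<cdot> (s \<cdot> ?z)) ` carrier FP"
    using L[OF st] L[of "cl x"] x by simp
  have "(\<lambda>s. s \<cdot> ?z) ` carrier FP = (\<lambda>s. s \<cdot> cl x) ` carrier FP"
    by (rule antisym[OF h1]) (subst h3, rule h2)
  also have "\<dots> = (\<lambda>s. s \<cdot> cl Y) ` carrier FP" by (rule L) (rule imageI[OF x])
  finally have "(\<lambda>s. s \<cdot> ?z) ` carrier FP = (\<lambda>s. s \<cdot> cl Y) ` carrier FP" .
  then show ?thesis
    unfolding L_class[symmetric] using t xc by (simp add: young_L_class_def green_L_class_def)
qed

section \<open>The bimodule of cosets\<close>

abbreviation "M \<equiv> coset_bimodule n \<rho>"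

lemma M_simps: "carrier M = free_on Cos" "\<zero>\<^bsub>M\<^esub> = 0" "add M = (+)" "smult M = pscale"
  "act M = (\<lambda>s. lin_ext (lft s))" "ract M = (\<lambda>x g. lin_ext (rgt g) x)"
  by (simp_all add: coset_bimodule_def)

lemma lft_free: "s \<in> carrier FP \<Longrightarrow> x \<in> Cos \<Longrightarrow> lft s x \<in> free_on Cos"
  by (erule (1) lft_cases) (auto simp: free_on_0)

lemma rgt_free: "x \<in> Cos \<Longrightarrow> g \<in> carrier Q \<Longrightarrow> rgt g x \<in> free_on Cos"
  by (simp add: rgt_eq Cos_act)

text \<open>The delicate case is a product that leaves the L-class at the first factor: by
  \<open>L_class_factor\<close> the full product is then outside as well, so both sides are
  0.\<close>

lemma lft_mult:
  assumes s: "s \<in> carrier FP" and t: "t \<in> carrier FP" and f: "f \<in> free_on Cos"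
  shows "lin_ext (lft (s \<cdot> t)) f = lin_ext (lft s) (lin_ext (lft t) f)"
proof (rule lin_eq_on_free[OF f lin_lin_ext lin_comp[OF lin_lin_ext lin_lin_ext]])
  fix x assume x: "x \<in> Cos"
  have st: "s \<cdot> t \<in> carrier FP" using s t by simp
  have assoc: "s \<cdot> t \<cdot> cl x = s \<cdot> (t \<cdot> cl x)"
    using s t x by (simp add: fp.m_assoc cl_carrier)
  show "lin_ext (lft (s \<cdot> t)) (basis_vec x) = lin_ext (lft s) (lin_ext (lft t) (basis_vec x))"
    unfolding lin_ext_basis_vec
  proof (rule lft_cases[OF t x])
    fix y assume y: "y \<in> Cos" "t \<cdot> cl x = cl y" "lft t x = basis_vec y"
    show "lft (s \<cdot> t) x = lin_ext (lft s) (lft t x)"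
      using lft_eq[OF st x] lft_eq[OF s y(1)] by (simp add: y assoc)
  next
    assume y: "t \<cdot> cl x \<notin> cl ` Cos" "lft t x = 0"
    then have "s \<cdot> t \<cdot> cl x \<notin> cl ` Cos"
      using L_class_factor[OF s t x] by (auto simp: assoc)
    then show "lft (s \<cdot> t) x = lin_ext (lft s) (lft t x)"
      using lft_eq[OF st x] by (simp add: y lin_ext_0)
  qed
qed

lemma lft_one: assumes f: "f \<in> free_on Cos" shows "lin_ext (lft \<one>\<^bsub>FP\<^esub>) f = f"
proof -
  have "lin_ext (lft \<one>\<^bsub>FP\<^esub>) f = id f"
  proof (rule lin_eq_on_free[OF f lin_lin_ext pm.linear_id])
    fix x assume "x \<in> Cos"
    then show "lin_ext (lft \<one>\<^bsub>FP\<^esub>) (basis_vec x) = id (basis_vec x)"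
      by (simp add: lft_eq cl_carrier rep_cl)
  qed
  then show ?thesis by simp
qed

text \<open>The element \<open>g\<close> is invertible in the quotient. So if \<open>s x g\<close>
  lies in the L-class, multiplying by the inverse of \<open>g\<close> shows that \<open>s x\<close>
  does too, and both sides vanish simultaneously.\<close>

lemma lft_rgt:
  assumes s: "s \<in> carrier FP" and g: "g \<in> carrier Q" and f: "f \<in> free_on Cos"
  shows "lin_ext (lft s) (lin_ext (rgt g) f) = lin_ext (rgt g) (lin_ext (lft s) f)"
proof (rule lin_eq_on_free[OF f lin_comp[OF lin_lin_ext lin_lin_ext] lin_comp[OF lin_lin_ext lin_lin_ext]])
  fix x assume x: "x \<in> Cos"
  note gc = cl_carrier[OF Q_Cos[OF g]]
  have assoc: "s \<cdot> cl (x ** g) = s \<cdot> cl x \<cdot> cl g"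
    using s x g gc by (simp add: cl_act fp.m_assoc cl_carrier)
  have lhs: "lin_ext (lft s) (lin_ext (rgt g) (basis_vec x)) = lft s (x ** g)"
    using x g by (simp add: rgt_eq)
  show "lin_ext (lft s) (lin_ext (rgt g) (basis_vec x)) = lin_ext (rgt g) (lin_ext (lft s) (basis_vec x))"
    unfolding lhs unfolding lin_ext_basis_vec
  proof (rule lft_cases[OF s x])
    fix y assume y: "y \<in> Cos" "s \<cdot> cl x = cl y" "lft s x = basis_vec y"
    have "s \<cdot> cl (x ** g) = cl (y ** g)" using y g by (simp add: assoc cl_act)
    then show "lft s (x ** g) = lin_ext (rgt g) (lft s x)"
      using lft_eq[OF s Cos_act[OF x g]] Cos_act[OF y(1) g] by (simp add: y rgt_eq g rep_cl)
  next
    assume y: "s \<cdot> cl x \<notin> cl ` Cos" "lft s x = 0"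
    have "s \<cdot> cl (x ** g) \<notin> cl ` Cos"
    proof (rule notI)
      assume "s \<cdot> cl (x ** g) \<in> cl ` Cos"
      then obtain z where z': "s \<cdot> cl (x ** g) = cl z" "z \<in> Cos" by (rule imageE)
      note z = z'(2,1)
      have ig: "inv\<^bsub>Q\<^esub> g \<in> carrier Q" using g by simp
      have "cl (z ** inv\<^bsub>Q\<^esub> g) = s \<cdot> (cl x \<cdot> (cl g \<cdot> cl (inv\<^bsub>Q\<^esub> g)))"
        using s x g ig gc cl_carrier[OF Q_Cos[OF ig]] z
        by (simp add: cl_act[OF z(1) ig] z(2)[symmetric] assoc fp.m_assoc cl_carrier)
      also have "cl g \<cdot> cl (inv\<^bsub>Q\<^esub> g) = cl Y"
        using g ig Q.r_inv[OF g] by (simp add: fp_mult Q_subsets Q_mult Q_one)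
      also have "cl x \<cdot> cl Y = cl x" using x by (simp add: fp_mult Cos_subsets young_subsets Cos_young)
      finally show False using y Cos_act[OF z(1) ig] by (metis imageI)
    qed
    then show "lft s (x ** g) = lin_ext (rgt g) (lft s x)"
      using lft_eq[OF s Cos_act[OF x g]] by (simp add: y lin_ext_0)
  qed
qed

text \<open>Right multiplication by \<open>g\<close> is injective on cosets, hence it merely
  relabels coefficients.\<close>

lemma rgt_lookup:
  assumes f: "f \<in> free_on Cos" and g: "g \<in> carrier Q" and x: "x \<in> Cos"
  shows "cf (lin_ext (rgt g) f) (x ** g) = cf f x"
proof -
  have cancel: "y = x" if y: "y \<in> Cos" and eq: "y ** g = x ** g" for y
  proof -
    have "y ** (g ** inv\<^bsub>Q\<^esub> g) = x ** (g ** inv\<^bsub>Q\<^esub> g)" using eq by (simp only: set_mult_assoc_sym[symmetric])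
    then show ?thesis using Q.r_inv[OF g] x y by (simp add: Q_mult Q_one Cos_young)
  qed
  have "f = (\<Sum>y\<in>Cos. pscale (cf f y) (basis_vec y))"
    using f by (intro pm_expand) (auto simp: free_on_def finite_Cos)
  then have "lin_ext (rgt g) f = lin_ext (rgt g) (\<Sum>y\<in>Cos. pscale (cf f y) (basis_vec y))" by simp
  also have "\<dots> = (\<Sum>y\<in>Cos. pscale (cf f y) (basis_vec (y ** g)))"
    unfolding lin_ext_sum lin_ext_scale lin_ext_basis_vec by (intro sum.cong) (simp_all add: rgt_eq g)
  finally have "cf (lin_ext (rgt g) f) (x ** g) = (\<Sum>y\<in>Cos. if y = x then cf f x else 0)"
    using cancel by (auto simp: cf_sum cf_basis_vec intro!: sum.cong)
  then show ?thesis using x by (simp add: finite_Cos)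
qed

end

section \<open>The action of the normalizer on the blocks\<close>

locale block_setup = young_setup +
  fixes e :: "nat \<Rightarrow> nat \<Rightarrow> nat set"
  assumes e: "\<And>i. i \<in> {1..n} \<Longrightarrow> bij_betw (e i) {1..block_count n \<rho> i} (blocks_of_size n \<rho> i)"
begin

abbreviation "k \<equiv> block_count n \<rho>"
abbreviation "blk \<equiv> {1..n} // \<rho>"
abbreviation "H \<equiv> \<Pi>\<^sub>E i\<in>{1..n}. Sym (k i)"

lemma blk_iff: "B \<in> blk \<longleftrightarrow> (\<exists>m\<in>{1..n}. B = \<rho> `` {m})"
  by (auto simp: quotient_def)

text \<open>Evaluate the two equal cosets \<open>sY\<close> and \<open>Ys\<close> at
  \<open>m\<close>.\<close>

lemma Nz_image: assumes s: "s \<in> Nz" and m: "m \<in> {1..n}" shows "s ` (\<rho> `` {m}) = \<rho> `` {s m}"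
proof -
  have ss: "s \<in> Sym n" and eq: "{s} ** Y = Y ** {s}" using s by (auto simp: Nz_iff)
  have sm: "s m \<in> {1..n}" using m sym_in[OF ss] by blast
  have "s ` (\<rho> `` {m}) = (\<lambda>p. p m) ` ({s} ** Y)"
    unfolding young_orbit[OF m, symmetric] by (auto simp: set_mult_def sym_group_mult image_iff)
  also have "\<dots> = (\<lambda>p. p (s m)) ` Y"
    unfolding eq by (auto simp: set_mult_def sym_group_mult image_iff)
  also have "\<dots> = \<rho> `` {s m}" by (rule young_orbit[OF sm])
  finally show ?thesis .
qed

text \<open>If \<open>s\<close> maps blocks to blocks, conjugating by \<open>s\<close> or by its
  inverse keeps block preserving permutations block preserving.\<close>

lemma NzI: assumes ss: "s \<in> Sym n" and im: "\<And>m. m \<in> {1..n} \<Longrightarrow> s ` (\<rho> `` {m}) = \<rho> `` {s m}" shows "s \<in> Nz"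
proof -
  let ?i = "inv' s"
  have isy: "?i \<in> Sym n" using ss by (rule sym_inv)
  have a: "s \<circ> y \<circ> ?i \<in> Y" if y: "y \<in> Y" for y
    unfolding young_iff
  proof (intro conjI ballI)
    show "s \<circ> y \<circ> ?i \<in> Sym n" using ss isy young_sym[OF y] by (intro sym_comp)
    fix x assume x: "x \<in> {1..n}"
    have ix: "?i x \<in> {1..n}" using x sym_in[OF isy] by blast
    then have "y (?i x) \<in> \<rho> `` {?i x}" using y by (simp add: young_iff)
    then have "s (y (?i x)) \<in> \<rho> `` {s (?i x)}" unfolding im[OF ix, symmetric] by (rule imageI)
    then show "(x, (s \<circ> y \<circ> ?i) x) \<in> \<rho>" by (simp add: sym_inverses[OF ss])
  qed
  have b: "?i \<circ> y \<circ> s \<in> Y" if y: "y \<in> Y" for y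
    unfolding young_iff
  proof (intro conjI ballI)
    show "?i \<circ> y \<circ> s \<in> Sym n" using ss isy young_sym[OF y] by (intro sym_comp)
    fix x assume x: "x \<in> {1..n}"
    have "s x \<in> {1..n}" using x sym_in[OF ss] by blast
    then have "y (s x) \<in> \<rho> `` {s x}" using y by (simp add: young_iff)
    then obtain w where "w \<in> \<rho> `` {x}" "y (s x) = s w" unfolding im[OF x, symmetric] by blast
    then show "(x, (?i \<circ> y \<circ> s) x) \<in> \<rho>" by (simp add: sym_inverses[OF ss])
  qed
  have "{s} ** Y = Y ** {s}"
  proof (intro equalityI subsetI)
    fix p assume "p \<in> {s} ** Y"
    then obtain y where y: "y \<in> Y" "p = s \<circ> y" by (auto simp: mem_set_mult_sym)
    then have "p = (s \<circ> y \<circ> ?i) \<circ> s" by (simp add: fun_eq_iff sym_inverses[OF ss])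
    then show "p \<in> Y ** {s}" using a[OF y(1)] unfolding mem_set_mult_sym by blast
  next
    fix p assume "p \<in> Y ** {s}"
    then obtain y where y: "y \<in> Y" "p = y \<circ> s" by (auto simp: mem_set_mult_sym)
    then have "p = s \<circ> (?i \<circ> y \<circ> s)" by (simp add: fun_eq_iff sym_inverses[OF ss])
    then show "p \<in> {s} ** Y" using b[OF y(1)] unfolding mem_set_mult_sym by blast
  qed
  then show ?thesis using ss by (simp add: Nz_iff)
qed

lemma Nz_blk: assumes s: "s \<in> Nz" and B: "B \<in> blk" shows "s ` B \<in> blk" "card (s ` B) = card B"
proof -
  obtain m where m: "m \<in> {1..n}" "B = \<rho> `` {m}" using B unfolding blk_iff by blast
  have ss: "s \<in> Sym n" using s by (simp add: Nz_iff)
  have "s m \<in> {1..n}" using m sym_in[OF ss] by blast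
  then show "s ` B \<in> blk" unfolding blk_iff m(2) Nz_image[OF s m(1)] by blast
  have "inj_on s B" using ss permutes_inj[of s "{1..n}"] by (auto simp: sym_iff inj_on_def)
  then show "card (s ` B) = card B" by (rule card_image)
qed

lemma e_mem: "i \<in> {1..n} \<Longrightarrow> j \<in> {1..k i} \<Longrightarrow> e i j \<in> blk \<and> card (e i j) = i"
  using e[of i] by (auto simp: bij_betw_def blocks_of_size_def)

lemma blk_finite: "B \<in> blk \<Longrightarrow> finite B"
  using in_quotient_imp_subset[OF equiv] by (meson finite_atLeastAtMost finite_subset)

lemma blk_card: assumes "B \<in> blk" shows "card B \<in> {1..n}"
proof -
  have "B \<subseteq> {1..n}" using in_quotient_imp_subset[OF equiv assms] .
  then have "card B \<le> n" using card_mono[of "{1..n}" B] by simp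
  moreover have "B \<noteq> {}" using in_quotient_imp_non_empty[OF equiv assms] .
  then have "0 < card B" using blk_finite[OF assms] by (simp add: card_gt_0_iff)
  ultimately show ?thesis by (simp add: atLeastAtMost_iff One_nat_def)
qed

lemma e_surj: assumes "B \<in> blk" obtains j where "j \<in> {1..k (card B)}" "e (card B) j = B"
proof -
  have "B \<in> blocks_of_size n \<rho> (card B)" using assms by (simp add: blocks_of_size_def)
  then have "B \<in> e (card B) ` {1..k (card B)}" using e[OF blk_card[OF assms]] by (simp add: bij_betw_def)
  then show ?thesis using that by blast
qed

lemma e_inj: "i \<in> {1..n} \<Longrightarrow> j \<in> {1..k i} \<Longrightarrow> j' \<in> {1..k i} \<Longrightarrow> e i j = e i j' \<Longrightarrow> j = j'"
  using e[of i] by (auto simp: bij_betw_def inj_on_def)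

abbreviation "\<phi> \<equiv> block_hom n \<rho> e"

lemma Y_blk: "y \<in> Y \<Longrightarrow> B \<in> blk \<Longrightarrow> y ` B = B"
  by (simp add: young_def)

lemma coset_image: assumes B: "B \<in> blk" shows "(\<Union>p\<in>{s} ** Y. p ` B) = s ` B"
proof -
  have "(\<Union>p\<in>{s} ** Y. p ` B) = (\<Union>y\<in>Y. s ` (y ` B))" by (auto simp: set_mult_def sym_group_mult)
  also have "\<dots> = (\<Union>y\<in>Y. s ` B)" using Y_blk[OF _ B] by (intro SUP_cong refl) simp
  also have "\<dots> = s ` B" using young_id by auto
  finally show ?thesis .
qed

text \<open>An element of the normalizer permutes the blocks of each size; the second equation
  determines \<open>\<phi>\<close> and is the form in which it is used throughout.\<close>

lemma \<phi>_eq: assumes s: "s \<in> Nz" and i: "i \<in> {1..n}" and j: "j \<in> {1..k i}"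
  shows "\<phi> ({s} ** Y) i j \<in> {1..k i}" "e i (\<phi> ({s} ** Y) i j) = s ` e i j"
proof -
  note eb = e_mem[OF i j]
  have eq: "\<phi> ({s} ** Y) i j = inv_into {1..k i} (e i) (s ` e i j)"
    using i j eb by (simp add: block_hom_def coset_image)
  have "s ` e i j \<in> e i ` {1..k i}"
    using e[OF i] Nz_blk[OF s, of "e i j"] eb by (simp add: bij_betw_def blocks_of_size_def)
  then show "\<phi> ({s} ** Y) i j \<in> {1..k i}" "e i (\<phi> ({s} ** Y) i j) = s ` e i j"
    unfolding eq by (rule inv_into_into, rule f_inv_into_f)
qed

lemma \<phi>_outside: "i \<in> {1..n} \<Longrightarrow> j \<notin> {1..k i} \<Longrightarrow> \<phi> g i j = j"
  by (simp add: block_hom_def)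

lemma \<phi>_H: assumes "g \<in> carrier Q" shows "\<phi> g \<in> H"
proof (rule PiE_I)
  obtain s where s: "s \<in> Nz" "g = {s} ** Y" using assms unfolding Q_carrier by blast
  fix i assume i: "i \<in> {1..n}"
  have "inj_on (\<phi> g i) {1..k i}"
  proof (rule inj_onI)
    fix j j' assume j: "j \<in> {1..k i}" "j' \<in> {1..k i}" "\<phi> g i j = \<phi> g i j'"
    then have "s ` e i j = s ` e i j'" using \<phi>_eq(2)[OF s(1) i] s(2) by metis
    moreover have "inj s" using s permutes_inj[of s "{1..n}"] by (simp add: Nz_iff sym_iff)
    ultimately have "e i j = e i j'" by (simp add: inj_image_eq_iff)
    then show "j = j'" using e_inj[OF i] j by blast
  qed
  moreover have "\<phi> g i ` {1..k i} \<subseteq> {1..k i}" using \<phi>_eq(1)[OF s(1) i] s(2) by blast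
  ultimately have "bij_betw (\<phi> g i) {1..k i} {1..k i}"
    by (simp add: bij_betw_def endo_inj_surj)
  then show "\<phi> g i \<in> Sym (k i)" unfolding sym_iff by (rule bij_imp_permutes) (simp add: \<phi>_outside i)
qed (simp add: block_hom_def)

lemma \<phi>_mult:
  assumes g: "g \<in> carrier Q" and h: "h \<in> carrier Q" and i: "i \<in> {1..n}"
  shows "\<phi> (g \<otimes>\<^bsub>Q\<^esub> h) i = \<phi> g i \<circ> \<phi> h i"
proof
  obtain s where s: "s \<in> Nz" "g = {s} ** Y" using g unfolding Q_carrier by blast
  obtain t where t: "t \<in> Nz" "h = {t} ** Y" using h unfolding Q_carrier by blast
  have st: "s \<circ> t \<in> Nz"
  proof (rule NzI)
    have ss: "s \<in> Sym n" "t \<in> Sym n" using s t by (auto simp: Nz_iff)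
    then show "s \<circ> t \<in> Sym n" by (rule sym_comp)
    fix m assume m: "m \<in> {1..n}"
    have tm: "t m \<in> {1..n}" using m sym_in[OF ss(2)] by blast
    show "(s \<circ> t) ` (\<rho> `` {m}) = \<rho> `` {(s \<circ> t) m}"
      unfolding image_comp[symmetric] Nz_image[OF t(1) m] Nz_image[OF s(1) tm] by simp
  qed
  have gh: "g \<otimes>\<^bsub>Q\<^esub> h = {s \<circ> t} ** Y"
  proof -
    have "g \<otimes>\<^bsub>Q\<^esub> h = {s} ** (Y ** {t}) ** Y" by (simp only: Q_mult s(2) t(2) set_mult_assoc_sym)
    also have "Y ** {t} = {t} ** Y" using t by (simp add: Nz_iff)
    also have "{s} ** ({t} ** Y) ** Y = ({s} ** {t}) ** (Y ** Y)" by (simp only: set_mult_assoc_sym)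
    also have "{s} ** {t} = {s \<circ> t}" by (simp add: set_mult_def sym_group_mult)
    finally show ?thesis by (simp only: young_mult)
  qed
  fix j show "\<phi> (g \<otimes>\<^bsub>Q\<^esub> h) i j = (\<phi> g i \<circ> \<phi> h i) j"
  proof (cases "j \<in> {1..k i}")
    case True
    have h': "\<phi> h i j \<in> {1..k i}" unfolding t(2) by (rule \<phi>_eq(1)[OF t(1) i True])
    have "e i (\<phi> (g \<otimes>\<^bsub>Q\<^esub> h) i j) = (s \<circ> t) ` e i j" unfolding gh by (rule \<phi>_eq(2)[OF st i True])
    also have "\<dots> = s ` (t ` e i j)" by (simp only: image_comp)
    also have "t ` e i j = e i (\<phi> h i j)" unfolding t(2) by (rule \<phi>_eq(2)[OF t(1) i True, symmetric])
    also have "s ` e i (\<phi> h i j) = e i (\<phi> g i (\<phi> h i j))" unfolding s(2) by (rule \<phi>_eq(2)[OF s(1) i h', symmetric])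
    finally have "e i (\<phi> (g \<otimes>\<^bsub>Q\<^esub> h) i j) = e i (\<phi> g i (\<phi> h i j))" .
    moreover have "\<phi> (g \<otimes>\<^bsub>Q\<^esub> h) i j \<in> {1..k i}" unfolding gh by (rule \<phi>_eq(1)[OF st i True])
    moreover have "\<phi> g i (\<phi> h i j) \<in> {1..k i}" unfolding s(2) by (rule \<phi>_eq(1)[OF s(1) i h'])
    ultimately show ?thesis using e_inj[OF i] by simp
  next
    case False
    then show ?thesis by (simp add: \<phi>_outside i)
  qed
qed

text \<open>Every block appears in the enumeration of its size, so equal images mean that
  \<open>s\<close> and \<open>t\<close> move every block to the same place. Then
  \<open>inv' t \<circ> s\<close> preserves each block.\<close>

lemma \<phi>_inj: "inj_on \<phi> (carrier Q)"
proof (rule inj_onI)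
  fix g h assume g: "g \<in> carrier Q" and h: "h \<in> carrier Q" and eq: "\<phi> g = \<phi> h"
  obtain s where s: "s \<in> Nz" "g = {s} ** Y" using g unfolding Q_carrier by blast
  obtain t where t: "t \<in> Nz" "h = {t} ** Y" using h unfolding Q_carrier by blast
  have ss: "s \<in> Sym n" "t \<in> Sym n" using s t by (auto simp: Nz_iff)
  have "s ` B = t ` B" if B: "B \<in> blk" for B
  proof -
    obtain j where j: "j \<in> {1..k (card B)}" "e (card B) j = B" using e_surj[OF B] .
    have "e (card B) (\<phi> g (card B) j) = e (card B) (\<phi> h (card B) j)" by (simp only: eq)
    then show ?thesis
      unfolding s(2) t(2) \<phi>_eq(2)[OF s(1) blk_card[OF B] j(1)] \<phi>_eq(2)[OF t(1) blk_card[OF B] j(1)] j(2) .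
  qed
  note im = this
  have "inv' t \<circ> s \<in> Y"
    unfolding young_iff
  proof (intro conjI ballI)
    show "inv' t \<circ> s \<in> Sym n" using ss by (simp add: sym_comp sym_inv)
    fix m assume m: "m \<in> {1..n}"
    have "m \<in> \<rho> `` {m}" using rho_refl[OF m] by simp
    then have "s m \<in> s ` (\<rho> `` {m})" by (rule imageI)
    also have "s ` (\<rho> `` {m}) = t ` (\<rho> `` {m})" using m by (intro im) (auto simp: blk_iff)
    finally obtain w where "w \<in> \<rho> `` {m}" "s m = t w" by blast
    then show "(m, (inv' t \<circ> s) m) \<in> \<rho>" by (simp add: sym_inverses[OF ss(2)])
  qed
  then have "s \<in> {t} ** Y" by (rule in_translate[OF ss(2)])
  then show "g = h" unfolding s(2) t(2) by (rule Cos_mem_eq[OF ss])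
qed

text \<open>The tuple \<open>h\<close> prescribes for each block a target block of the same
  cardinality. Gluing arbitrary bijections between these blocks gives a permutation in the
  normalizer.\<close>

lemma \<phi>_surj: assumes h: "h \<in> H" shows "h \<in> \<phi> ` carrier Q"
proof -
  have hS: "h i \<in> Sym (k i)" if "i \<in> {1..n}" for i using h that by (rule PiE_mem)
  define tgt where "tgt B = e (card B) (h (card B) (inv_into {1..k (card B)} (e (card B)) B))" for B
  have tgt_e: "tgt (e i j) = e i (h i j)" if i: "i \<in> {1..n}" and j: "j \<in> {1..k i}" for i j
  proof -
    have "inj_on (e i) {1..k i}" using e[OF i] by (simp add: bij_betw_def)
    then show ?thesis using e_mem[OF i j] j by (simp add: tgt_def)
  qed
  have tgt: "tgt B \<in> blk" "card (tgt B) = card B" if B: "B \<in> blk" for B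
  proof -
    obtain j where j: "j \<in> {1..k (card B)}" "e (card B) j = B" using e_surj[OF B] .
    have "h (card B) j \<in> {1..k (card B)}" using j sym_in[OF hS[OF blk_card[OF B]]] by blast
    from e_mem[OF blk_card[OF B] this] show "tgt B \<in> blk" "card (tgt B) = card B"
      using tgt_e[OF blk_card[OF B] j(1)] j(2) by auto
  qed
  have tgt_inj: "B = C" if B: "B \<in> blk" and C: "C \<in> blk" and eq: "tgt B = tgt C" for B C
  proof -
    have card: "card B = card C" using tgt(2)[OF B] tgt(2)[OF C] eq by simp
    let ?i = "card B"
    note i = blk_card[OF B]
    obtain j where j: "j \<in> {1..k ?i}" "e ?i j = B" using e_surj[OF B] .
    obtain j' where j': "j' \<in> {1..k ?i}" "e ?i j' = C" using e_surj[OF C] unfolding card .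
    have "e ?i (h ?i j) = e ?i (h ?i j')" using eq tgt_e[OF i j(1)] tgt_e[OF i j'(1)] j j' by simp
    moreover have "h ?i j \<in> {1..k ?i}" "h ?i j' \<in> {1..k ?i}" using j j' sym_in[OF hS[OF i]] by blast+
    ultimately have "h ?i j = h ?i j'" using e_inj[OF i] by blast
    then have "j = j'" using sym_inverses(2)[OF hS[OF i]] by metis
    then show ?thesis using j j' by simp
  qed
  have "\<exists>f. bij_betw f B (tgt B)" if "B \<in> blk" for B
    using bij_betw_iff_card[OF blk_finite[OF that] blk_finite[OF tgt(1)[OF that]]] tgt(2)[OF that] by simp
  then obtain f where f: "\<And>B. B \<in> blk \<Longrightarrow> bij_betw (f B) B (tgt B)" by metis
  define s where "s x = (if x \<in> {1..n} then f (\<rho> `` {x}) x else x)" for x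
  have cls: "\<rho> `` {m} \<in> blk" if "m \<in> {1..n}" for m using that by (rule quotientI)
  have self: "m \<in> \<rho> `` {m}" if "m \<in> {1..n}" for m using rho_refl[OF that] by simp
  have same: "\<rho> `` {x} = B" if B: "B \<in> blk" and "x \<in> B" for x B
  proof -
    obtain m where m: "B = \<rho> `` {m}" using B unfolding blk_iff by blast
    then have "(m, x) \<in> \<rho>" using that by simp
    then show ?thesis unfolding m by (rule equiv_class_eq[OF equiv, symmetric])
  qed
  have sub: "B \<subseteq> {1..n}" if "B \<in> blk" for B by (rule in_quotient_imp_subset[OF equiv that])
  have im: "s ` B = tgt B" if B: "B \<in> blk" for B
  proof -
    have "s ` B = f B ` B" using sub[OF B] same[OF B] by (intro image_cong) (auto simp: s_def)
    then show ?thesis using f[OF B] by (simp add: bij_betw_def)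
  qed
  have s_tgt: "s x \<in> tgt (\<rho> `` {x})" if "x \<in> {1..n}" for x
    using im[OF cls[OF that]] self[OF that] by blast
  have "inj_on s {1..n}"
  proof (rule inj_onI)
    fix x y assume x: "x \<in> {1..n}" and y: "y \<in> {1..n}" and eq: "s x = s y"
    let ?B = "\<rho> `` {x}" and ?C = "\<rho> `` {y}"
    have "tgt ?B = tgt ?C"
      using same[OF tgt(1)[OF cls[OF x]] s_tgt[OF x]] same[OF tgt(1)[OF cls[OF y]] s_tgt[OF y]] eq by simp
    then have BC: "?B = ?C" by (rule tgt_inj[OF cls[OF x] cls[OF y]])
    have "inj_on (f ?B) ?B" using f[OF cls[OF x]] by (simp add: bij_betw_def)
    moreover have "f ?B x = f ?B y" using eq x y BC by (simp add: s_def)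
    ultimately show "x = y" using self[OF x] self[OF y] BC by (simp add: inj_on_def)
  qed
  moreover have "s ` {1..n} \<subseteq> {1..n}"
    using s_tgt sub[OF tgt(1)[OF cls]] by blast
  ultimately have "bij_betw s {1..n} {1..n}" by (simp add: bij_betw_def endo_inj_surj)
  then have ss: "s \<in> Sym n" unfolding sym_iff by (rule bij_imp_permutes) (simp add: s_def)
  have sN: "s \<in> Nz"
  proof (rule NzI[OF ss])
    fix m assume m: "m \<in> {1..n}"
    show "s ` (\<rho> `` {m}) = \<rho> `` {s m}"
      unfolding im[OF cls[OF m]] by (rule same[OF tgt(1)[OF cls[OF m]] s_tgt[OF m], symmetric])
  qed
  let ?g = "{s} ** Y"
  have g: "?g \<in> carrier Q" unfolding Q_carrier using sN by blast
  have "\<phi> ?g = h"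
  proof (rule PiE_ext[OF \<phi>_H[OF g] h])
    fix i assume i: "i \<in> {1..n}"
    show "\<phi> ?g i = h i"
    proof
      fix j show "\<phi> ?g i j = h i j"
      proof (cases "j \<in> {1..k i}")
        case True
        have "e i (\<phi> ?g i j) = e i (h i j)"
          using \<phi>_eq(2)[OF sN i True] im e_mem[OF i True] tgt_e[OF i True] by simp
        moreover have "h i j \<in> {1..k i}" using True sym_in[OF hS[OF i]] by blast
        ultimately show ?thesis using e_inj[OF i \<phi>_eq(1)[OF sN i True]] by blast
      next
        case False
        then have "h i j = j" using hS[OF i] by (auto simp: sym_iff permutes_def)
        then show ?thesis using False by (simp add: \<phi>_outside i)
      qed
    qed
  qed
  then show ?thesis using g by blast
qed

lemma \<phi>_bij: "bij_betw \<phi> (carrier Q) H"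
  unfolding bij_betw_def using \<phi>_inj \<phi>_H \<phi>_surj by blast

end

section \<open>The decomposition\<close>

lemma tensor_relsI:
  "x \<in> carrier M \<Longrightarrow> x' \<in> carrier M \<Longrightarrow> y \<in> carrier X \<Longrightarrow>
    basis_vec (x \<oplus>\<^bsub>M\<^esub> x', y) - basis_vec (x, y) - basis_vec (x', y) \<in> tensor_rels G M X"
  "x \<in> carrier M \<Longrightarrow> y \<in> carrier X \<Longrightarrow> y' \<in> carrier X \<Longrightarrow>
    basis_vec (x, y \<oplus>\<^bsub>X\<^esub> y') - basis_vec (x, y) - basis_vec (x, y') \<in> tensor_rels G M X"
  "x \<in> carrier M \<Longrightarrow> y \<in> carrier X \<Longrightarrow>
    basis_vec (c \<odot>\<^bsub>M\<^esub> x, y) - pscale c (basis_vec (x, y)) \<in> tensor_rels G M X"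
  "x \<in> carrier M \<Longrightarrow> y \<in> carrier X \<Longrightarrow>
    basis_vec (x, c \<odot>\<^bsub>X\<^esub> y) - pscale c (basis_vec (x, y)) \<in> tensor_rels G M X"
  "x \<in> carrier M \<Longrightarrow> g \<in> carrier G \<Longrightarrow> y \<in> carrier X \<Longrightarrow>
    basis_vec (ract M x g, y) - basis_vec (x, act X g y) \<in> tensor_rels G M X"
      apply (simp_all only: tensor_rels_def Un_iff mem_Collect_eq)
      apply blast+
  done

lemma direct_sum_simps:
  "carrier (direct_sum I M) = {f \<in> \<Pi>\<^sub>E i\<in>I. carrier (M i). finite {i\<in>I. f i \<noteq> \<zero>\<^bsub>M i\<^esub>}}"
  "f \<oplus>\<^bsub>direct_sum I M\<^esub> g = (\<lambda>i\<in>I. f i \<oplus>\<^bsub>M i\<^esub> g i)"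
  "c \<odot>\<^bsub>direct_sum I M\<^esub> f = (\<lambda>i\<in>I. c \<odot>\<^bsub>M i\<^esub> f i)"
  "act (direct_sum I M) s f = (\<lambda>i\<in>I. act (M i) s (f i))"
  by (simp_all add: direct_sum_def)

lemma carrier_direct_sum_finite: "finite I \<Longrightarrow> carrier (direct_sum I M) = (\<Pi>\<^sub>E i\<in>I. carrier (M i))"
  by (simp add: direct_sum_simps)

text \<open>The dual functionals make the vectors \<open>E t\<close> independent, so by the count no
  further independent vector fits into the free space on \<open>G\<close>. Hence \<open>f\<close>
  lies in their span, and its coefficients there are the values
  \<open>\<psi> t f = 0\<close>.\<close>

lemma dual_family:
  fixes E :: "'t \<Rightarrow> ('g \<Rightarrow>\<^sub>0 complex)" and \<psi> :: "'t \<Rightarrow> ('g \<Rightarrow>\<^sub>0 complex) \<Rightarrow> complex"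
  assumes fin: "finite T" "finite G" and card: "card G \<le> card T"
    and lin: "\<And>t x y. \<psi> t (x + y) = \<psi> t x + \<psi> t y" "\<And>t c x. \<psi> t (pscale c x) = c * \<psi> t x"
    and E: "\<And>t. t \<in> T \<Longrightarrow> E t \<in> free_on G"
    and dual: "\<And>s t. s \<in> T \<Longrightarrow> t \<in> T \<Longrightarrow> \<psi> s (E t) = (if s = t then 1 else 0)"
    and f: "f \<in> free_on G" and zero: "\<And>t. t \<in> T \<Longrightarrow> \<psi> t f = 0"
  shows "f = 0"
proof (rule ccontr)
  assume "f \<noteq> 0"
  have sum: "\<psi> t (sum h A) = (\<Sum>a\<in>A. \<psi> t (h a))" for t h and A :: "'t set"
    using lin(2)[of t 0] by (induction A rule: infinite_finite_induct) (auto simp: lin)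
  have comb: "\<psi> s (\<Sum>t\<in>T. pscale (c t) (E t)) = c s" if s: "s \<in> T" for s c
  proof -
    have "\<psi> s (\<Sum>t\<in>T. pscale (c t) (E t)) = (\<Sum>t\<in>T. if t = s then c s else 0)"
      unfolding sum lin(2) using dual s by (intro sum.cong refl) auto
    then show ?thesis using s fin by simp
  qed
  have inj: "inj_on E T" by (rule inj_onI) (metis dual zero_neq_one)
  have ind: "pm.independent (E ` T)"
  proof (rule pm.independent_if_scalars_zero)
    fix c x assume 0: "(\<Sum>x\<in>E ` T. pscale (c x) x) = 0" and x: "x \<in> E ` T"
    then obtain s where s: "s \<in> T" "x = E s" by blast
    have "(\<Sum>t\<in>T. pscale (c (E t)) (E t)) = 0" using 0 by (simp add: sum.reindex[OF inj])
    then have "c (E s) = \<psi> s 0" using comb[OF s(1), of "\<lambda>t. c (E t)"] by simp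
    then show "c x = 0" using lin(2)[of s 0 0] s by simp
  qed (simp add: fin)
  have "f \<notin> pm.span (E ` T)"
  proof
    assume "f \<in> pm.span (E ` T)"
    then obtain c where "f = (\<Sum>x\<in>E ` T. pscale (c x) x)"
      using fin pm.span_finite[of "E ` T"] by auto
    then have f: "f = (\<Sum>t\<in>T. pscale (c (E t)) (E t))" by (simp add: sum.reindex[OF inj])
    have "c (E t) = 0" if "t \<in> T" for t
      using comb[OF that, of "\<lambda>t. c (E t)"] zero[OF that] f by simp
    then show False using f \<open>f \<noteq> 0\<close> by simp
  qed
  then have "pm.independent (insert f (E ` T))" using ind by (rule pm.independent_insertI)
  moreover have "insert f (E ` T) \<subseteq> pm.span (basis_vec ` G)"
    using f E by (auto simp: free_on_eq_span[symmetric])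
  ultimately have "card (insert f (E ` T)) \<le> card (basis_vec ` G)"
    using pm.independent_span_bound[of "basis_vec ` G"] fin by blast
  also have "\<dots> \<le> card G" using fin by (intro card_image_le)
  finally have "card (insert f (E ` T)) \<le> card G" .
  moreover have "card (insert f (E ` T)) = Suc (card T)"
    using \<open>f \<notin> pm.span (E ` T)\<close> fin pm.span_base[of f "E ` T"]
    by (subst card_insert_disjoint) (auto simp: card_image[OF inj])
  ultimately show False using card by simp
qed

context block_setup
begin

section \<open>Density and faithfulness for the group algebra of the quotient\<close>

abbreviation "MP \<equiv> multipartitions n k"
abbreviation "X \<equiv> specht_multi n \<rho> e"
abbreviation "Bs \<equiv> outer_basis n k"

lemma X_simps: "carrier (X l) = pm.span (Bs l)" "add (X l) = (+)" "smult (X l) = pscale"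
  "act (X l) g = act (outer_specht n k l) (\<phi> g)"
  by (simp_all add: specht_multi_def pullback_def outer_basis) (simp_all add: outer_tensor_def sub_free_def)

lemma Bs_X: "b \<in> Bs l \<Longrightarrow> b \<in> carrier (X l)"
  unfolding X_simps by (rule pm.span_base)

lemma lin_X_act: "lin (act (X l) g)"
  unfolding X_simps by (rule lin_outer_act)

lemma X_act_closed: "g \<in> carrier Q \<Longrightarrow> v \<in> carrier (X l) \<Longrightarrow> act (X l) g v \<in> carrier (X l)"
  using outer_act_closed[OF \<phi>_H, of g v l] by (simp only: X_simps outer_basis)

lemma X_act_mult: "g \<in> carrier Q \<Longrightarrow> h \<in> carrier Q \<Longrightarrow> act (X l) (g \<otimes>\<^bsub>Q\<^esub> h) v = act (X l) g (act (X l) h v)"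
  unfolding X_simps by (rule outer_act_comp) (rule \<phi>_mult)

lemma dim_X: "pm.dim (carrier (X l)) = card (Bs l)"
  by (simp only: X_simps pm.dim_span_eq_card_independent[OF orthogonal_independent[OF outer_basis(2,1)]])

text \<open>Combine the rank one elements for \<open>b\<close> and all basis vectors
  \<open>w\<close> so that \<open>b\<close> is sent to \<open>v\<close>. All other basis vectors of
  the same module are orthogonal to \<open>b\<close> and are killed.\<close>

lemma density:
  assumes l: "l \<in> MP" and b: "b \<in> Bs l" and v: "v \<in> carrier (X l)"
  shows "\<exists>a. \<forall>m\<in>MP. \<forall>b'\<in>Bs m.
    (\<Sum>g\<in>carrier Q. pscale (a g) (act (X m) g b')) = (if m = l \<and> b' = b then v else 0)"
proof -
  have "\<forall>w\<in>Bs l. \<exists>a. \<forall>m\<in>MP. \<forall>v\<in>carrier (outer_specht n k m).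
      (\<Sum>h\<in>H. pscale (a h) (act (outer_specht n k m) h v)) = (if m = l then pscale (ip v b) w else 0)"
    by (rule ballI, rule outer_rank_one_exists[OF l b])
  from bchoice[OF this] obtain a where a: "\<And>w m v. w \<in> Bs l \<Longrightarrow> m \<in> MP \<Longrightarrow> v \<in> carrier (outer_specht n k m) \<Longrightarrow>
      (\<Sum>h\<in>H. pscale (a w h) (act (outer_specht n k m) h v)) = (if m = l then pscale (ip v b) w else 0)"
    by blast
  \<comment> \<open>The coefficients of \<open>v\<close> in the orthogonal basis, divided by the
    factor \<open>ip b b\<close> that the rank one operator produces at \<open>b\<close>.\<close>
  define c where "c w = ip v w / ip w w / ip b b" for w
  show ?thesis
  proof (intro exI ballI)
    fix m b' assume m: "m \<in> MP" and b': "b' \<in> Bs m"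
    have b'c: "b' \<in> carrier (outer_specht n k m)" using Bs_X[OF b'] by (simp only: X_simps outer_basis)
    have "(\<Sum>g\<in>carrier Q. pscale (\<Sum>w\<in>Bs l. c w * a w (\<phi> g)) (act (X m) g b'))
        = (\<Sum>h\<in>H. pscale (\<Sum>w\<in>Bs l. c w * a w h) (act (outer_specht n k m) h b'))"
      unfolding X_simps by (rule sum.reindex_bij_betw[OF \<phi>_bij])
    also have "\<dots> = (\<Sum>w\<in>Bs l. pscale (c w) (\<Sum>h\<in>H. pscale (a w h) (act (outer_specht n k m) h b')))"
      unfolding pm.scale_sum_left pm.scale_sum_right pm.scale_scale by (rule sum.swap)
    also have "\<dots> = (\<Sum>w\<in>Bs l. pscale (c w) (if m = l then pscale (ip b' b) w else 0))"
      by (intro sum.cong refl) (simp only: a[OF _ m b'c])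
    also have "\<dots> = (if m = l \<and> b' = b then v else 0)"
    proof (cases "m = l \<and> b' = b")
      case True
      have "ip b b \<noteq> 0" using b outer_basis(2)[of n k l] by (auto simp: orthogonal_set_def)
      then have "(\<Sum>w\<in>Bs l. pscale (c w) (pscale (ip b b) w)) = (\<Sum>w\<in>Bs l. pscale (ip v w / ip w w) w)"
        by (simp add: c_def)
      also have "\<dots> = v" using orthogonal_expand[OF outer_basis(2,1)] v by (simp only: X_simps)
      finally show ?thesis using True by simp
    next
      case False
      then have "m = l \<Longrightarrow> ip b' b = 0" using b b' outer_basis(2)[of n k l] by (auto simp: orthogonal_set_def)
      then show ?thesis using False by (cases "m = l") auto
    qed
    finally show "(\<Sum>g\<in>carrier Q. pscale (\<Sum>w\<in>Bs l. c w * a w (\<phi> g)) (act (X m) g b')) = (if m = l \<and> b' = b then v else 0)" .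
  qed
qed

text \<open>
  By density the matrix units lift to a linearly independent family in the group algebra; it is a
  basis by the dimension count \<open>card_outer_basis_squares\<close>.
\<close>

lemma faithful:
  assumes zero: "\<And>m b. m \<in> MP \<Longrightarrow> b \<in> Bs m \<Longrightarrow> (\<Sum>g\<in>carrier Q. pscale (a g) (act (X m) g b)) = 0"
    and g: "g \<in> carrier Q"
  shows "a g = 0"
proof -
  define T where "T = (SIGMA l:MP. Bs l \<times> Bs l)"
  \<comment> \<open>The unnormalized matrix entry of \<open>f\<close> at the pair \<open>b\<close>,
    \<open>w\<close> on the module of \<open>l\<close>.\<close>
  define \<psi> where "\<psi> = (\<lambda>(l, b, w) f. ip (\<Sum>g\<in>carrier Q. pscale (cf f g) (act (X l) g b)) w)"
  have finT: "finite T" unfolding T_def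
    by (intro finite_SigmaI finite_multipartitions finite_cartesian_product outer_basis(1))
  have nz: "ip w w \<noteq> 0" if "w \<in> Bs l" for w l
    using that outer_basis(2)[of n k l] by (auto simp: orthogonal_set_def)
  \<comment> \<open>The matrix units sending \<open>b\<close> to \<open>w\<close>, scaled by
    \<open>1 / ip w w\<close> so that they become dual to \<open>\<psi>\<close>.\<close>
  have "\<forall>t\<in>T. \<exists>a. \<forall>m\<in>MP. \<forall>b'\<in>Bs m. (\<Sum>g\<in>carrier Q. pscale (a g) (act (X m) g b'))
      = (if m = fst t \<and> b' = fst (snd t) then pscale (1 / ip (snd (snd t)) (snd (snd t))) (snd (snd t)) else 0)"
  proof (rule ballI, rule density)
    fix t assume t: "t \<in> T"
    then show "pscale (1 / ip (snd (snd t)) (snd (snd t))) (snd (snd t)) \<in> carrier (X (fst t))"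
      unfolding X_simps by (intro pm.span_scale pm.span_base) (auto simp: T_def)
    show "fst t \<in> MP" "fst (snd t) \<in> Bs (fst t)" using t by (auto simp: T_def)
  qed
  from bchoice[OF this] obtain A where A: "\<And>t m b'. t \<in> T \<Longrightarrow> m \<in> MP \<Longrightarrow> b' \<in> Bs m \<Longrightarrow>
      (\<Sum>g\<in>carrier Q. pscale (A t g) (act (X m) g b'))
      = (if m = fst t \<and> b' = fst (snd t) then pscale (1 / ip (snd (snd t)) (snd (snd t))) (snd (snd t)) else 0)"
    by blast
  define mk where "mk c = (\<Sum>g\<in>carrier Q. pscale (c g) (basis_vec g))" for c :: "(nat \<Rightarrow> nat) set \<Rightarrow> complex"
  have mk_cf: "cf (mk c) g = c g" if "g \<in> carrier Q" for c g
  proof -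
    have "cf (mk c) g = (\<Sum>h\<in>carrier Q. if h = g then c g else 0)"
      unfolding mk_def cf_sum by (intro sum.cong) (auto simp: cf_basis_vec)
    then show ?thesis using that finite_Q by simp
  qed
  have mk_free: "mk c \<in> free_on (carrier Q)" for c
    unfolding mk_def by (intro free_on_sum free_on_scale) simp
  define E where "E t = mk (A t)" for t
  have "mk a = 0"
  proof (rule dual_family[where \<psi> = \<psi> and E = E, OF finT finite_Q])
    have "card (carrier Q) = card H" by (rule bij_betw_same_card[OF \<phi>_bij])
    also have "\<dots> \<le> (\<Sum>l\<in>MP. (card (Bs l))\<^sup>2)" by (rule card_outer_basis_squares)
    also have "\<dots> = card T"
      unfolding T_def using finite_multipartitions outer_basis(1)
      by (subst card_SigmaI) (auto simp: card_cartesian_product power2_eq_square)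
    finally show "card (carrier Q) \<le> card T" .
    show "\<psi> t (x + y) = \<psi> t x + \<psi> t y" for t x y
      by (cases t) (simp add: \<psi>_def lookup_add pm.scale_left_distrib sum.distrib ip_add_left)
    show "\<psi> t (pscale c x) = c * \<psi> t x" for t c x
    proof (cases t)
      case (fields l b w)
      have "(\<Sum>g\<in>carrier Q. pscale (cf (pscale c x) g) (act (X l) g b)) = pscale c (\<Sum>g\<in>carrier Q. pscale (cf x g) (act (X l) g b))"
        by (simp add: pm.scale_sum_right)
      then show ?thesis by (simp add: fields \<psi>_def ip_scale_left)
    qed
    show "E t \<in> free_on (carrier Q)" for t by (simp add: E_def mk_free)
    show "\<psi> s (E t) = (if s = t then 1 else 0)" if s: "s \<in> T" and t: "t \<in> T" for s t
    proof -
      obtain m b' w' where s': "s = (m, b', w')" "m \<in> MP" "b' \<in> Bs m" "w' \<in> Bs m" using s by (auto simp: T_def)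
      obtain l b w where t': "t = (l, b, w)" "w \<in> Bs l" using t by (auto simp: T_def)
      have "\<psi> s (E t) = ip (\<Sum>g\<in>carrier Q. pscale (A t g) (act (X m) g b')) w'"
        by (simp add: \<psi>_def E_def s'(1) mk_cf)
      also have "\<dots> = ip (if m = l \<and> b' = b then pscale (1 / ip w w) w else 0) w'"
        using A[OF t s'(2,3)] by (simp add: t'(1))
      also have "\<dots> = (if s = t then 1 else 0)"
        using s' t' nz[OF t'(2)] outer_basis(2)[of n k l] by (auto simp: ip_scale_left orthogonal_set_def)
      finally show ?thesis .
    qed
    show "\<psi> t (mk a) = 0" if "t \<in> T" for t
      using that zero by (auto simp: T_def \<psi>_def mk_cf)
  qed (rule mk_free)
  then show ?thesis using mk_cf[OF g, of a] by simp
qed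

lemma left_module_M: "left_module FP M"
proof -
  have "Module.module complex_ring M"
    by (rule complex_moduleI)
       (auto simp: M_simps free_on_0 free_on_add free_on_scale pm.scale_left_distrib pm.scale_right_distrib ac_simps)
  then show ?thesis
    unfolding left_module_def M_simps
    by (auto simp: lin_ext_add lin_ext_scale lft_mult lft_one lin_ext_free_on lft_free)
qed

lemma tensor_setup_X: "tensor_setup FP Q M (X l)"
proof (rule tensor_setup.intro)
  show "left_module FP M" by (rule left_module_M)
  show "ract M x g \<in> carrier M" if "x \<in> carrier M" "g \<in> carrier Q" for x g
    using that unfolding M_simps by (intro lin_ext_free_on rgt_free)
  show "act M s (ract M x g) = ract M (act M s x) g"
    if "s \<in> carrier FP" "x \<in> carrier M" "g \<in> carrier Q" for s x g
    using that unfolding M_simps by (intro lft_rgt)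
  show "x \<oplus>\<^bsub>X l\<^esub> y \<in> carrier (X l)" if "x \<in> carrier (X l)" "y \<in> carrier (X l)" for x y
    using that unfolding X_simps by (rule pm.span_add)
  show "c \<odot>\<^bsub>X l\<^esub> x \<in> carrier (X l)" if "x \<in> carrier (X l)" for c x
    using that unfolding X_simps by (rule pm.span_scale)
  show "act (X l) g x \<in> carrier (X l)" if "g \<in> carrier Q" "x \<in> carrier (X l)" for g x
    using that by (rule X_act_closed)
qed

section \<open>Computing in the tensor products and constructing preimages\<close>

abbreviation "Rl l \<equiv> pm.span (tensor_rels Q M (X l))"

lemma tensor_sum_left:
  assumes "finite I" "\<And>i. i \<in> I \<Longrightarrow> x i \<in> carrier M" "y \<in> carrier (X l)"
  shows "basis_vec (\<Sum>i\<in>I. pscale (c i) (x i), y) - (\<Sum>i\<in>I. pscale (c i) (basis_vec (x i, y))) \<in> Rl l"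
  using assms
proof (induction I)
  case empty
  have "0 \<in> carrier M" by (simp add: M_simps free_on_0)
  \<comment> \<open>The relation for the scalar 0 says that a tensor with a zero factor
    vanishes.\<close>
  from tensor_relsI(3)[OF this empty(2), of 0 Q]
  have "basis_vec (0, y) \<in> tensor_rels Q M (X l)" by (simp add: M_simps)
  then show ?case by (simp add: pm.span_base)
next
  case (insert i I)
  let ?s = "\<Sum>i\<in>I. pscale (c i) (x i)" and ?x = "pscale (c i) (x i)"
  have s: "?s \<in> carrier M" "x i \<in> carrier M" "?x \<in> carrier M"
    using insert by (auto simp: M_simps intro: free_on_sum free_on_scale)
  have 1: "basis_vec (?x \<oplus>\<^bsub>M\<^esub> ?s, y) - basis_vec (?x, y) - basis_vec (?s, y) \<in> Rl l"
    by (rule pm.span_base, rule tensor_relsI) (use s insert.prems in blast)+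
  have 2: "basis_vec (c i \<odot>\<^bsub>M\<^esub> x i, y) - pscale (c i) (basis_vec (x i, y)) \<in> Rl l"
    by (rule pm.span_base, rule tensor_relsI) (use s insert.prems in blast)+
  have 3: "basis_vec (?s, y) - (\<Sum>i\<in>I. pscale (c i) (basis_vec (x i, y))) \<in> Rl l"
    using insert by blast
  from pm.span_add[OF pm.span_add[OF 1 2] 3] show ?case
    using insert by (simp add: M_simps algebra_simps)
qed

lemma tensor_sum_right:
  assumes "finite I" "\<And>i. i \<in> I \<Longrightarrow> y i \<in> carrier (X l)" "x \<in> carrier M"
  shows "basis_vec (x, \<Sum>i\<in>I. pscale (c i) (y i)) - (\<Sum>i\<in>I. pscale (c i) (basis_vec (x, y i))) \<in> Rl l"
  using assms
proof (induction I)
  case empty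
  have "0 \<in> carrier (X l)" by (simp add: X_simps pm.span_zero)
  from tensor_relsI(4)[OF empty(2) this, of 0 Q]
  have "basis_vec (x, 0) \<in> tensor_rels Q M (X l)" by (simp add: X_simps)
  then show ?case by (simp add: pm.span_base)
next
  case (insert i I)
  let ?s = "\<Sum>i\<in>I. pscale (c i) (y i)" and ?y = "pscale (c i) (y i)"
  have s: "?s \<in> carrier (X l)" "y i \<in> carrier (X l)" "?y \<in> carrier (X l)"
    using insert by (auto simp: X_simps intro!: pm.span_sum pm.span_scale)
  have 1: "basis_vec (x, ?y \<oplus>\<^bsub>X l\<^esub> ?s) - basis_vec (x, ?y) - basis_vec (x, ?s) \<in> Rl l"
    by (rule pm.span_base, rule tensor_relsI) (use s insert.prems in blast)+
  have 2: "basis_vec (x, c i \<odot>\<^bsub>X l\<^esub> y i) - pscale (c i) (basis_vec (x, y i)) \<in> Rl l"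
    by (rule pm.span_base, rule tensor_relsI) (use s insert.prems in blast)+
  have 3: "basis_vec (x, ?s) - (\<Sum>i\<in>I. pscale (c i) (basis_vec (x, y i))) \<in> Rl l"
    using insert by blast
  from pm.span_add[OF pm.span_add[OF 1 2] 3] show ?case
    using insert by (simp add: X_simps algebra_simps)
qed

lemma span_sum_diff:
  "(\<And>i. i \<in> I \<Longrightarrow> u i - v i \<in> pm.span Z) \<Longrightarrow> (\<Sum>i\<in>I. pscale (c i) (u i)) - (\<Sum>i\<in>I. pscale (c i) (v i)) \<in> pm.span Z"
  unfolding sum_subtractf[symmetric] pm.scale_right_diff_distrib[symmetric]
  by (intro pm.span_sum pm.span_scale)

lemma span_diff_trans: "u - v \<in> pm.span Z \<Longrightarrow> v - w \<in> pm.span Z \<Longrightarrow> u - w \<in> pm.span Z"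
  using pm.span_add[of "u - v" Z "v - w"] by simp

text \<open>Let \<open>a\<close> be the group algebra element from density and put
  \<open>z = x a\<close>. Moving \<open>a\<close> across the tensor sign turns
  \<open>z \<otimes> b'\<close> into \<open>x \<otimes> a b'\<close>, which is
  \<open>x \<otimes> v\<close> in one component and 0 in the others.\<close>

lemma elementary_preimage:
  assumes l: "l \<in> MP" and b: "b \<in> Bs l" and x: "x \<in> carrier M" and v: "v \<in> carrier (X l)"
  shows "\<exists>z\<in>carrier M. \<forall>m\<in>MP. \<forall>b'\<in>Bs m.
    basis_vec (z, b') - (if m = l \<and> b' = b then basis_vec (x, v) else 0) \<in> Rl m"
proof -
  obtain a where a: "\<And>m b'. m \<in> MP \<Longrightarrow> b' \<in> Bs m \<Longrightarrow>
      (\<Sum>g\<in>carrier Q. pscale (a g) (act (X m) g b')) = (if m = l \<and> b' = b then v else 0)"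
    using density[OF l b v] by blast
  let ?z = "\<Sum>g\<in>carrier Q. pscale (a g) (ract M x g)"
  have rx: "ract M x g \<in> carrier M" if "g \<in> carrier Q" for g
    using tensor_setup.ract_closed[OF tensor_setup_X x that] .
  have "?z \<in> carrier M" unfolding M_simps(1)
    by (intro free_on_sum free_on_scale) (use rx in \<open>simp add: M_simps(1)\<close>)
  moreover have "basis_vec (?z, b') - (if m = l \<and> b' = b then basis_vec (x, v) else 0) \<in> Rl m"
    if m: "m \<in> MP" and b': "b' \<in> Bs m" for m b'
  proof -
    note b'X = Bs_X[OF b']
    have 1: "basis_vec (?z, b') - (\<Sum>g\<in>carrier Q. pscale (a g) (basis_vec (ract M x g, b'))) \<in> Rl m"
      by (rule tensor_sum_left[OF finite_Q rx b'X])
    have 2: "(\<Sum>g\<in>carrier Q. pscale (a g) (basis_vec (ract M x g, b')))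
        - (\<Sum>g\<in>carrier Q. pscale (a g) (basis_vec (x, act (X m) g b'))) \<in> Rl m"
    proof (rule span_sum_diff, rule pm.span_base)
      fix g assume "g \<in> carrier Q"
      then show "basis_vec (ract M x g, b') - basis_vec (x, act (X m) g b') \<in> tensor_rels Q M (X m)"
        using x b'X by (intro tensor_relsI)
    qed
    have 3: "basis_vec (x, \<Sum>g\<in>carrier Q. pscale (a g) (act (X m) g b'))
        - (\<Sum>g\<in>carrier Q. pscale (a g) (basis_vec (x, act (X m) g b'))) \<in> Rl m"
      by (rule tensor_sum_right[OF finite_Q X_act_closed[OF _ b'X] x])
    have 3: "(\<Sum>g\<in>carrier Q. pscale (a g) (basis_vec (x, act (X m) g b'))) - basis_vec (x, if m = l \<and> b' = b then v else 0) \<in> Rl m"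
      using pm.span_neg[OF 3] unfolding a[OF m b'] by simp
    have "basis_vec (x, 0) \<in> Rl m"
      using tensor_sum_right[of "{}" _ m x] x by simp
    then have 4: "basis_vec (x, if m = l \<and> b' = b then v else 0) - (if m = l \<and> b' = b then basis_vec (x, v) else 0) \<in> Rl m"
      by (simp add: pm.span_zero)
    show ?thesis by (rule span_diff_trans[OF span_diff_trans[OF span_diff_trans[OF 1 2] 3] 4])
  qed
  ultimately show ?thesis by blast
qed

text \<open>Each prescribed representative is a finite combination of elementary tensors, so the
  same combination of elementary preimages works.\<close>

lemma preimage:
  assumes f: "\<And>l b. l \<in> MP \<Longrightarrow> b \<in> Bs l \<Longrightarrow> f l b \<in> free_on (carrier M \<times> carrier (X l))"
  shows "\<exists>z\<in>carrier M. \<forall>m\<in>MP. \<forall>b'\<in>Bs m. basis_vec (z, b') - f m b' \<in> Rl m"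
proof -
  define I where "I = (SIGMA l:MP. SIGMA b:Bs l. Poly_Mapping.keys (f l b))"
  have finI: "finite I"
    unfolding I_def by (intro finite_SigmaI finite_multipartitions outer_basis(1)) simp
  have "\<exists>z\<in>carrier M. \<forall>m\<in>MP. \<forall>b'\<in>Bs m.
      basis_vec (z, b') - (if m = l \<and> b' = b then basis_vec p else 0) \<in> Rl m" if "(l, b, p) \<in> I" for l b p
  proof -
    have lb: "l \<in> MP" "b \<in> Bs l" "p \<in> Poly_Mapping.keys (f l b)" using that by (auto simp: I_def)
    then have "p \<in> carrier M \<times> carrier (X l)" using f[OF lb(1,2)] by (auto simp: free_on_def)
    then obtain x v where p: "p = (x, v)" "x \<in> carrier M" "v \<in> carrier (X l)" by blast
    show ?thesis unfolding p(1) by (rule elementary_preimage[OF lb(1,2) p(2,3)])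
  qed
  then obtain z where z: "\<And>l b p. (l, b, p) \<in> I \<Longrightarrow> z l b p \<in> carrier M"
    "\<And>l b p m b'. (l, b, p) \<in> I \<Longrightarrow> m \<in> MP \<Longrightarrow> b' \<in> Bs m \<Longrightarrow>
      basis_vec (z l b p, b') - (if m = l \<and> b' = b then basis_vec p else 0) \<in> Rl m"
    by metis
  define c where "c = (\<lambda>(l, b, p). cf (f l b) p)"
  define zz where "zz = (\<lambda>(l, b, p). z l b p)"
  let ?z = "\<Sum>i\<in>I. pscale (c i) (zz i)"
  have zzM: "zz i \<in> carrier M" if "i \<in> I" for i using that z(1) by (cases i) (simp add: zz_def)
  have "?z \<in> carrier M" unfolding M_simps(1)
    by (intro free_on_sum free_on_scale) (use zzM in \<open>simp add: M_simps(1)\<close>)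
  moreover have "basis_vec (?z, b') - f m b' \<in> Rl m" if m: "m \<in> MP" and b': "b' \<in> Bs m" for m b'
  proof -
    let ?d = "\<lambda>(l, b, p). if m = l \<and> b' = b then basis_vec p else 0"
    have 1: "basis_vec (?z, b') - (\<Sum>i\<in>I. pscale (c i) (basis_vec (zz i, b'))) \<in> Rl m"
      by (rule tensor_sum_left[OF finI zzM Bs_X[OF b']])
    have 2: "(\<Sum>i\<in>I. pscale (c i) (basis_vec (zz i, b'))) - (\<Sum>i\<in>I. pscale (c i) (?d i)) \<in> Rl m"
    proof (rule span_sum_diff)
      fix i assume "i \<in> I"
      then show "basis_vec (zz i, b') - ?d i \<in> Rl m" using z(2)[OF _ m b'] by (cases i) (simp add: zz_def)
    qed
    have "(\<Sum>i\<in>I. pscale (c i) (?d i)) = (\<Sum>i\<in>(\<lambda>p. (m, b', p)) ` Poly_Mapping.keys (f m b'). pscale (c i) (?d i))"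
      using finI m b' by (intro sum.mono_neutral_right) (auto simp: I_def split: if_splits)
    also have "\<dots> = (\<Sum>p\<in>Poly_Mapping.keys (f m b'). pscale (cf (f m b') p) (basis_vec p))"
      by (subst sum.reindex) (auto simp: inj_on_def c_def)
    also have "\<dots> = f m b'" using pm_expand[of "Poly_Mapping.keys (f m b')" "f m b'"] by simp
    finally show ?thesis using span_diff_trans[OF 1 2] by simp
  qed
  ultimately show ?thesis by blast
qed

text \<open>Restricts \<open>y\<close> to the G-orbit of the coset \<open>r\<close> and lets the
  resulting group algebra element act on \<open>v\<close>. On tensors this is the coordinate, with
  values in the module of \<open>l\<close>, at the orbit representative \<open>r\<close>.\<close>

definition coeff_map :: "(nat \<Rightarrow> nat list) \<Rightarrow> (nat \<Rightarrow> nat) set \<Rightarrow>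
    (((nat \<Rightarrow> nat) set \<Rightarrow>\<^sub>0 complex) \<times> ((nat \<Rightarrow> (nat \<times> nat \<Rightarrow> nat) set) \<Rightarrow>\<^sub>0 complex) \<Rightarrow>\<^sub>0 complex) \<Rightarrow>
    ((nat \<Rightarrow> (nat \<times> nat \<Rightarrow> nat) set) \<Rightarrow>\<^sub>0 complex)"
  where "coeff_map l r = lin_ext (\<lambda>(y, v). \<Sum>g\<in>carrier Q. pscale (cf y (r ** g)) (act (X l) g v))"

text \<open>The first four kinds of relations vanish by bilinearity. For the last kind, reindexing
  by right multiplication with \<open>h\<close> moves \<open>h\<close> from the coset side to the
  module side.\<close>

lemma coeff_map_Rl:
  assumes r: "r \<in> Cos" and f: "f \<in> Rl l" shows "coeff_map l r f = 0"
proof -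
  have L: "lin (coeff_map l r)" unfolding coeff_map_def by (rule lin_lin_ext)
  have bas: "coeff_map l r (basis_vec (y, v)) = (\<Sum>g\<in>carrier Q. pscale (cf y (r ** g)) (act (X l) g v))" for y v
    by (simp add: coeff_map_def)
  have "coeff_map l r u = 0" if u: "u \<in> tensor_rels Q M (X l)" for u
  proof -
    consider
      (a) x x' y where "u = basis_vec (x + x', y) - basis_vec (x, y) - basis_vec (x', y)"
      | (b) x y y' where "u = basis_vec (x, y + y') - basis_vec (x, y) - basis_vec (x, y')"
      | (c) c x y where "u = basis_vec (pscale c x, y) - pscale c (basis_vec (x, y))"
      | (d) c x y where "u = basis_vec (x, pscale c y) - pscale c (basis_vec (x, y))"
      | (e) x h y where "u = basis_vec (ract M x h, y) - basis_vec (x, act (X l) h y)" "x \<in> carrier M" "h \<in> carrier Q"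
      using u unfolding tensor_rels_def M_simps(3,4) X_simps(2,3) by blast
    then show ?thesis
    proof cases
      case a
      then show ?thesis
        by (simp add: pmm.linear_diff[OF L] bas lookup_add pm.scale_left_distrib sum.distrib)
    next
      case b
      then show ?thesis
        by (simp add: pmm.linear_diff[OF L] bas pmm.linear_add[OF lin_X_act] pm.scale_right_distrib sum.distrib)
    next
      case c
      then show ?thesis
        by (simp add: pmm.linear_diff[OF L] pmm.linear_scale[OF L] bas pm.scale_sum_right)
    next
      case d
      then show ?thesis
        by (simp add: pmm.linear_diff[OF L] pmm.linear_scale[OF L] bas pmm.linear_scale[OF lin_X_act] pm.scale_sum_right mult.commute)
    next
      case e
      have bij: "bij_betw (\<lambda>g. g \<otimes>\<^bsub>Q\<^esub> h) (carrier Q) (carrier Q)"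
        by (rule bij_betw_byWitness[where f' = "\<lambda>g. g \<otimes>\<^bsub>Q\<^esub> inv\<^bsub>Q\<^esub> h"]) (use e(3) in \<open>auto simp: Q.m_assoc\<close>)
      have "coeff_map l r (basis_vec (ract M x h, y))
          = (\<Sum>g\<in>carrier Q. pscale (cf (ract M x h) (r ** (g \<otimes>\<^bsub>Q\<^esub> h))) (act (X l) (g \<otimes>\<^bsub>Q\<^esub> h) y))"
        unfolding bas by (rule sum.reindex_bij_betw[OF bij, symmetric])
      also have "\<dots> = (\<Sum>g\<in>carrier Q. pscale (cf x (r ** g)) (act (X l) g (act (X l) h y)))"
      proof (intro sum.cong refl)
        fix g assume g: "g \<in> carrier Q"
        have "cf (ract M x h) (r ** (g \<otimes>\<^bsub>Q\<^esub> h)) = cf x (r ** g)"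
          using rgt_lookup[of x h "r ** g"] e g Cos_act[OF r g] by (simp add: M_simps Q_mult set_mult_assoc_sym)
        then show "pscale (cf (ract M x h) (r ** (g \<otimes>\<^bsub>Q\<^esub> h))) (act (X l) (g \<otimes>\<^bsub>Q\<^esub> h) y) = pscale (cf x (r ** g)) (act (X l) g (act (X l) h y))"
          using X_act_mult[OF g e(3)] by simp
      qed
      finally show ?thesis by (simp add: e(1) pmm.linear_diff[OF L] bas)
    qed
  qed
  then show ?thesis by (rule pmm.linear_eq_0_on_span[OF L _ f])
qed

text \<open>Applying \<open>coeff_map\<close> at \<open>r\<close> shows that the group algebra
  element with coefficients \<open>cf (x - y) (r ** g)\<close> annihilates all basis vectors.
  Faithfulness makes it 0, and \<open>g = 1\<close> gives the coefficient at \<open>r\<close>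
  itself.\<close>

lemma separation:
  assumes x: "x \<in> carrier M" and y: "y \<in> carrier M"
    and eq: "\<And>l b. l \<in> MP \<Longrightarrow> b \<in> Bs l \<Longrightarrow> basis_vec (x, b) - basis_vec (y, b) \<in> Rl l"
  shows "x = y"
proof -
  have "cf (x - y) r = 0" if r: "r \<in> Cos" for r
  proof -
    have "(\<Sum>g\<in>carrier Q. pscale (cf (x - y) (r ** g)) (act (X l) g b)) = 0" if l: "l \<in> MP" and b: "b \<in> Bs l" for l b
    proof -
      have "coeff_map l r (basis_vec (x, b) - basis_vec (y, b)) = 0" by (rule coeff_map_Rl[OF r eq[OF l b]])
      then show ?thesis
        by (simp add: coeff_map_def lin_ext_diff lookup_minus pm.scale_left_diff_distrib sum_subtractf)
    qed
    from faithful[OF this Q.one_closed] show ?thesis using r by (simp add: Q_one Cos_young)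
  qed
  moreover have "cf (x - y) r = 0" if "r \<notin> Cos" for r
  proof -
    have "x - y \<in> free_on Cos" using x y by (simp add: M_simps free_on_diff)
    then show ?thesis using that by (auto simp: free_on_def in_keys_iff)
  qed
  ultimately have "x - y = 0" by (intro poly_mapping_eqI) (metis lookup_zero)
  then show ?thesis by simp
qed

theorem decomposition:
  "left_module_iso FP M (direct_sum MP (\<lambda>l. copies (pm.dim (carrier (X l))) (induced_module n \<rho> (X l))))"
proof -
  let ?d = "\<lambda>l. card (Bs l)"
  let ?T = "\<lambda>l. tensor_over Q M (X l)"
  let ?D = "direct_sum MP (\<lambda>l. copies (?d l) (?T l))"
  let ?cl = "\<lambda>l. tensor_setup.tcl Q M (X l)"
  let ?W = "\<lambda>l. free_on (carrier M \<times> carrier (X l))"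
  have Tm: "left_module FP (?T l)" for l
    by (rule tensor_setup.left_module_tensor[OF tensor_setup_X monoid_fp_monoid])
  have Dm: "left_module FP ?D" by (intro left_module_direct_sum left_module_copies Tm)
  \<comment> \<open>Copies are indexed by numbers below the dimension, so each basis is
    enumerated.\<close>
  have "\<exists>\<beta>. bij_betw \<beta> {..<?d l} (Bs l)" for l
    using ex_bij_betw_nat_finite[OF outer_basis(1)] by (simp add: atLeast0LessThan)
  then obtain \<beta> where \<beta>: "\<And>l. bij_betw (\<beta> l) {..<?d l} (Bs l)" by metis
  have \<beta>B: "\<beta> l j \<in> Bs l" if "j < ?d l" for l j using \<beta>[of l] that by (auto simp: bij_betw_def)
  define F where "F x = (\<lambda>l\<in>MP. \<lambda>j\<in>{..<?d l}. ?cl l (basis_vec (x, \<beta> l j)))" for x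
  have bW: "basis_vec (x, \<beta> l j) \<in> ?W l" if "x \<in> carrier M" "j < ?d l" for x l j
    using that Bs_X[OF \<beta>B] by simp
  have car: "carrier ?D = (\<Pi>\<^sub>E l\<in>MP. \<Pi>\<^sub>E j\<in>{..<?d l}. ?cl l ` ?W l)"
    by (simp only: carrier_direct_sum_finite finite_multipartitions finite_lessThan copies_def tensor_setup.T_carrier[OF tensor_setup_X])
  have ops: "f \<oplus>\<^bsub>?D\<^esub> g = (\<lambda>l\<in>MP. \<lambda>j\<in>{..<?d l}. f l j \<oplus>\<^bsub>?T l\<^esub> g l j)"
    "c \<odot>\<^bsub>?D\<^esub> f = (\<lambda>l\<in>MP. \<lambda>j\<in>{..<?d l}. c \<odot>\<^bsub>?T l\<^esub> f l j)"
    "act ?D s f = (\<lambda>l\<in>MP. \<lambda>j\<in>{..<?d l}. act (?T l) s (f l j))" for f g c s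
    by (simp_all only: direct_sum_simps copies_def)
  have "bij_betw F (carrier M) (carrier ?D)"
  proof (rule bij_betw_imageI)
    show "inj_on F (carrier M)"
    proof (rule inj_onI)
      fix x y assume x: "x \<in> carrier M" and y: "y \<in> carrier M" and eq: "F x = F y"
      show "x = y"
      proof (rule separation[OF x y])
        fix l b assume l: "l \<in> MP" and b: "b \<in> Bs l"
        then obtain j where j: "j < ?d l" "b = \<beta> l j" using \<beta>[of l] by (auto simp: bij_betw_def)
        have "?cl l (basis_vec (x, \<beta> l j)) = ?cl l (basis_vec (y, \<beta> l j))"
          using fun_cong[OF fun_cong[OF eq, of l], of j] l j by (simp add: F_def)
        then show "basis_vec (x, b) - basis_vec (y, b) \<in> Rl l"
          using tensor_setup.tcl_eq[OF tensor_setup_X bW[OF x j(1)] bW[OF y j(1)]] j(2) by simp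
      qed
    qed
    show "F ` carrier M = carrier ?D"
    proof (intro equalityI subsetI)
      fix t assume "t \<in> F ` carrier M"
      then obtain x where x: "x \<in> carrier M" "t = F x" by blast
      show "t \<in> carrier ?D" unfolding car x(2) F_def
        by (intro restrict_PiE_iff[THEN iffD2] ballI imageI bW[OF x(1)]) simp
    next
      fix t assume t: "t \<in> carrier ?D"
      have "\<exists>f. f \<in> ?W l \<and> t l j = ?cl l f" if "l \<in> MP" "j < ?d l" for l j
        using PiE_mem[OF PiE_mem[OF t[unfolded car] that(1)], of j] that(2) by auto
      then obtain f0 where f0: "\<And>l j. l \<in> MP \<Longrightarrow> j < ?d l \<Longrightarrow> f0 l j \<in> ?W l"
        "\<And>l j. l \<in> MP \<Longrightarrow> j < ?d l \<Longrightarrow> t l j = ?cl l (f0 l j)" by metis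
      \<comment> \<open>The chosen representatives, reindexed by basis vectors instead of their
        numbers, as \<open>preimage\<close> expects.\<close>
      define f where "f l b = f0 l (inv_into {..<?d l} (\<beta> l) b)" for l b
      have f\<beta>: "f l (\<beta> l j) = f0 l j" if "j < ?d l" for l j
        using \<beta>[of l] that by (simp add: f_def bij_betw_def)
      have "f l b \<in> ?W l" if lb: "l \<in> MP" "b \<in> Bs l" for l b
      proof -
        have "b \<in> \<beta> l ` {..<?d l}" using \<beta>[of l] lb by (simp add: bij_betw_def)
        then obtain j where "j < ?d l" "b = \<beta> l j" by blast
        then show ?thesis using f\<beta> f0(1)[OF lb(1)] by simp
      qed
      then obtain z where z: "z \<in> carrier M" "\<And>m b. m \<in> MP \<Longrightarrow> b \<in> Bs m \<Longrightarrow> basis_vec (z, b) - f m b \<in> Rl m"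
        using preimage[of f] by blast
      have eq: "F z l j = t l j" if l: "l \<in> MP" and j: "j < ?d l" for l j
      proof -
        have "basis_vec (z, \<beta> l j) - f0 l j \<in> Rl l" using z(2)[OF l \<beta>B[OF j]] f\<beta>[OF j] by simp
        then have "?cl l (basis_vec (z, \<beta> l j)) = ?cl l (f0 l j)"
          using tensor_setup.tcl_eq[OF tensor_setup_X bW[OF z(1) j] f0(1)[OF l j]] by simp
        then show ?thesis using l j f0(2) by (simp add: F_def)
      qed
      have Fz: "F z \<in> carrier ?D" unfolding car F_def
        by (intro restrict_PiE_iff[THEN iffD2] ballI imageI bW[OF z(1)]) simp
      have "F z = t"
      proof (rule PiE_ext[OF Fz[unfolded car] t[unfolded car]])
        fix l assume l: "l \<in> MP"
        show "F z l = t l"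
          by (rule PiE_ext[OF PiE_mem[OF Fz[unfolded car] l] PiE_mem[OF t[unfolded car] l]])
            (simp add: eq[OF l])
      qed
      then show "t \<in> F ` carrier M" using z(1) by blast
    qed
  qed
  moreover have "F (x \<oplus>\<^bsub>M\<^esub> y) = F x \<oplus>\<^bsub>?D\<^esub> F y" if x: "x \<in> carrier M" and y: "y \<in> carrier M" for x y
  proof -
    have "?cl l (basis_vec (x \<oplus>\<^bsub>M\<^esub> y, \<beta> l j)) = ?cl l (basis_vec (x, \<beta> l j)) \<oplus>\<^bsub>?T l\<^esub> ?cl l (basis_vec (y, \<beta> l j))"
      if j: "j < ?d l" for l j
    proof -
      have "basis_vec (x \<oplus>\<^bsub>M\<^esub> y, \<beta> l j) - basis_vec (x, \<beta> l j) - basis_vec (y, \<beta> l j) \<in> Rl l"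
        using x y Bs_X[OF \<beta>B[OF j]] by (intro pm.span_base tensor_relsI)
      then have "basis_vec (x \<oplus>\<^bsub>M\<^esub> y, \<beta> l j) - (basis_vec (x, \<beta> l j) + basis_vec (y, \<beta> l j)) \<in> Rl l"
        by (simp add: algebra_simps)
      then show ?thesis
        unfolding tensor_setup.T_add[OF tensor_setup_X bW[OF x j] bW[OF y j]]
          tensor_setup.tcl_eq[OF tensor_setup_X bW[OF left_moduleD(2)[OF left_module_M x y] j]
            free_on_add[OF bW[OF x j] bW[OF y j]]] .
    qed
    then show ?thesis unfolding ops F_def by (intro restrict_ext) simp
  qed
  moreover have "F (c \<odot>\<^bsub>M\<^esub> x) = c \<odot>\<^bsub>?D\<^esub> F x" if x: "x \<in> carrier M" for c x
  proof -
    have "?cl l (basis_vec (c \<odot>\<^bsub>M\<^esub> x, \<beta> l j)) = c \<odot>\<^bsub>?T l\<^esub> ?cl l (basis_vec (x, \<beta> l j))"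
      if j: "j < ?d l" for l j
    proof -
      have "basis_vec (c \<odot>\<^bsub>M\<^esub> x, \<beta> l j) - pscale c (basis_vec (x, \<beta> l j)) \<in> Rl l"
        using x Bs_X[OF \<beta>B[OF j]] by (intro pm.span_base tensor_relsI)
      then show ?thesis
        unfolding tensor_setup.T_smult[OF tensor_setup_X bW[OF x j]]
          tensor_setup.tcl_eq[OF tensor_setup_X bW[OF left_moduleD(7)[OF left_module_M x] j] free_on_scale[OF bW[OF x j]]] .
    qed
    then show ?thesis unfolding ops F_def by (intro restrict_ext) simp
  qed
  moreover have "F (act M s x) = act ?D s (F x)" if s: "s \<in> carrier FP" and x: "x \<in> carrier M" for s x
    unfolding ops F_def
    by (intro restrict_ext) (simp add: tensor_setup.T_act[OF tensor_setup_X s bW[OF x]])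
  ultimately have "left_module_iso FP M ?D"
    unfolding left_module_iso_def using left_module_M Dm by blast
  then show ?thesis by (simp add: dim_X induced_module_def)
qed

end

theorem corollary16:
  fixes n :: nat and \<rho> :: "(nat \<times> nat) set" and e :: "nat \<Rightarrow> nat \<Rightarrow> nat set"
  assumes "n \<ge> 1"
    and "equiv {1..n} \<rho>"
    and "\<And>i. i \<in> {1..n} \<Longrightarrow>
           bij_betw (e i) {1..block_count n \<rho> i} (blocks_of_size n \<rho> i)"
  shows "left_module_iso (fp_monoid n)
           (coset_bimodule n \<rho>)
           (direct_sum (multipartitions n (block_count n \<rho>))
              (\<lambda>l. copies (pm.dim (carrier (specht_multi n \<rho> e l)))
                     (induced_module n \<rho> (specht_multi n \<rho> e l))))"
proof -
  interpret block_setup n \<rho> e 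
    by (intro block_setup.intro young_setup.intro block_setup_axioms.intro assms(2,3))
  show ?thesis by (rule decomposition)
qed

end
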